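(* Let $n\ge1$ and let $\hat h_n$ be a strictly positive function on $W^n$ with $\hat P^n_t\hat h_n=e^{c t}\hat h_n$ for all $t\ge0$ (some constant $c$). Put $h_{n+1}=\Lambda_{n,n+1}\hat h_n$ on $W^{n+1}$. Then $\hat h_n$ (viewed as the function $(x,y)\mapsto\hat h_n(y)$) satisfies $\mathsf Q^{n,n+1}_t\hat h_n=e^{ct}\hat h_n$, $h_{n+1}$ is a strictly positive eigenfunction of $P^{n+1}_t$ with eigenvalue $e^{ct}$, and for all $t\ge0$ $$P^{n+1,h_{n+1}}_t\Lambda^{\hat h_n}_{n,n+1}=\Lambda^{\hat h_n}_{n,n+1}\mathsf Q^{n,n+1,\hat h_n}_t,\qquad P^{n+1,h_{n+1}}_t\Lambda^{\hat h_n}_{n,n+1}=\Lambda^{\hat h_n}_{n,n+1}\hat P^{n,\hat h_n}_t,$$ where in the second identity $\Lambda^{\hat h_n}_{n,n+1}$ is viewed as a kernel from $W^{n+1}$ to $W^n$ (acting on functions of $y$ only).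
   Context: Let $I=\mathbb N=\{0,1,2,\dots\}$ (with $l=0$) or $I=\mathbb Z$ (with $l=-\infty$). Let $\lambda,\mu:I\to[0,\infty)$ with $\lambda(x)>0$ and $\mu(x)>0$ for all $x\in I$, except that $\mu(0)=0$ when $I=\mathbb N$. Put $\pi(0)=1$, $\pi(x)=\prod_{i=1}^{x}\lambda(i-1)/\mu(i)$ for $x\ge1$ and $\pi(x)=\prod_{i=1}^{-x}\mu(x+i)/\lambda(x+i-1)$ for $x\le-1$. Assume $\pm\infty$ are natural boundaries: if $I=\mathbb N$, $\sum_{j\ge0}\frac{1}{\lambda(j)\pi(j)}\sum_{i=0}^{j}\pi(i)=\infty$ and $\sum_{j\ge0}\frac{1}{\lambda(j)\pi(j)}\sum_{i>j}\pi(i)=\infty$; if $I=\mathbb Z$, $\sum_{j\ge1}\frac{1}{\lambda(j)\pi(j)}\sum_{i=1}^{j}\pi(i)=\infty$, $\sum_{j\ge1}\pi(j)\sum_{i=1}^{j-1}\frac{1}{\lambda(i)\pi(i)}=\infty$, $\sum_{j\le-1}\frac{1}{\lambda(j)\pi(j)}\sum_{i=j+1}^{-1}\pi(i)=\infty$, $\sum_{j\le -1}\pi(j)\sum_{i=j}^{-1}\frac{1}{\lambda(i)\pi(i)}=\infty$. The $\mathcal D$-chain is the continuous-time Markov chain on $I$ jumping $x\to x+1$ at rate $\lambda(x)$ and $x\to x-1$ at rate $\mu(x)$; $p_t(x,y)$ denotes its transition probabilities and $P_t\mathbf 1_{[l,y]}(x)=\sum_{l\le w\le y}p_t(x,w)$.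 Its Siegmund dual, the $\hat{\mathcal D}$-chain, has rates $\hat\lambda(x)=\mu(x+1)$ (for $x\to x+1$) and $\hat\mu(x)=\lambda(x)$ (for $x\to x-1$); when $I=\mathbb N$ it lives on $\{-1,0,1,\dots\}$ and is absorbed at $-1$. $\hat p_t(x,y)$, $x,y\in I$, denotes its transition probabilities restricted to $I$ (equivalently, those of the chain killed at $-1$). $\hat\pi(0)=1$, $\hat\pi(x)=\prod_{i=1}^x\mu(i)/\lambda(i)$ for $x\ge1$, $\hat\pi(x)=\prod_{i=1}^{-x}\lambda(x+i)/\mu(x+i)$ for $x\le-1$. $W^n=\{x\in I^n:x_1<\dots<x_n\}$; for $x\in W^{n+1}$, $W^{n,n+1}(x)=\{y\in W^n:x_1\le y_1<x_2\le y_2<\dots\le y_n<x_{n+1}\}$; $W^{n,n+1}=\{(x,y):x\in W^{n+1},y\in W^{n,n+1}(x)\}$. Karlin–McGregor kernels: $P^n_t(x,y)=\det(p_t(x_i,y_j))_{i,j=1}^n$, $\hat P^n_t(x,y)=\det(\hat p_t(x_i,y_j))_{i,j=1}^n$ on $W^n$. $\Lambda_{n,n+1}$ is the kernel $\Lambda_{n,n+1}(x,y)=\prod_{i=1}^n\hat\pi(y_i)\mathbf 1(y\in W^{n,n+1}(x))$. For $(x,y),(x',y')\in W^{n,n+1}$ and $t\ge0$, $\mathsf q^{n,n+1}_t((x,y),(x',y'))$ is the determinant of the $(2n+1)\times(2n+1)$ block matrix $\begin{pmatrix}\mathsf A&\mathsf B\\ \mathsf C&\mathsf D\end{pmatrix}$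 with $\mathsf A_{ij}=p_t(x_i,x'_j)$ ($1\le i,j\le n+1$), $\mathsf B_{ij}=\hat\pi(y'_j)\big(P_t\mathbf 1_{[l,y'_j]}(x_i)-\mathbf 1(j\ge i)\big)$ ($1\le i\le n+1,1\le j\le n$), $\mathsf C_{ij}=\hat\pi(y_i)^{-1}\big(p_t(y_i,x'_j)-p_t(y_i+1,x'_j)\big)$ ($1\le i\le n,1\le j\le n+1$), $\mathsf D_{ij}=\hat p_t(y_i,y'_j)$; $\mathsf Q^{n,n+1}_t$ is the operator with kernel $\mathsf q^{n,n+1}_t$ on $W^{n,n+1}$. Doob transforms: for a kernel semigroup $K_t$ with strictly positive eigenfunction $h$, $K_th=e^{ct}h$, set $K^h_t(a,b)=e^{-ct}h(b)K_t(a,b)/h(a)$. Thus $P^{n+1,h_{n+1}}_t$, $\hat P^{n,\hat h_n}_t$, and $\mathsf Q^{n,n+1,\hat h_n}_t((x,y),(x',y'))=e^{-ct}\frac{\hat h_n(y')}{\hat h_n(y)}\mathsf q^{n,n+1}_t((x,y),(x',y'))$. The Markov kernel $\Lambda^{\hat h_n}_{n,n+1}$ from $W^{n+1}$ to $W^{n,n+1}$ is $\Lambda^{\hat h_n}_{n,n+1}(x,(x,y))=\frac{1}{h_{n+1}(x)}\prod_{i=1}^n\hat\pi(y_i)\hat h_n(y)$ for $y\in W^{n,n+1}(x)$ (and zero on pairs with first coordinate different from $x$). *)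

theory Defs
  imports "HOL-Analysis.Analysis"
begin

text \<open>States are integers; I is either {0..} (the case I = N) or UNIV (the case I = Z).
  lam and mu are the up and down rates of the D-chain.\<close>

definition bd_setting :: "int set \<Rightarrow> (int \<Rightarrow> real) \<Rightarrow> (int \<Rightarrow> real) \<Rightarrow> bool" where
  "bd_setting I lam mu \<longleftrightarrow>
     ((I = {0..} \<and> mu 0 = 0 \<and> (\<forall>x\<in>I. lam x > 0) \<and> (\<forall>x\<in>I. x \<noteq> 0 \<longrightarrow> mu x > 0))
      \<or> (I = UNIV \<and> (\<forall>x. lam x > 0) \<and> (\<forall>x. mu x > 0)))"

definition pi_D :: "(int \<Rightarrow> real) \<Rightarrow> (int \<Rightarrow> real) \<Rightarrow> int \<Rightarrow> real" where
  "pi_D lam mu x =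
     (if x = 0 then 1
      else if x \<ge> 1 then (\<Prod>i\<in>{1..x}. lam (i - 1) / mu i)
      else (\<Prod>i\<in>{1..-x}. mu (x + i) / lam (x + i - 1)))"

definition hpi :: "(int \<Rightarrow> real) \<Rightarrow> (int \<Rightarrow> real) \<Rightarrow> int \<Rightarrow> real" where
  "hpi lam mu x =
     (if x = 0 then 1
      else if x \<ge> 1 then (\<Prod>i\<in>{1..x}. mu i / lam i)
      else (\<Prod>i\<in>{1..-x}. lam (x + i) / mu (x + i)))"

text \<open>Natural boundaries at \<plusminus>\<infinity> (sums of nonnegative terms, computed in ennreal,
  so that "= \<infinity>" means divergence).\<close>

definition natural_boundaries :: "int set \<Rightarrow> (int \<Rightarrow> real) \<Rightarrow> (int \<Rightarrow> real) \<Rightarrow> bool" where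
  "natural_boundaries I lam mu \<longleftrightarrow>
    (let \<pi> = pi_D lam mu in
     (I = {0..} \<longrightarrow>
        (\<Sum>j. ennreal (1 / (lam (int j) * \<pi> (int j))) * ennreal (\<Sum>i\<in>{0..int j}. \<pi> i)) = \<infinity>
      \<and> (\<Sum>j. ennreal (1 / (lam (int j) * \<pi> (int j))) * (\<Sum>k. ennreal (\<pi> (int j + 1 + int k)))) = \<infinity>)
   \<and> (I = UNIV \<longrightarrow>
        (\<Sum>k. let j = int k + 1 in ennreal (1 / (lam j * \<pi> j)) * ennreal (\<Sum>i\<in>{1..j}. \<pi> i)) = \<infinity>
      \<and> (\<Sum>k. let j = int k + 1 in ennreal (\<pi> j) * ennreal (\<Sum>i\<in>{1..j-1}. 1 / (lam i * \<pi> i))) = \<infinity>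
      \<and> (\<Sum>k. let j = - int k - 1 in ennreal (1 / (lam j * \<pi> j)) * ennreal (\<Sum>i\<in>{j+1..-1}. \<pi> i)) = \<infinity>
      \<and> (\<Sum>k. let j = - int k - 1 in ennreal (\<pi> j) * ennreal (\<Sum>i\<in>{j..-1}. 1 / (lam i * \<pi> i))) = \<infinity>))"

text \<open>Birth--death chain on the state set S with up rate a and down rate b; a jump leaving
  S kills the chain.  bd_iter k t x y is the probability of being at y at time t after
  exactly k jumps (backward recursion on the first jump time); the transition function
  is the sum over k (the minimal solution of the Kolmogorov equations).\<close>

fun bd_iter :: "int set \<Rightarrow> (int \<Rightarrow> real) \<Rightarrow> (int \<Rightarrow> real) \<Rightarrow> nat \<Rightarrow> real \<Rightarrow> int \<Rightarrow> int \<Rightarrow> real" where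
  "bd_iter S a b 0 t x y = (if x = y then exp (- (a x + b x) * t) else 0)"
| "bd_iter S a b (Suc k) t x y =
     integral {0..t} (\<lambda>s. exp (- (a x + b x) * s) *
        ((if x + 1 \<in> S then a x * bd_iter S a b k (t - s) (x + 1) y else 0)
       + (if x - 1 \<in> S then b x * bd_iter S a b k (t - s) (x - 1) y else 0)))"

definition bd_trans :: "int set \<Rightarrow> (int \<Rightarrow> real) \<Rightarrow> (int \<Rightarrow> real) \<Rightarrow> real \<Rightarrow> int \<Rightarrow> int \<Rightarrow> real" where
  "bd_trans S a b t x y = (\<Sum>k. bd_iter S a b k t x y)"

text \<open>p_t of the D-chain, and \<hat>p_t of the dual chain restricted to I (killed at -1 when I = N).\<close>

definition ptr :: "int set \<Rightarrow> (int \<Rightarrow> real) \<Rightarrow> (int \<Rightarrow> real) \<Rightarrow> real \<Rightarrow> int \<Rightarrow> int \<Rightarrow> real" where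
  "ptr I lam mu = bd_trans I lam mu"

definition hptr :: "int set \<Rightarrow> (int \<Rightarrow> real) \<Rightarrow> (int \<Rightarrow> real) \<Rightarrow> real \<Rightarrow> int \<Rightarrow> int \<Rightarrow> real" where
  "hptr I lam mu = bd_trans I (\<lambda>x. mu (x + 1)) lam"

definition Pcum :: "int set \<Rightarrow> (int \<Rightarrow> real) \<Rightarrow> (int \<Rightarrow> real) \<Rightarrow> real \<Rightarrow> int \<Rightarrow> int \<Rightarrow> real" where
  "Pcum I lam mu t x y = (\<Sum>\<^sub>\<infinity>w\<in>{w\<in>I. w \<le> y}. ptr I lam mu t x w)"

definition Wch :: "int set \<Rightarrow> nat \<Rightarrow> int list set" where
  "Wch I n = {xs. length xs = n \<and> set xs \<subseteq> I \<and> sorted_wrt (<) xs}"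

definition Wint :: "int set \<Rightarrow> int list \<Rightarrow> int list set" where
  "Wint I x = {y. y \<in> Wch I (length x - 1) \<and>
                  (\<forall>i < length x - 1. x ! i \<le> y ! i \<and> y ! i < x ! (i + 1))}"

definition WI :: "int set \<Rightarrow> nat \<Rightarrow> (int list \<times> int list) set" where
  "WI I n = {(x, y). x \<in> Wch I (n + 1) \<and> y \<in> Wint I x}"

definition ldet :: "nat \<Rightarrow> (nat \<Rightarrow> nat \<Rightarrow> real) \<Rightarrow> real" where
  "ldet m f = (\<Sum>\<sigma> | \<sigma> permutes {..<m}. of_int (sign \<sigma>) * (\<Prod>i<m. f i (\<sigma> i)))"

definition KM :: "(real \<Rightarrow> int \<Rightarrow> int \<Rightarrow> real) \<Rightarrow> nat \<Rightarrow> real \<Rightarrow> int list \<Rightarrow> int list \<Rightarrow> real" where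
  "KM p n t xs ys = ldet n (\<lambda>i j. p t (xs ! i) (ys ! j))"

text \<open>The kernel q^{n,n+1}_t; row/column indices 0..n for the x-block, n+1..2n for the y-block.\<close>
definition qker :: "int set \<Rightarrow> (int \<Rightarrow> real) \<Rightarrow> (int \<Rightarrow> real) \<Rightarrow> nat \<Rightarrow> real \<Rightarrow>
    int list \<times> int list \<Rightarrow> int list \<times> int list \<Rightarrow> real" where
  "qker I lam mu n t xy xy' =
    (let x = fst xy; y = snd xy; x' = fst xy'; y' = snd xy';
         p = ptr I lam mu; hp = hptr I lam mu; h\<pi> = hpi lam mu in
     ldet (2 * n + 1) (\<lambda>i j.
       if i \<le> n \<and> j \<le> n then p t (x ! i) (x' ! j)
       else if i \<le> n then
         (let j' = j - (n + 1) in
          h\<pi> (y' ! j') * (Pcum I lam mu t (x ! i) (y' ! j') - (if j' \<ge> i then 1 else 0)))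
       else if j \<le> n then
         (let i' = i - (n + 1) in
          (p t (y ! i') (x' ! j) - p t (y ! i' + 1) (x' ! j)) / h\<pi> (y ! i'))
       else hp t (y ! (i - (n + 1))) (y' ! (j - (n + 1)))))"

definition Lam :: "int set \<Rightarrow> (int \<Rightarrow> real) \<Rightarrow> (int \<Rightarrow> real) \<Rightarrow> int list \<Rightarrow> int list \<Rightarrow> real" where
  "Lam I lam mu x y = (if y \<in> Wint I x then (\<Prod>i<length y. hpi lam mu (y ! i)) else 0)"

definition hup :: "int set \<Rightarrow> (int \<Rightarrow> real) \<Rightarrow> (int \<Rightarrow> real) \<Rightarrow> nat \<Rightarrow> (int list \<Rightarrow> real) \<Rightarrow> int list \<Rightarrow> real" where
  "hup I lam mu n hh x = (\<Sum>\<^sub>\<infinity>y\<in>Wch I n. Lam I lam mu x y * hh y)"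

definition doob :: "real \<Rightarrow> ('a \<Rightarrow> real) \<Rightarrow> real \<Rightarrow> ('a \<Rightarrow> 'a \<Rightarrow> real) \<Rightarrow> 'a \<Rightarrow> 'a \<Rightarrow> real" where
  "doob c h t K a b = exp (- c * t) * h b * K a b / h a"

definition LamH :: "int set \<Rightarrow> (int \<Rightarrow> real) \<Rightarrow> (int \<Rightarrow> real) \<Rightarrow> nat \<Rightarrow> (int list \<Rightarrow> real) \<Rightarrow>
    int list \<Rightarrow> int list \<times> int list \<Rightarrow> real" where
  "LamH I lam mu n hh x xy =
     (if fst xy = x \<and> snd xy \<in> Wint I x
      then (\<Prod>i<n. hpi lam mu (snd xy ! i)) * hh (snd xy) / hup I lam mu n hh x
      else 0)"

definition kcomp :: "'b set \<Rightarrow> ('a \<Rightarrow> 'b \<Rightarrow> real) \<Rightarrow> ('b \<Rightarrow> 'c \<Rightarrow> real) \<Rightarrow> 'a \<Rightarrow> 'c \<Rightarrow> real" where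
  "kcomp A K L a c = (\<Sum>\<^sub>\<infinity>b\<in>A. K a b * L b c)"

end

theory Submission
  imports Defs "Jordan_Normal_Form.Determinant"
begin

text \<open>
  Write \<open>p'\<close>, \<open>P'\<close>, \<open>w\<close> for the hatted \<open>p\<close>, \<open>P\<close>, \<open>\<pi>\<close> of the dual chain and \<open>F\<^sub>t(x,y) = P\<^sub>t 1\<^bsub>[l,y]\<^esub>(x)\<close>. Siegmund duality together with reversibility of the dual chain says
  \<open>p'\<^sub>t(y,y') = w(y') (F\<^sub>t(y,y') - F\<^sub>t(y+1,y')) / w(y)\<close>, so the lower rows of the block matrix are discrete
  derivatives \<open>(R(y) - R(y+1)) / w(y)\<close> of the same row function \<open>R\<close> that gives its upper rows.
  Hence summing the lower rows over \<open>y\<close> interlacing with \<open>x\<close> telescopes and row operations leave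
  \<open>P\<^sup>n\<^sup>+\<^sup>1\<^sub>t(x,x') \<Prod>w(y'\<^sub>i)\<close>; summing the left columns over \<open>x'\<close> telescopes and column operations leave
  \<open>P'\<^sup>n\<^sub>t(y,y')\<close>. The theorem follows from these two identities, provided that the kernel \<open>q\<close> is
  nonnegative, which legitimises the exchange of the infinite sums.

  Conservativity, duality and nonnegativity are obtained by truncation to a finite interval on which the
  chain is reflected and its dual is killed. There duality is uniqueness for a finite linear
  system, and \<open>q\<close> solves a backward equation whose rates are nonnegative: a jump that would break the
  interlacing is blocked, pushes the neighbouring particle, or kills the process. The truncated objects
  converge because the chain does not explode, for which the natural-boundary condition provides a
  Lyapunov function.
\<close>

subsection \<open>Determinants\<close>

text \<open>The hypothesis on \<open>hh\<close> concerns an iterated sum in which the sum over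
  \<open>x'\<close> has already been carried out. Passing to the sum over pairs needs absolute
  convergence, and a determinant shows no sign by itself.

  The boundary behaviour is forced: differencing in the starting site turns a reflecting end into a
  killing end. Reflected transition functions are not monotone in the window. Lower bounds on a set
  and on its complement, together with total mass one before and after the limit, still determine
  the limit.

  The indicators in the upper right block do not depend on time or on the sites in their row, so
  they do not disturb the backward equation. After the row or column operations they are what
  remains: they supply the diagonal block.\<close>

lemma permutes_lessThan: "\<sigma> permutes {..<m} \<Longrightarrow> i < m \<Longrightarrow> \<sigma> i < m" for m :: nat
  using permutes_in_image[of \<sigma> "{..<m}" i] by simp

lemma ldet_eq_det: "ldet m f = Determinant.det (Matrix.mat m m (\<lambda>(i,j). f i j))"
  unfolding ldet_def Determinant.det_def
  by (auto simp: lessThan_atLeast0[symmetric] permutes_lessThan intro!: sum.cong prod.cong)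

lemma ldet_cong:
  assumes "\<And>i j. i < m \<Longrightarrow> j < m \<Longrightarrow> f i j = g i j"
  shows "ldet m f = ldet m g"
  using assms unfolding ldet_def
  by (intro sum.cong prod.cong arg_cong2[where f = "(*)"] refl) (auto simp: permutes_lessThan)

lemma ldet_transpose: "ldet m (\<lambda>i j. f j i) = ldet m f"
proof -
  have "Matrix.mat m m (\<lambda>(i,j). f j i) = transpose_mat (Matrix.mat m m (\<lambda>(i,j). f i j))"
    by auto
  thus ?thesis unfolding ldet_eq_det by (simp add: Determinant.det_transpose[of _ m])
qed

lemma ldet_expand_row:
  assumes "k < m"
  shows "ldet m f = (\<Sum>\<sigma> | \<sigma> permutes {..<m}. of_int (sign \<sigma>) * (f k (\<sigma> k) * (\<Prod>i\<in>{..<m}-{k}. f i (\<sigma> i))))"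
  unfolding ldet_def using assms by (intro sum.cong refl) (simp add: prod.remove[of _ k])

lemma ldet_row_sum:
  assumes "k < m" "\<And>j. j < m \<Longrightarrow> f k j = (\<Sum>a\<in>A. c a * g a j)"
  shows "ldet m f = (\<Sum>a\<in>A. c a * ldet m (f(k := g a)))"
proof -
  have "ldet m f = (\<Sum>\<sigma> | \<sigma> permutes {..<m}. \<Sum>a\<in>A. c a * (of_int (sign \<sigma>) * (g a (\<sigma> k) * (\<Prod>i\<in>{..<m}-{k}. f i (\<sigma> i)))))"
    unfolding ldet_expand_row[OF assms(1)]
  proof (intro sum.cong refl, goal_cases)
    case (1 \<sigma>)
    hence "\<sigma> k < m" using assms(1) permutes_in_image by fastforce
    thus ?case by (simp add: assms(2) sum_distrib_left sum_distrib_right mult_ac)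
  qed
  also have "\<dots> = (\<Sum>a\<in>A. c a * ldet m (f(k := g a)))"
    unfolding ldet_expand_row[OF assms(1)]
    by (subst sum.swap) (simp add: sum_distrib_left)
  finally show ?thesis .
qed

lemma ldet_rows_proportional:
  assumes "k < m" "l < m" "k \<noteq> l" "\<And>j. j < m \<Longrightarrow> f k j = c * f l j"
  shows "ldet m f = 0"
proof -
  have "ldet m f = (\<Sum>a\<in>{()}. c * ldet m (f(k := f l)))"
    using assms by (intro ldet_row_sum) auto
  also have "ldet m (f(k := f l)) = 0"
    unfolding ldet_eq_det using assms
    by (intro Determinant.det_identical_rows[of _ m k l]) auto
  finally show ?thesis by simp
qed

lemma ldet_cols_proportional:
  assumes "k < m" "l < m" "k \<noteq> l" "\<And>i. i < m \<Longrightarrow> f i k = c * f i l"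
  shows "ldet m f = 0"
  using ldet_rows_proportional[of k m l "\<lambda>i j. f j i" c] assms ldet_transpose[of m f] by simp

lemma ldet_add_row_multiple:
  assumes "k < m" "l < m" "k \<noteq> l" "\<And>j. j < m \<Longrightarrow> r j = f k j + c * f l j"
  shows "ldet m (f(k := r)) = ldet m f"
proof -
  have "ldet m (f(k := r)) = (\<Sum>a\<in>{True,False}. (if a then 1 else c) * ldet m ((f(k := r))(k := (if a then f k else f l))))"
    using assms by (intro ldet_row_sum) auto
  also have "\<dots> = ldet m f + c * ldet m (f(k := f l))" by simp
  also have "ldet m (f(k := f l)) = 0"
    using assms by (intro ldet_rows_proportional[of k m l _ 1]) auto
  finally show ?thesis by (simp only: mult_zero_right add_0_right)
qed

text \<open>The columns that are added have index at least \<open>k\<close> and stay unchanged, so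
  all operations together are right multiplication by one unit lower triangular matrix.\<close>

lemma ldet_add_cols:
  assumes "k \<le> m"
    and "\<And>i j. i < m \<Longrightarrow> j < m \<Longrightarrow> g i j = f i j + (if j < k then \<Sum>l\<in>{k..<m}. f i l * T l j else 0)"
  shows "ldet m g = ldet m f"
proof -
  define U where "U = Matrix.mat m m (\<lambda>(l,j). (if l = j then 1 else 0) + (if j < k \<and> k \<le> l then T l j else 0))"
  have U: "U \<in> carrier_mat m m" by (simp add: U_def)
  have "Determinant.det U = prod_list (diag_mat U)"
    by (rule det_lower_triangular[of m]) (auto simp: U_def)
  also have "diag_mat U = map (\<lambda>_. 1) [0..<m]"
    by (auto simp: diag_mat_def U_def)
  finally have dU: "Determinant.det U = 1" by (simp add: prod_list_replicate map_replicate_const)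
  have "Matrix.mat m m (\<lambda>(i,j). g i j) = Matrix.mat m m (\<lambda>(i,j). f i j) * U"
  proof (rule eq_matI)
    fix i j assume "i < dim_row (Matrix.mat m m (\<lambda>(i,j). f i j) * U)"
      and "j < dim_col (Matrix.mat m m (\<lambda>(i,j). f i j) * U)"
    hence ij: "i < m" "j < m" by (auto simp: U_def)
    have "(Matrix.mat m m (\<lambda>(i,j). f i j) * U) $$ (i, j) =
      (\<Sum>l<m. f i l * ((if l = j then 1 else 0) + (if j < k \<and> k \<le> l then T l j else 0)))"
      using ij by (simp add: U_def scalar_prod_def lessThan_atLeast0)
    also have "\<dots> = (\<Sum>l<m. if l = j then f i l else 0) + (\<Sum>l<m. if j < k \<and> k \<le> l then f i l * T l j else 0)"
      by (subst sum.distrib[symmetric]) (auto intro!: sum.cong simp: algebra_simps)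
    also have "(\<Sum>l<m. if l = j then f i l else 0) = f i j" using ij by simp
    also have "(\<Sum>l<m. if j < k \<and> k \<le> l then f i l * T l j else 0) = (if j < k then \<Sum>l\<in>{k..<m}. f i l * T l j else 0)"
      by (auto intro!: sum.mono_neutral_cong_right)
    finally show "Matrix.mat m m (\<lambda>(i,j). g i j) $$ (i, j) = (Matrix.mat m m (\<lambda>(i,j). f i j) * U) $$ (i, j)"
      using ij assms(2) by simp
  qed (auto simp: U_def)
  thus ?thesis unfolding ldet_eq_det using U dU by (simp add: Determinant.det_mult[of _ m])
qed

lemma ldet_add_rows:
  assumes "k \<le> m"
    and "\<And>i j. i < m \<Longrightarrow> j < m \<Longrightarrow> g i j = f i j + (if k \<le> i then \<Sum>l<k. T i l * f l j else 0)"
  shows "ldet m g = ldet m f"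
proof -
  define U where "U = Matrix.mat m m (\<lambda>(i,l). (if l = i then 1 else 0) + (if k \<le> i \<and> l < k then T i l else 0))"
  have U: "U \<in> carrier_mat m m" by (simp add: U_def)
  have "Determinant.det U = prod_list (diag_mat U)"
    by (rule det_lower_triangular[of m]) (auto simp: U_def)
  also have "diag_mat U = map (\<lambda>_. 1) [0..<m]"
    by (auto simp: diag_mat_def U_def)
  finally have dU: "Determinant.det U = 1" by (simp add: prod_list_replicate map_replicate_const)
  have "Matrix.mat m m (\<lambda>(i,j). g i j) = U * Matrix.mat m m (\<lambda>(i,j). f i j)"
  proof (rule eq_matI)
    fix i j assume "i < dim_row (U * Matrix.mat m m (\<lambda>(i,j). f i j))"
      and "j < dim_col (U * Matrix.mat m m (\<lambda>(i,j). f i j))"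
    hence ij: "i < m" "j < m" by (auto simp: U_def)
    have "(U * Matrix.mat m m (\<lambda>(i,j). f i j)) $$ (i, j) =
      (\<Sum>l<m. ((if l = i then 1 else 0) + (if k \<le> i \<and> l < k then T i l else 0)) * f l j)"
      using ij by (simp add: U_def scalar_prod_def lessThan_atLeast0)
    also have "\<dots> = (\<Sum>l<m. if l = i then f l j else 0) + (\<Sum>l<m. if k \<le> i \<and> l < k then T i l * f l j else 0)"
      by (subst sum.distrib[symmetric]) (auto intro!: sum.cong simp: algebra_simps)
    also have "(\<Sum>l<m. if l = i then f l j else 0) = f i j" using ij by simp
    also have "(\<Sum>l<m. if k \<le> i \<and> l < k then T i l * f l j else 0) = (if k \<le> i then \<Sum>l<k. T i l * f l j else 0)"
      using assms(1) by (auto intro!: sum.mono_neutral_cong_right split: if_splits)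
    finally show "Matrix.mat m m (\<lambda>(i,j). g i j) $$ (i, j) = (U * Matrix.mat m m (\<lambda>(i,j). f i j)) $$ (i, j)"
      using ij assms(2) by simp
  qed (auto simp: U_def)
  thus ?thesis unfolding ldet_eq_det using U dU by (simp add: Determinant.det_mult[of _ m])
qed

lemma ldet_block_lower_left_zero:
  assumes "\<And>i j. i < l \<Longrightarrow> j < k \<Longrightarrow> f (k + i) j = 0"
  shows "ldet (k + l) f = ldet k f * ldet l (\<lambda>i j. f (k + i) (k + j))"
proof -
  have "f i j = 0" if "i < k + l" "j < k" "k \<le> i" for i j
    using assms[of "i - k" j] that by simp
  hence eq: "Matrix.mat (k + l) (k + l) (\<lambda>(i,j). f i j) =
    four_block_mat (Matrix.mat k k (\<lambda>(i,j). f i j)) (Matrix.mat k l (\<lambda>(i,j). f i (k + j)))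
      (0\<^sub>m l k) (Matrix.mat l l (\<lambda>(i,j). f (k + i) (k + j)))"
    by (intro eq_matI) auto
  show ?thesis unfolding ldet_eq_det eq
    by (simp add: det_four_block_mat_lower_left_zero[of _ k _ l])
qed

lemma ldet_block_upper_right_zero:
  assumes "\<And>i j. i < k \<Longrightarrow> j < l \<Longrightarrow> f i (k + j) = 0"
  shows "ldet (k + l) f = ldet k f * ldet l (\<lambda>i j. f (k + i) (k + j))"
  using ldet_block_lower_left_zero[of l k "\<lambda>i j. f j i"] assms
    ldet_transpose[of "k + l" f] ldet_transpose[of k f] ldet_transpose[of l "\<lambda>i j. f (k + i) (k + j)"]
  by simp

lemma ldet_diag: "ldet m (\<lambda>i j. if i = j then d i else 0) = (\<Prod>i<m. d i)"
proof -
  have "ldet m (\<lambda>i j. if i = j then d i else 0) =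
    prod_list (diag_mat (Matrix.mat m m (\<lambda>(i,j). if i = j then d i else 0)))"
    unfolding ldet_eq_det by (rule det_lower_triangular[of m]) auto
  also have "diag_mat (Matrix.mat m m (\<lambda>(i,j). if i = j then d i else 0)) = map d [0..<m]"
    by (auto simp: diag_mat_def)
  finally show ?thesis by (simp add: prod.list_conv_set_nth lessThan_atLeast0)
qed

text \<open>The product rule in each Leibniz term, regrouped by the differentiated factor, gives one
  determinant per row. Since every particle owns one row, each contributes its own
  generator.\<close>

lemma has_real_derivative_ldet:
  assumes "\<And>i j. i < m \<Longrightarrow> j < m \<Longrightarrow> ((\<lambda>t. f t i j) has_real_derivative f' i j) (at t within A)"
  shows "((\<lambda>t. ldet m (f t)) has_real_derivative (\<Sum>k<m. ldet m ((f t)(k := f' k)))) (at t within A)"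
proof -
  have "((\<lambda>t. ldet m (f t)) has_real_derivative
     (\<Sum>\<sigma> | \<sigma> permutes {..<m}. of_int (sign \<sigma>) * (\<Sum>k<m. f' k (\<sigma> k) * (\<Prod>i\<in>{..<m}-{k}. f t i (\<sigma> i))))) (at t within A)"
    unfolding ldet_def
  proof (intro DERIV_sum DERIV_cmult, goal_cases)
    case (1 \<sigma>)
    have "((\<lambda>u. \<Prod>i\<in>B. f u i (\<sigma> i)) has_real_derivative
        (\<Sum>k\<in>B. f' k (\<sigma> k) * (\<Prod>i\<in>B-{k}. f t i (\<sigma> i)))) (at t within A)"
      if "finite B" "B \<subseteq> {..<m}" for B
      using that
    proof (induction B rule: finite_induct)
      case (insert b B)
      have eq: "insert b B - {y} = insert b (B - {y})" if "y \<in> B" for y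
        using insert.hyps that by auto
      have "((\<lambda>t. f t b (\<sigma> b)) has_real_derivative f' b (\<sigma> b)) (at t within A)"
        using 1 insert.prems permutes_in_image[of \<sigma> "{..<m}" b] by (intro assms) auto
      from DERIV_mult[OF this insert.IH] insert show ?case
        by (simp add: eq sum_distrib_left mult_ac cong: sum.cong_simp)
    qed simp
    thus ?case by simp
  qed
  also have "(\<Sum>\<sigma> | \<sigma> permutes {..<m}. of_int (sign \<sigma>) * (\<Sum>k<m. f' k (\<sigma> k) * (\<Prod>i\<in>{..<m}-{k}. f t i (\<sigma> i))))
    = (\<Sum>k<m. ldet m ((f t)(k := f' k)))"
  proof -
    have "ldet m ((f t)(k := f' k)) = (\<Sum>\<sigma> | \<sigma> permutes {..<m}. of_int (sign \<sigma>) * (f' k (\<sigma> k) * (\<Prod>i\<in>{..<m}-{k}. f t i (\<sigma> i))))"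
      if "k < m" for k using that by (simp add: ldet_expand_row)
    thus ?thesis by (simp add: sum_distrib_left) (rule sum.swap)
  qed
  finally show ?thesis .
qed

lemma tendsto_ldet:
  assumes "\<And>i j. i < m \<Longrightarrow> j < m \<Longrightarrow> ((\<lambda>t. f t i j) \<longlongrightarrow> g i j) F"
  shows "((\<lambda>t. ldet m (f t)) \<longlongrightarrow> ldet m g) F"
  unfolding ldet_def
  by (intro tendsto_intros) (use assms in \<open>auto simp: permutes_lessThan\<close>)

section \<open>Sums of determinants over products of sets\<close>

definition list_prod :: "nat \<Rightarrow> (nat \<Rightarrow> 'a set) \<Rightarrow> 'a list set" where
  "list_prod k S = {xs. length xs = k \<and> (\<forall>j<k. xs ! j \<in> S j)}"

lemma has_sum_list_prod:
  fixes g :: "nat \<Rightarrow> 'a \<Rightarrow> real"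
  assumes "\<And>j. j < k \<Longrightarrow> (g j has_sum s j) (S j)"
  shows "((\<lambda>xs. \<Prod>j<k. g j (xs ! j)) has_sum (\<Prod>j<k. s j)) (list_prod k S)"
  using assms
proof (induction k)
  case 0
  have "list_prod 0 S = {[]}" by (auto simp: list_prod_def)
  thus ?case by (simp add: has_sum_finite_iff)
next
  case (Suc k)
  let ?G = "\<lambda>xs. \<Prod>j<k. g j (xs ! j)"
  have IH: "(?G has_sum (\<Prod>j<k. s j)) (list_prod k S)" using Suc by simp
  have gk: "(g k has_sum s k) (S k)" using Suc by simp
  have "((\<lambda>(xs, w). ?G xs * g k w) has_sum ((\<Prod>j<k. s j) * s k)) (list_prod k S \<times> S k)"
  proof (rule has_sum_SigmaI)
    fix xs
    show "((\<lambda>w. case (xs, w) of (xs, w) \<Rightarrow> ?G xs * g k w) has_sum (?G xs * s k)) (S k)"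
      using has_sum_cmult_right[OF gk] by simp
  next
    show "((\<lambda>xs. ?G xs * s k) has_sum (\<Prod>j<k. s j) * s k) (list_prod k S)"
      using has_sum_cmult_left[OF IH] by simp
  next
    \<comment> \<open>Real families are summable only if absolutely summable, which supplies the
      condition for splitting the sum over the product.\<close>
    have "(\<lambda>x. norm (?G x)) summable_on list_prod k S" "(\<lambda>x. norm (g k x)) summable_on S k"
      using summable_on_iff_abs_summable_on_real[THEN iffD1, OF has_sum_imp_summable[OF IH]]
        summable_on_iff_abs_summable_on_real[THEN iffD1, OF has_sum_imp_summable[OF gk]] by simp_all
    hence "(\<lambda>(xs, w). \<bar>?G xs\<bar> * \<bar>g k w\<bar>) summable_on list_prod k S \<times> S k"
      by (intro summable_on_SigmaI[where g = "\<lambda>xs. \<bar>?G xs\<bar> * (\<Sum>\<^sub>\<infinity>w\<in>S k. \<bar>g k w\<bar>)"])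
         (auto intro!: has_sum_cmult_right summable_on_cmult_left)
    thus "(\<lambda>(xs, w). ?G xs * g k w) summable_on list_prod k S \<times> S k"
      by (subst summable_on_iff_abs_summable_on_real) (simp add: case_prod_unfold abs_mult)
  qed
  also have "?this \<longleftrightarrow> ?case"
    unfolding prod.lessThan_Suc
    by (rule has_sum_reindex_bij_witness[of _ "\<lambda>xs. (take k xs, xs ! k)" "\<lambda>(xs, w). xs @ [w]"])
       (auto simp: list_prod_def nth_append less_Suc_eq take_Suc_conv_app_nth[symmetric])
  finally show ?case .
qed

lemma has_sum_finite_sum:
  fixes f :: "'b \<Rightarrow> 'a \<Rightarrow> real"
  assumes "\<And>a. a \<in> A \<Longrightarrow> (f a has_sum s a) S"
  shows "((\<lambda>x. \<Sum>a\<in>A. f a x) has_sum (\<Sum>a\<in>A. s a)) S"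
  using assms by (induction A rule: infinite_finite_induct) (auto intro: has_sum_add)

text \<open>In each Leibniz term the coordinate \<open>xs ! j\<close> enters through column
  \<open>j\<close> alone, so the sum over a product set factors and moves inside the
  determinant.\<close>

lemma has_sum_ldet_cols:
  fixes f :: "nat \<Rightarrow> nat \<Rightarrow> 'a \<Rightarrow> real"
  assumes "k \<le> m" and "\<And>i j. i < m \<Longrightarrow> j < k \<Longrightarrow> (f i j has_sum s i j) (S j)"
  shows "((\<lambda>xs. ldet m (\<lambda>i j. if j < k then f i j (xs ! j) else g i j))
     has_sum ldet m (\<lambda>i j. if j < k then s i j else g i j)) (list_prod k S)"
proof -
  have split: "(\<Prod>j<m. if j < k then P j else R j) = (\<Prod>j<k. P j) * (\<Prod>j\<in>{k..<m}. R j)" for P R :: "nat \<Rightarrow> real"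
  proof -
    have "{..<m} = {..<k} \<union> {k..<m}" using assms(1) by auto
    moreover have "(\<Prod>j\<in>{..<k} \<union> {k..<m}. if j < k then P j else R j)
      = (\<Prod>j<k. if j < k then P j else R j) * (\<Prod>j\<in>{k..<m}. if j < k then P j else R j)"
      by (rule prod.union_disjoint) auto
    ultimately show ?thesis by simp
  qed
  have "((\<lambda>xs. \<Sum>\<sigma> | \<sigma> permutes {..<m}. of_int (sign \<sigma>) * ((\<Prod>j<k. f (\<sigma> j) j (xs ! j)) * (\<Prod>j\<in>{k..<m}. g (\<sigma> j) j)))
     has_sum (\<Sum>\<sigma> | \<sigma> permutes {..<m}. of_int (sign \<sigma>) * ((\<Prod>j<k. s (\<sigma> j) j) * (\<Prod>j\<in>{k..<m}. g (\<sigma> j) j)))) (list_prod k S)"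
  proof (intro has_sum_finite_sum has_sum_cmult_right has_sum_cmult_left has_sum_list_prod assms(2), goal_cases)
    case (1 \<sigma> j)
    thus ?case using assms(1) by (auto simp: permutes_lessThan)
  qed
  moreover have "ldet m (\<lambda>i j. if j < k then P i j else g i j) =
    (\<Sum>\<sigma> | \<sigma> permutes {..<m}. of_int (sign \<sigma>) * ((\<Prod>j<k. P (\<sigma> j) j) * (\<Prod>j\<in>{k..<m}. g (\<sigma> j) j)))" for P
    using ldet_transpose[of m "\<lambda>i j. if j < k then P i j else g i j"] by (simp add: ldet_def split)
  ultimately show ?thesis by simp
qed

lemma has_sum_ldet_rows:
  fixes f :: "nat \<Rightarrow> nat \<Rightarrow> 'a \<Rightarrow> real"
  assumes "\<And>i j. i < l \<Longrightarrow> j < k + l \<Longrightarrow> (f i j has_sum s i j) (S i)"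
  shows "((\<lambda>ys. ldet (k + l) (\<lambda>i j. if i < k then g i j else f (i - k) j (ys ! (i - k))))
     has_sum ldet (k + l) (\<lambda>i j. if i < k then g i j else s (i - k) j)) (list_prod l S)"
proof -
  have split: "(\<Prod>i<k + l. if i < k then P i else R i) = (\<Prod>i<k. P i) * (\<Prod>i<l. R (k + i))" for P R :: "nat \<Rightarrow> real"
    by (induction l) (auto simp: mult_ac)
  have "((\<lambda>ys. \<Sum>\<sigma> | \<sigma> permutes {..<k + l}. of_int (sign \<sigma>) * ((\<Prod>i<k. g i (\<sigma> i)) * (\<Prod>i<l. f i (\<sigma> (k + i)) (ys ! i))))
     has_sum (\<Sum>\<sigma> | \<sigma> permutes {..<k + l}. of_int (sign \<sigma>) * ((\<Prod>i<k. g i (\<sigma> i)) * (\<Prod>i<l. s i (\<sigma> (k + i)))))) (list_prod l S)"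
  proof (intro has_sum_finite_sum has_sum_cmult_right has_sum_list_prod assms, goal_cases)
    case (1 \<sigma> i)
    thus ?case by simp
  next
    case (2 \<sigma> i)
    hence "\<sigma> (k + i) \<in> {..<k + l} \<longleftrightarrow> k + i \<in> {..<k + l}" by (intro permutes_in_image) auto
    thus ?case using 2 by simp
  qed
  thus ?thesis by (simp add: ldet_def if_distrib[of "\<lambda>h. h _"] split cong: if_cong)
qed

lemma has_sum_minus:
  fixes f g :: "'a \<Rightarrow> real"
  assumes "(f has_sum a) A" "(g has_sum b) A"
  shows "((\<lambda>x. f x - g x) has_sum (a - b)) A"
  using has_sum_add[OF assms(1) has_sum_uminusI[OF assms(2)]] by simp

lemma finite_list_prod:
  assumes "\<And>i. i < n \<Longrightarrow> finite (S i)"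
  shows "finite (list_prod n S)"
proof (rule finite_subset)
  show "list_prod n S \<subseteq> {xs. set xs \<subseteq> (\<Union>i<n. S i) \<and> length xs = n}"
  proof (intro subsetI CollectI conjI)
    fix xs z assume xs: "xs \<in> list_prod n S"
    thus "length xs = n" by (simp add: list_prod_def)
    assume "z \<in> set xs"
    then obtain i where "i < n" "z = xs ! i" using xs by (auto simp: list_prod_def in_set_conv_nth)
    thus "z \<in> (\<Union>i<n. S i)" using xs by (auto simp: list_prod_def)
  qed
  show "finite {xs. set xs \<subseteq> (\<Union>i<n. S i) \<and> length xs = n}"
    using assms by (intro finite_lists_length_eq) auto
qed

lemma ldet_scale_rows:
  "ldet (k + l) (\<lambda>i j. if i < k then g i j else c (i - k) * f (i - k) j)
     = (\<Prod>i<l. c i) * ldet (k + l) (\<lambda>i j. if i < k then g i j else f (i - k) j)"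
proof -
  have split: "(\<Prod>i<k + l. if i < k then P i else R i) = (\<Prod>i<k. P i) * (\<Prod>i<l. R (k + i))" for P R :: "nat \<Rightarrow> real"
    by (induction l) (auto simp: mult_ac)
  have "ldet (k + l) (\<lambda>i j. if i < k then g i j else h (i - k) j) =
    (\<Sum>\<sigma> | \<sigma> permutes {..<k + l}. of_int (sign \<sigma>) * ((\<Prod>i<k. g i (\<sigma> i)) * (\<Prod>i<l. h i (\<sigma> (k + i)))))" for h
    by (simp add: ldet_def if_distrib[of "\<lambda>h. h _"] split cong: if_cong)
  note this[of "\<lambda>i j. c i * f i j"] this[of f]
  thus ?thesis by (simp add: prod.distrib sum_distrib_left mult_ac)
qed

text \<open>Multilinearity in row \<open>k\<close>: a nearest-neighbour generator applied to one row
  becomes the same generator applied to the determinant.\<close>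

lemma ldet_row_move:
  assumes k: "k < m" and r: "\<And>j. j < m \<Longrightarrow> r j = \<alpha> * (r1 j - f k j) + \<beta> * (r2 j - f k j)"
  shows "ldet m (f(k := r)) = \<alpha> * (ldet m (f(k := r1)) - ldet m f) + \<beta> * (ldet m (f(k := r2)) - ldet m f)"
proof -
  define c where "c a = (if a = 0 then \<alpha> else if a = 1 then \<beta> else - (\<alpha> + \<beta>))" for a :: nat
  define g where "g a = (if a = 0 then r1 else if a = 1 then r2 else f k)" for a :: nat
  have "ldet m (f(k := r)) = (\<Sum>a\<in>{0,1,2}. c a * ldet m ((f(k := r))(k := g a)))"
    using assms by (intro ldet_row_sum) (auto simp: c_def g_def algebra_simps)
  thus ?thesis by (simp add: c_def g_def algebra_simps)
qed

text \<open>The value is 0 or 1: increasing lists of the same length agree once one set contains the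
  other, and otherwise an entry of \<open>x'\<close> missing from \<open>x\<close> gives a zero
  column.\<close>

lemma ldet_indicator_nonneg:
  fixes x x' :: "int list"
  assumes n: "1 \<le> n" and len: "length x = n + 1" "length x' = n + 1"
    and s: "sorted_wrt (<) x" "sorted_wrt (<) x'"
  shows "0 \<le> ldet (n + 1) (\<lambda>i j. if x ! i = x' ! j then 1 else 0)"
proof (cases "x = x'")
  case True
  have "distinct x" using s(1) by (simp add: strict_sorted_iff)
  hence "ldet (n + 1) (\<lambda>i j. if x ! i = x' ! j then 1 else 0) = ldet (n + 1) (\<lambda>i j. if i = j then 1 else 0)"
    using len True by (intro ldet_cong) (auto simp: nth_eq_iff_index_eq)
  also have "\<dots> = 1" by (subst ldet_diag) simp
  finally show ?thesis by simp
next
  case False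
  have "\<not> set x' \<subseteq> set x"
  proof
    assume sub: "set x' \<subseteq> set x"
    have d: "distinct x" "distinct x'" "sorted x" "sorted x'" using s by (auto simp: strict_sorted_iff)
    hence "card (set x') = card (set x)" using len by (simp add: distinct_card)
    hence "set x' = set x" using sub by (intro card_subset_eq) auto
    thus False using d False sorted_distinct_set_unique by metis
  qed
  then obtain v where "v \<in> set x'" "v \<notin> set x" by blast
  then obtain j where j: "j < n + 1" "x' ! j \<notin> set x" using len by (metis in_set_conv_nth)
  \<comment> \<open>Any second column serves, since it is taken with factor zero;
    \<open>1 \<le> n\<close> ensures that there is one.\<close>
  define l where "l = (if j = 0 then 1 else 0 :: nat)"
  have "ldet (n + 1) (\<lambda>i j. if x ! i = x' ! j then 1 else 0) = 0"
  proof (rule ldet_cols_proportional[of j _ l _ 0])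
    fix i assume "i < n + 1"
    hence "x ! i \<in> set x" using len by simp
    thus "(if x ! i = x' ! j then 1 else 0) = 0 * (if x ! i = x' ! l then 1 else (0::real))" using j by auto
  qed (use j n in \<open>auto simp: l_def\<close>)
  thus ?thesis by simp
qed

subsection \<open>Finite systems of differential inequalities\<close>

lemma integral_reverse: "integral {0..t} (\<lambda>s. h (t - s)) = integral {0..t} h" for h :: "real \<Rightarrow> real"
  using integral_shift_real_ivl[of 0 t t "\<lambda>s. h (t - s)"] Henstock_Kurzweil_Integration.integral_reflect_real[of t 0 h] by simp

text \<open>The square removes the corner of the negative part at zero, so a Gronwall function built
  from it is differentiable in time.\<close>

lemma min_zero_square_has_derivative:
  fixes u :: "real \<Rightarrow> real"
  assumes "(u has_real_derivative d) (at t within A)"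
  shows "((\<lambda>s. (min (u s) 0)\<^sup>2) has_real_derivative 2 * min (u t) 0 * d) (at t within A)"
proof -
  have "((\<lambda>v. (min v 0)\<^sup>2) has_real_derivative 2 * min v 0) (at v)" for v :: real
  proof -
    consider "v < 0" | "v > 0" | "v = 0" by linarith
    thus ?thesis
    proof cases
      case 1
      have "((\<lambda>v. v\<^sup>2) has_real_derivative 2 * v) (at v)" by (auto intro!: derivative_eq_intros)
      moreover have ev: "\<forall>\<^sub>F x in nhds v. x\<^sup>2 = (min x 0)\<^sup>2"
        using eventually_nhds_in_open[of "{..<0}" v] 1 by (auto elim!: eventually_mono)
      ultimately show ?thesis using 1 DERIV_cong_ev[OF refl ev refl] by simp
    next
      case 2
      have "((\<lambda>v. 0) has_real_derivative 0) (at v)" by simp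
      moreover have ev: "\<forall>\<^sub>F x in nhds v. 0 = (min x 0)\<^sup>2"
        using eventually_nhds_in_open[of "{0<..}" v] 2 by (auto elim!: eventually_mono)
      ultimately show ?thesis using 2 DERIV_cong_ev[OF refl ev refl] by simp
    next
      case 3
      have "((\<lambda>x. (min x 0)\<^sup>2 / x) \<longlongrightarrow> 0) (at (0::real))"
      proof (rule Lim_null_comparison)
        show "\<forall>\<^sub>F x in at 0. norm ((min x 0)\<^sup>2 / x) \<le> \<bar>x\<bar>"
          by (intro always_eventually allI) (auto simp: min_def power2_eq_square)
        show "((\<lambda>x. \<bar>x\<bar>) \<longlongrightarrow> 0) (at (0::real))" by (intro tendsto_eq_intros) auto
      qed
      thus ?thesis using 3 by (simp add: has_field_derivative_iff)
    qed
  qed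
  from DERIV_chain2[OF this assms] show ?thesis .
qed

text \<open>The sum of the squared negative parts satisfies a Gronwall inequality.\<close>

lemma finite_system_nonneg:
  fixes u u' :: "'a \<Rightarrow> real \<Rightarrow> real" and r d :: "'a \<Rightarrow> real"
  assumes "finite J" and "0 \<le> T"
    and deriv: "\<And>j t. j \<in> J \<Longrightarrow> t \<in> {0..T} \<Longrightarrow> (u j has_real_derivative u' j t) (at t within {0..T})"
    and init: "\<And>j. j \<in> J \<Longrightarrow> 0 \<le> u j 0"
    and r: "\<And>j. j \<in> J \<Longrightarrow> 0 \<le> r j"
    and below: "\<And>j t m. j \<in> J \<Longrightarrow> t \<in> {0..T} \<Longrightarrow> m \<le> 0 \<Longrightarrow> (\<And>i. i \<in> J \<Longrightarrow> m \<le> u i t)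
      \<Longrightarrow> r j * m - d j * u j t \<le> u' j t"
    and "j \<in> J"
  shows "0 \<le> u j T"
proof -
  define \<phi> where "\<phi> t = (\<Sum>j\<in>J. (min (u j t) 0)\<^sup>2)" for t
  define K where "K = (\<Sum>j\<in>J. 2 * r j + 2 * \<bar>d j\<bar>)"
  define \<phi>' where "\<phi>' t = (\<Sum>j\<in>J. 2 * min (u j t) 0 * u' j t)" for t
  have d\<phi>: "(\<phi> has_real_derivative \<phi>' t) (at t within {0..T})" if "t \<in> {0..T}" for t
    unfolding \<phi>_def \<phi>'_def
    by (intro DERIV_sum min_zero_square_has_derivative deriv that)
  have \<phi>_ge: "(min (u j t) 0)\<^sup>2 \<le> \<phi> t" if "j \<in> J" for j t
    unfolding \<phi>_def using that \<open>finite J\<close> by (intro member_le_sum) auto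
  have bound: "\<phi>' t \<le> K * \<phi> t" if t: "t \<in> {0..T}" for t
    unfolding \<phi>'_def K_def sum_distrib_right
  proof (rule sum_mono)
    fix j assume j: "j \<in> J"
    let ?m = "\<lambda>j. min (u j t) 0"
    \<comment> \<open>Minus the Euclidean norm of the negative parts bounds all components from
      below, as \<open>below\<close> requires. It is cruder than the minimum but a function of
      \<open>\<phi>\<close>, so the estimate closes.\<close>
    define m where "m = - sqrt (\<phi> t)"
    have \<phi>0: "0 \<le> \<phi> t" unfolding \<phi>_def by (intro sum_nonneg) auto
    have lb: "m \<le> ?m i" if "i \<in> J" for i
      using real_sqrt_le_mono[OF \<phi>_ge[OF that, of t]] \<phi>0 unfolding m_def by (simp add: min_def split: if_splits)
    have m0: "m \<le> 0" unfolding m_def using \<phi>0 by simp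
    have le: "r j * m - d j * u j t \<le> u' j t"
      by (rule below[OF j t m0]) (use lb in force)
    have "2 * ?m j * u' j t \<le> 2 * ?m j * (r j * m - d j * u j t)"
      using le by (intro mult_left_mono_neg) auto
    also have "\<dots> = 2 * r j * (?m j * m) - 2 * d j * (?m j * u j t)" by (simp add: algebra_simps)
    also have "?m j * u j t = (?m j)\<^sup>2" by (simp add: min_def power2_eq_square)
    also have "2 * r j * (?m j * m) \<le> 2 * r j * \<phi> t"
    proof -
      have "?m j * m \<le> m * m" using lb[OF j] m0 by (intro mult_right_mono_neg) auto
      also have "m * m = \<phi> t" unfolding m_def using \<phi>0 by simp
      finally show ?thesis using r[OF j] by (intro mult_left_mono) auto
    qed
    finally have *: "2 * ?m j * u' j t \<le> 2 * r j * \<phi> t + - (2 * d j * (?m j)\<^sup>2)"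
      by (simp only: diff_conv_add_uminus)
    have "- (2 * d j * (?m j)\<^sup>2) \<le> 2 * \<bar>d j\<bar> * \<phi> t"
    proof -
      have "(- (2 * d j)) * (?m j)\<^sup>2 \<le> (2 * \<bar>d j\<bar>) * (?m j)\<^sup>2"
        by (intro mult_right_mono) auto
      also have "\<dots> \<le> 2 * \<bar>d j\<bar> * \<phi> t" by (rule mult_left_mono[OF \<phi>_ge[OF j]]) simp
      finally show ?thesis by (simp only: mult_minus_left)
    qed
    from * this show "2 * ?m j * u' j t \<le> (2 * r j + 2 * \<bar>d j\<bar>) * \<phi> t"
      unfolding distrib_right by (rule order_trans[OF _ add_left_mono])
  qed
  have "\<phi> T * exp (- K * T) \<le> \<phi> 0 * exp (- K * 0)"
  proof (rule DERIV_nonpos_imp_decreasing_open[OF \<open>0 \<le> T\<close>, where f = "\<lambda>t. \<phi> t * exp (- K * t)"])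
    fix t assume t: "0 < t" "t < T"
    hence "(\<phi> has_real_derivative \<phi>' t) (at t)"
      using d\<phi>[of t] at_within_interior[of t "{0..T}"] by simp
    hence "((\<lambda>t. \<phi> t * exp (- K * t)) has_real_derivative (\<phi>' t - K * \<phi> t) * exp (- K * t)) (at t)"
      by (auto intro!: derivative_eq_intros simp: algebra_simps)
    moreover have "(\<phi>' t - K * \<phi> t) * exp (- K * t) \<le> 0"
      using bound[of t] t by (intro mult_nonpos_nonneg) auto
    ultimately show "\<exists>y. ((\<lambda>t. \<phi> t * exp (- K * t)) has_real_derivative y) (at t) \<and> y \<le> 0" by blast
  next
    have "continuous_on {0..T} \<phi>" using d\<phi> DERIV_continuous_on by blast
    thus "continuous_on {0..T} (\<lambda>t. \<phi> t * exp (- K * t))" by (intro continuous_intros)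
  qed
  moreover have "\<phi> 0 = 0" unfolding \<phi>_def using init by (auto intro!: sum.neutral simp: min_absorb2)
  ultimately have "\<phi> T \<le> 0" by (simp add: mult_le_0_iff)
  hence "(min (u j T) 0)\<^sup>2 \<le> 0" using \<phi>_ge[OF \<open>j \<in> J\<close>, of T] by linarith
  thus ?thesis by (simp add: min_def split: if_splits)
qed

subsection \<open>Transition functions of birth-death chains\<close>

text \<open>The off-diagonal part of the generator; a target outside \<open>S\<close> counts as
  zero, which is killing.\<close>

definition bd_jump :: "int set \<Rightarrow> (int \<Rightarrow> real) \<Rightarrow> (int \<Rightarrow> real) \<Rightarrow> (int \<Rightarrow> real) \<Rightarrow> int \<Rightarrow> real" where
  "bd_jump S a b f x = (if x + 1 \<in> S then a x * f (x + 1) else 0) + (if x - 1 \<in> S then b x * f (x - 1) else 0)"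

lemma bd_jump_sum: "bd_jump S a b (\<lambda>z. \<Sum>i\<in>A. f i z) x = (\<Sum>i\<in>A. bd_jump S a b (f i) x)"
  by (simp add: bd_jump_def sum_distrib_left sum.distrib)

locale bd_rates =
  fixes S :: "int set" and a b :: "int \<Rightarrow> real"
  assumes rates_nonneg: "x \<in> S \<Longrightarrow> 0 \<le> a x" "x \<in> S \<Longrightarrow> 0 \<le> b x"
begin

abbreviation "iter \<equiv> bd_iter S a b"
abbreviation "tr \<equiv> bd_trans S a b"
abbreviation "jump \<equiv> bd_jump S a b"

lemma jump_mono:
  assumes "x \<in> S" "\<And>z. z \<in> S \<Longrightarrow> f z \<le> g z"
  shows "jump f x \<le> jump g x"
  unfolding bd_jump_def using assms rates_nonneg[OF assms(1)]
  by (intro add_mono) (auto intro: mult_left_mono)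

lemma jump_nonneg:
  assumes "x \<in> S" "\<And>z. z \<in> S \<Longrightarrow> 0 \<le> f z"
  shows "0 \<le> jump f x"
  unfolding bd_jump_def using assms rates_nonneg[OF assms(1)] by (intro add_nonneg_nonneg) auto

lemma jump_le_rate:
  assumes "x \<in> S" "\<And>z. z \<in> S \<Longrightarrow> f z \<le> 1"
  shows "jump f x \<le> a x + b x"
proof -
  have "jump f x \<le> jump (\<lambda>_. 1) x" by (rule jump_mono) (use assms in auto)
  also have "\<dots> \<le> a x + b x"
    unfolding bd_jump_def using rates_nonneg[OF assms(1)] by (intro add_mono) auto
  finally show ?thesis .
qed

lemma continuous_on_jump:
  assumes "\<And>z. z \<in> S \<Longrightarrow> continuous_on A (\<lambda>t. f t z)"
  shows "continuous_on A (\<lambda>t. jump (f t) x)"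
  unfolding bd_jump_def using assms
  by (cases "x + 1 \<in> S"; cases "x - 1 \<in> S") (auto intro!: continuous_intros)

lemma tendsto_jump:
  assumes "\<And>z. z \<in> S \<Longrightarrow> ((\<lambda>k. f k z) \<longlongrightarrow> g z) F"
  shows "((\<lambda>k. jump (f k) x) \<longlongrightarrow> jump g x) F"
  unfolding bd_jump_def using assms by (auto intro!: tendsto_intros)

text \<open>Reversing time takes \<open>t\<close> out of the integrand, so that continuity in
  \<open>t\<close> follows from that of an indefinite integral.\<close>

lemma iter_Suc_eq:
  "iter (Suc k) t x y = exp (- (a x + b x) * t) *
     integral {0..t} (\<lambda>s. exp ((a x + b x) * s) * jump (\<lambda>z. iter k s z y) x)"
proof -
  have "iter (Suc k) t x y = integral {0..t} (\<lambda>s. exp (- (a x + b x) * (t - s)) * jump (\<lambda>z. iter k s z y) x)"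
    using integral_reverse[of t "\<lambda>s. exp (- (a x + b x) * (t - s)) * jump (\<lambda>z. iter k s z y) x"]
    by (simp add: bd_jump_def)
  also have "\<dots> = integral {0..t} (\<lambda>s. exp (- (a x + b x) * t) * (exp ((a x + b x) * s) * jump (\<lambda>z. iter k s z y) x))"
    by (intro integral_cong) (simp add: algebra_simps flip: exp_add)
  finally show ?thesis by simp
qed

lemma continuous_on_iter: "x \<in> S \<Longrightarrow> continuous_on {0..T} (\<lambda>t. iter k t x y)"
proof (induction k arbitrary: x)
  case 0
  show ?case by (cases "x = y") (auto intro!: continuous_intros)
next
  case (Suc k)
  show ?case unfolding iter_Suc_eq
    by (intro continuous_intros indefinite_integral_continuous_1 integrable_continuous_real
        continuous_on_jump Suc.IH)
qed

lemma iter_integrand_integrable: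
  "(\<lambda>s. exp (c * s) * jump (\<lambda>z. iter k s z y) x) integrable_on {0..t}"
  by (intro integrable_continuous_real continuous_intros continuous_on_jump continuous_on_iter)

lemma iter_nonneg: "x \<in> S \<Longrightarrow> 0 \<le> t \<Longrightarrow> 0 \<le> iter k t x y"
proof (induction k arbitrary: x t)
  case (Suc k)
  show ?case unfolding iter_Suc_eq
    using Suc by (intro mult_nonneg_nonneg integral_nonneg iter_integrand_integrable)
      (auto intro!: mult_nonneg_nonneg jump_nonneg)
qed simp

section \<open>The transition function as a limit over the number of jumps, and its backward
  equation\<close>

definition psum :: "nat \<Rightarrow> real \<Rightarrow> int \<Rightarrow> int \<Rightarrow> real" where
  "psum K t x y = (\<Sum>k<K. iter k t x y)"

lemma psum_nonneg: "x \<in> S \<Longrightarrow> 0 \<le> t \<Longrightarrow> 0 \<le> psum K t x y"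
  unfolding psum_def by (intro sum_nonneg iter_nonneg)

lemma continuous_on_psum: "x \<in> S \<Longrightarrow> continuous_on {0..T} (\<lambda>t. psum K t x y)"
  unfolding psum_def by (intro continuous_intros continuous_on_iter)

lemma psum_Suc_eq:
  "psum (Suc K) t x y = exp (- (a x + b x) * t) *
    ((if x = y then 1 else 0) + integral {0..t} (\<lambda>s. exp ((a x + b x) * s) * jump (\<lambda>z. psum K s z y) x))"
proof -
  have "psum (Suc K) t x y = iter 0 t x y + (\<Sum>k<K. iter (Suc k) t x y)"
    unfolding psum_def by (rule sum.lessThan_Suc_shift)
  also have "(\<Sum>k<K. iter (Suc k) t x y) = exp (- (a x + b x) * t) *
     (\<Sum>k<K. integral {0..t} (\<lambda>s. exp ((a x + b x) * s) * jump (\<lambda>z. iter k s z y) x))"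
    unfolding iter_Suc_eq by (simp add: sum_distrib_left)
  also have "(\<Sum>k<K. integral {0..t} (\<lambda>s. exp ((a x + b x) * s) * jump (\<lambda>z. iter k s z y) x))
    = integral {0..t} (\<lambda>s. exp ((a x + b x) * s) * jump (\<lambda>z. psum K s z y) x)"
    unfolding psum_def bd_jump_sum sum_distrib_left
    by (intro integral_sum[symmetric] iter_integrand_integrable) auto
  finally show ?thesis by (simp add: algebra_simps)
qed

lemma integral_exp_rate:
  fixes q :: real
  assumes "0 \<le> t"
  shows "integral {0..t} (\<lambda>s. exp (q * s) * q) = exp (q * t) - 1"
proof -
  have "((\<lambda>s. exp (q * s) * q) has_integral exp (q * t) - exp (q * 0)) {0..t}"
    using assms by (intro fundamental_theorem_of_calculus)
      (auto intro!: derivative_eq_intros simp: has_real_derivative_iff_has_vector_derivative[symmetric])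
  from integral_unique[OF this] show ?thesis by (simp del: integral_mult_left)
qed

lemma sum_psum_le_1:
  assumes "finite A" "x \<in> S" "0 \<le> t"
  shows "(\<Sum>y\<in>A. psum K t x y) \<le> 1"
  using assms(2,3)
proof (induction K arbitrary: x t)
  case 0
  thus ?case by (simp add: psum_def)
next
  case (Suc K)
  define q where "q = a x + b x"
  have int: "(\<lambda>s. exp (q * s) * jump (\<lambda>z. psum K s z y) x) integrable_on {0..t}" for y
    by (intro integrable_continuous_real continuous_intros continuous_on_jump continuous_on_psum)
  have "(\<Sum>y\<in>A. psum (Suc K) t x y) = exp (- q * t) * ((\<Sum>y\<in>A. if x = y then 1 else 0) +
     (\<Sum>y\<in>A. integral {0..t} (\<lambda>s. exp (q * s) * jump (\<lambda>z. psum K s z y) x)))"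
    unfolding psum_Suc_eq q_def by (simp only: sum_distrib_left[symmetric] sum.distrib)
  also have "(\<Sum>y\<in>A. integral {0..t} (\<lambda>s. exp (q * s) * jump (\<lambda>z. psum K s z y) x))
    = integral {0..t} (\<lambda>s. exp (q * s) * jump (\<lambda>z. \<Sum>y\<in>A. psum K s z y) x)"
    unfolding bd_jump_sum sum_distrib_left by (intro integral_sum[symmetric] int assms(1))
  also have "\<dots> \<le> integral {0..t} (\<lambda>s. exp (q * s) * q)"
    unfolding bd_jump_sum sum_distrib_left
  proof (intro integral_le integrable_sum int assms(1))
    show "(\<lambda>s. exp (q * s) * q) integrable_on {0..t}"
      by (intro integrable_continuous_real continuous_intros)
    fix s assume "s \<in> {0..t}"
    hence "jump (\<lambda>z. \<Sum>y\<in>A. psum K s z y) x \<le> q"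
      unfolding q_def by (intro jump_le_rate Suc) auto
    thus "(\<Sum>y\<in>A. exp (q * s) * jump (\<lambda>z. psum K s z y) x) \<le> exp (q * s) * q"
      unfolding bd_jump_sum sum_distrib_left[symmetric] by simp
  qed
  also have "\<dots> = exp (q * t) - 1" using Suc by (intro integral_exp_rate) auto
  also have "(\<Sum>y\<in>A. if x = y then 1 else 0) \<le> (1::real)"
    using assms(1) by simp
  finally have "(\<Sum>y\<in>A. psum (Suc K) t x y) \<le> exp (- q * t) * exp (q * t)"
    by simp
  thus ?case by (simp flip: exp_add)
qed

lemma psum_le_1: "x \<in> S \<Longrightarrow> 0 \<le> t \<Longrightarrow> psum K t x y \<le> 1"
  using sum_psum_le_1[of "{y}"] by simp

lemma summable_iter: "x \<in> S \<Longrightarrow> 0 \<le> t \<Longrightarrow> summable (\<lambda>k. iter k t x y)"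
  using psum_le_1[of x t _ y] unfolding psum_def
  by (intro summableI_nonneg_bounded[of _ 1] iter_nonneg) auto

lemma psum_tendsto: "x \<in> S \<Longrightarrow> 0 \<le> t \<Longrightarrow> (\<lambda>K. psum K t x y) \<longlonglongrightarrow> tr t x y"
  using summable_LIMSEQ[OF summable_iter] unfolding psum_def bd_trans_def .

lemma psum_le_trans: "x \<in> S \<Longrightarrow> 0 \<le> t \<Longrightarrow> psum K t x y \<le> tr t x y"
  unfolding psum_def bd_trans_def by (intro sum_le_suminf summable_iter) (auto intro: iter_nonneg)

lemma trans_nonneg: "x \<in> S \<Longrightarrow> 0 \<le> t \<Longrightarrow> 0 \<le> tr t x y"
  using psum_le_trans[of x t 0 y] by (simp add: psum_def)

lemma sum_trans_le_1:
  assumes "finite A" "x \<in> S" "0 \<le> t"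
  shows "(\<Sum>y\<in>A. tr t x y) \<le> 1"
  by (rule LIMSEQ_le_const2[OF tendsto_sum[OF psum_tendsto]]) (use assms sum_psum_le_1 in auto)

lemma trans_summable: 
  assumes "x \<in> S" "0 \<le> t"
  shows "tr t x summable_on A"
  using assms by (intro nonneg_bounded_partial_sums_imp_summable_on[where C = 1] trans_nonneg)
    (auto intro!: eventually_finite_subsets_at_top_weakI sum_trans_le_1)

lemma infsum_trans_le_1:
  assumes "x \<in> S" "0 \<le> t"
  shows "(\<Sum>\<^sub>\<infinity>y\<in>A. tr t x y) \<le> 1"
  using assms by (intro infsum_le_finite_sums trans_summable sum_trans_le_1)

lemma trans_0: "tr 0 x y = (if x = y then 1 else 0)"
proof -
  have "iter k 0 x y = (if k = 0 then (if x = y then 1 else 0) else 0)" for k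
    by (cases k) auto
  thus ?thesis unfolding bd_trans_def
    using suminf_finite[of "{0}" "\<lambda>k. iter k 0 x y"] by simp
qed

text \<open>Dominated convergence in \<open>psum_Suc_eq\<close>: partial sums lie between 0 and 1,
  so the jump term is at most the total rate. The integral form yields continuity first and then the
  derivative.\<close>

lemma trans_integral_eq:
  fixes y :: int
  assumes "x \<in> S" "0 \<le> t"
  defines "g \<equiv> \<lambda>s. exp ((a x + b x) * s) * jump (\<lambda>z. tr s z y) x"
  shows "g integrable_on {0..t}"
    and "tr t x y = exp (- (a x + b x) * t) * ((if x = y then 1 else 0) + integral {0..t} g)"
proof -
  let ?f = "\<lambda>K s. exp ((a x + b x) * s) * jump (\<lambda>z. psum K s z y) x"
  have 1: "?f K integrable_on {0..t}" for K
    by (intro integrable_continuous_real continuous_intros continuous_on_jump continuous_on_psum)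
  have 2: "(\<lambda>s. exp ((a x + b x) * s) * (a x + b x)) integrable_on {0..t}"
    by (intro integrable_continuous_real continuous_intros)
  have 3: "norm (?f K s) \<le> exp ((a x + b x) * s) * (a x + b x)" if "s \<in> {0..t}" for K s
    using that jump_nonneg[OF assms(1), of "\<lambda>z. psum K s z y"] jump_le_rate[OF assms(1), of "\<lambda>z. psum K s z y"]
      psum_nonneg psum_le_1 by (simp add: abs_mult)
  have 4: "(\<lambda>K. ?f K s) \<longlonglongrightarrow> g s" if "s \<in> {0..t}" for s
    using that unfolding g_def by (intro tendsto_intros tendsto_jump psum_tendsto) auto
  note dc = dominated_convergence[OF 1 2 3 4]
  show "g integrable_on {0..t}" by (rule dc(1))
  have "(\<lambda>K. psum (Suc K) t x y) \<longlonglongrightarrow> exp (- (a x + b x) * t) * ((if x = y then 1 else 0) + integral {0..t} g)"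
    unfolding psum_Suc_eq by (intro tendsto_intros dc(2))
  moreover have "(\<lambda>K. psum (Suc K) t x y) \<longlonglongrightarrow> tr t x y"
    using psum_tendsto[OF assms(1,2)] by (rule LIMSEQ_Suc)
  ultimately show "tr t x y = exp (- (a x + b x) * t) * ((if x = y then 1 else 0) + integral {0..t} g)"
    using LIMSEQ_unique by blast
qed

lemma continuous_on_trans:
  assumes "x \<in> S" "0 \<le> T"
  shows "continuous_on {0..T} (\<lambda>t. tr t x y)"
proof -
  have "continuous_on {0..T} (\<lambda>t. exp (- (a x + b x) * t) * ((if x = y then 1 else 0) +
      integral {0..t} (\<lambda>s. exp ((a x + b x) * s) * jump (\<lambda>z. tr s z y) x)))"
    by (intro continuous_intros indefinite_integral_continuous_1 trans_integral_eq(1) assms)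
  thus ?thesis
    by (rule continuous_on_eq) (use trans_integral_eq(2)[OF assms(1)] in auto)
qed

lemma trans_has_derivative:
  assumes "x \<in> S" "t \<in> {0..T}"
  shows "((\<lambda>t. tr t x y) has_real_derivative
     (jump (\<lambda>z. tr t z y) x - (a x + b x) * tr t x y)) (at t within {0..T})"
proof -
  let ?q = "a x + b x"
  let ?g = "\<lambda>s. exp (?q * s) * jump (\<lambda>z. tr s z y) x"
  let ?G = "\<lambda>t. (if x = y then 1 else 0) + integral {0..t} ?g"
  have T: "0 \<le> T" using assms by auto
  have "((\<lambda>t. integral {0..t} ?g) has_real_derivative ?g t) (at t within {0..T})"
    using assms T by (intro integral_has_real_derivative continuous_intros continuous_on_jump continuous_on_trans)
  from DERIV_add[OF DERIV_const[of "if x = y then 1 else 0"] this]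
  have G: "(?G has_real_derivative ?g t) (at t within {0..T})" by simp
  have E: "((\<lambda>t. exp (- ?q * t)) has_real_derivative - ?q * exp (- ?q * t)) (at t within {0..T})"
    by (auto intro!: derivative_eq_intros)
  from DERIV_mult[OF E G] have "((\<lambda>t. exp (- ?q * t) * ?G t) has_real_derivative
      (exp (- ?q * t) * ?g t - ?q * (exp (- ?q * t) * ?G t))) (at t within {0..T})"
    by (rule DERIV_cong) (simp add: algebra_simps)
  also have "exp (- ?q * t) * ?g t = jump (\<lambda>z. tr t z y) x"
    by (simp add: algebra_simps flip: exp_add mult.assoc)
  also have "exp (- ?q * t) * ?G t = tr t x y"
    using trans_integral_eq(2)[OF assms(1), of t y] assms(2) by simp
  finally show ?thesis
    by (rule has_field_derivative_transform_within[where d = 1, OF _ _ assms(2)])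
       (use trans_integral_eq(2)[OF assms(1)] in auto)
qed

end

text \<open>A path with \<open>k\<close> jumps stays within distance \<open>k\<close> of its start
  and cannot feel changes further away. This is how the windows are compared with the full
  chain.\<close>

lemma bd_iter_local:
  assumes "\<And>z. \<bar>z - x\<bar> \<le> int k \<Longrightarrow> z \<in> S \<longleftrightarrow> z \<in> S'"
    and "\<And>z. z \<in> S \<Longrightarrow> \<bar>z - x\<bar> \<le> int k \<Longrightarrow> a z = a' z \<and> b z = b' z" and "x \<in> S"
  shows "bd_iter S a b k t x y = bd_iter S' a' b' k t x y"
  using assms
proof (induction k arbitrary: t x)
  case (Suc k)
  have "bd_iter S a b k s z y = bd_iter S' a' b' k s z y" if "z = x + 1 \<or> z = x - 1" "z \<in> S" for s z
    using that by (intro Suc.IH Suc.prems) auto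
  moreover have "x + 1 \<in> S \<longleftrightarrow> x + 1 \<in> S'" "x - 1 \<in> S \<longleftrightarrow> x - 1 \<in> S'" "a x = a' x" "b x = b' x"
    using Suc.prems by auto
  ultimately show ?case by (auto intro!: integral_cong)
qed auto

text \<open>A path inside \<open>S\<close> has the same weight in both chains, because the holding
  rates are not altered; the larger set only removes killing.\<close>

lemma bd_iter_mono_set:
  assumes "bd_rates S' a b" "S \<subseteq> S'" "x \<in> S" "0 \<le> t"
  shows "bd_iter S a b k t x y \<le> bd_iter S' a b k t x y"
  using assms(3,4)
proof (induction k arbitrary: t x)
  case (Suc k)
  interpret S': bd_rates S' a b by fact
  interpret bd_rates S a b using S'.rates_nonneg assms(2) by unfold_locales auto
  have "jump (\<lambda>z. iter k s z y) x \<le> S'.jump (\<lambda>z. S'.iter k s z y) x" if "s \<in> {0..t}" for s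
  proof -
    have "jump (\<lambda>z. iter k s z y) x \<le> jump (\<lambda>z. S'.iter k s z y) x"
      using that Suc by (intro jump_mono) auto
    also have "\<dots> \<le> S'.jump (\<lambda>z. S'.iter k s z y) x"
      unfolding bd_jump_def using assms(2) Suc.prems that S'.rates_nonneg[of x]
      by (intro add_mono) (auto intro!: mult_nonneg_nonneg S'.iter_nonneg)
    finally show ?thesis .
  qed
  thus ?case
    unfolding iter_Suc_eq S'.iter_Suc_eq
    by (intro mult_left_mono integral_le iter_integrand_integrable S'.iter_integrand_integrable) auto
qed simp

subsection \<open>Reflected truncations and Siegmund duality\<close>

lemma bd_trans_mono_set:
  assumes "bd_rates S' a b" "S \<subseteq> S'" "x \<in> S" "0 \<le> t"
  shows "bd_trans S a b t x y \<le> bd_trans S' a b t x y"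
proof -
  interpret S': bd_rates S' a b by fact
  interpret bd_rates S a b using S'.rates_nonneg assms(2) by unfold_locales auto
  show ?thesis unfolding bd_trans_def
    using assms by (intro suminf_le bd_iter_mono_set summable_iter S'.summable_iter) auto
qed

text \<open>One interface for both state spaces. \<open>hpi_step\<close> is detailed balance for the
  dual rates. \<open>lyap\<close> makes \<open>exp (- t) * f\<close> along the chain a
  supermartingale, and coercivity then excludes escape to infinity in finite time.\<close>

locale bd_lyapunov =
  fixes I :: "int set" and lam mu f :: "int \<Rightarrow> real"
  assumes up_closed: "x \<in> I \<Longrightarrow> x \<le> y \<Longrightarrow> y \<in> I"
    and lam_pos: "x \<in> I \<Longrightarrow> 0 < lam x"
    and mu_pos: "x \<in> I \<Longrightarrow> x - 1 \<in> I \<Longrightarrow> 0 < mu x"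
    and mu_zero: "x \<in> I \<Longrightarrow> x - 1 \<notin> I \<Longrightarrow> mu x = 0"
    and hpi_pos: "x \<in> I \<Longrightarrow> 0 < hpi lam mu x"
    and hpi_step: "x \<in> I \<Longrightarrow> hpi lam mu (x + 1) * lam (x + 1) = hpi lam mu x * mu (x + 1)"
    and lyap: "x \<in> I \<Longrightarrow> lam x * (f (x + 1) - f x) + mu x * (f (x - 1) - f x) \<le> f x"
    and lyap_nonneg: "x \<in> I \<Longrightarrow> 0 \<le> f x"
    and lyap_coercive: "\<exists>N. \<forall>x\<in>I. N \<le> \<bar>x\<bar> \<longrightarrow> C \<le> f x"
begin

lemma mu_nonneg: "x \<in> I \<Longrightarrow> 0 \<le> mu x"
  using mu_pos mu_zero by (cases "x - 1 \<in> I") (auto intro: less_imp_le)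

lemma mu_Suc_pos: "x \<in> I \<Longrightarrow> 0 < mu (x + 1)"
  using mu_pos[of "x + 1"] up_closed[of x "x + 1"] by simp

sublocale chain: bd_rates I lam mu
  using lam_pos mu_nonneg by unfold_locales (auto intro: less_imp_le)

sublocale dual: bd_rates I "\<lambda>x. mu (x + 1)" lam
  using lam_pos mu_Suc_pos by unfold_locales (auto intro: less_imp_le)

abbreviation "p \<equiv> ptr I lam mu"
abbreviation "hp \<equiv> hptr I lam mu"
abbreviation "w \<equiv> hpi lam mu"

lemma p_eq: "p = chain.tr" and hp_eq: "hp = dual.tr"
  by (simp_all add: ptr_def hptr_def)

definition trunc :: "nat \<Rightarrow> int set" where "trunc M = I \<inter> {- int M..int M}"

lemma finite_trunc [simp]: "finite (trunc M)" by (simp add: trunc_def)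

lemma trunc_subset: "trunc M \<subseteq> I" by (auto simp: trunc_def)

lemma trunc_convex: "x \<in> trunc M \<Longrightarrow> y \<in> trunc M \<Longrightarrow> x \<le> z \<Longrightarrow> z \<le> y \<Longrightarrow> z \<in> trunc M"
  using up_closed by (auto simp: trunc_def)

lemma eventually_in_trunc: "x \<in> I \<Longrightarrow> \<forall>\<^sub>F M in sequentially. x \<in> trunc M"
  using eventually_ge_at_top[of "nat \<bar>x\<bar>"] by eventually_elim (auto simp: trunc_def)

text \<open>Here a jump out of the window kills. The lost mass is at most
  \<open>exp t * f x / C\<close>, since this function is a supersolution that is at least 1 wherever
  mass can be lost.\<close>

lemma trunc_mass:
  assumes "x \<in> trunc M" "0 \<le> t" "0 < C" and C: "\<And>z. z \<in> I - trunc M \<Longrightarrow> C \<le> f z"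
  shows "1 - exp t * f x / C \<le> (\<Sum>z\<in>trunc M. bd_trans (trunc M) lam mu t x z)"
proof -
  interpret B: bd_rates "trunc M" lam mu
    using chain.rates_nonneg trunc_subset by unfold_locales auto
  define v where "v t x = (\<Sum>z\<in>trunc M. B.tr t x z)" for t x
  define g where "g t x = exp t * f x / C" for t x
  let ?q = "\<lambda>x. lam x + mu x"
  have "0 \<le> v t x - 1 + g t x"
  proof (rule finite_system_nonneg[where J = "trunc M" and T = t and j = x and u = "\<lambda>x t. v t x - 1 + g t x"
        and u' = "\<lambda>x t. B.jump (v t) x - ?q x * v t x + g t x" and r = ?q and d = ?q])
    fix x s assume x: "x \<in> trunc M" and s: "s \<in> {0..t}"
    have "((\<lambda>t. v t x) has_real_derivative (\<Sum>z\<in>trunc M. B.jump (\<lambda>y. B.tr s y z) x - ?q x * B.tr s x z)) (at s within {0..t})"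
      unfolding v_def by (intro DERIV_sum B.trans_has_derivative x s)
    also have "(\<Sum>z\<in>trunc M. B.jump (\<lambda>y. B.tr s y z) x - ?q x * B.tr s x z) = B.jump (v s) x - ?q x * v s x"
      unfolding v_def bd_jump_sum by (simp add: sum_subtractf sum_distrib_left)
    finally have 1: "((\<lambda>t. v t x) has_real_derivative B.jump (v s) x - ?q x * v s x) (at s within {0..t})" .
    have 2: "((\<lambda>t. g t x) has_real_derivative g s x) (at s within {0..t})"
      unfolding g_def using \<open>0 < C\<close> by (auto intro!: derivative_eq_intros)
    from DERIV_add[OF DERIV_diff[OF 1 DERIV_const[of 1]] 2]
    show "((\<lambda>t. v t x - 1 + g t x) has_real_derivative B.jump (v s) x - ?q x * v s x + g s x) (at s within {0..t})"
      by simp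
  next
    fix x assume x: "x \<in> trunc M"
    hence "0 \<le> f x" using lyap_nonneg trunc_subset by auto
    moreover have "v 0 x = 1" using x unfolding v_def B.trans_0 by simp
    ultimately show "0 \<le> v 0 x - 1 + g 0 x" using \<open>0 < C\<close> by (auto simp: g_def)
  next
    fix x assume "x \<in> trunc M"
    thus "0 \<le> ?q x" using B.rates_nonneg by auto
  next
    fix x s m assume x: "x \<in> trunc M" and s: "s \<in> {0..t}" and m: "m \<le> 0"
      and lb: "\<And>i. i \<in> trunc M \<Longrightarrow> m \<le> v s i - 1 + g s i"
    have xI: "x \<in> I" using x trunc_subset by auto
    \<comment> \<open>A site outside the window carries no mass, but there \<open>g\<close> is at
      least 1, and \<open>m + 1 \<le> 1\<close>.\<close>
    have nb: "m + 1 \<le> (if z \<in> trunc M then v s z else 0) + g s z" if "z \<in> I" for z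
    proof (cases "z \<in> trunc M")
      case False
      hence "1 \<le> f z / C" using C[of z] that \<open>0 < C\<close> by simp
      moreover have "1 \<le> exp s" using s by simp
      ultimately have "1 * 1 \<le> exp s * (f z / C)" by (intro mult_mono) auto
      thus ?thesis using m False by (simp add: g_def)
    qed (use lb[of z] in simp)
    have "lam x * (m + 1) \<le> lam x * ((if x + 1 \<in> trunc M then v s (x + 1) else 0) + g s (x + 1))"
      using nb[of "x + 1"] up_closed[OF xI, of "x + 1"] lam_pos[OF xI] by (intro mult_left_mono) auto
    moreover have "mu x * (m + 1) \<le> mu x * ((if x - 1 \<in> trunc M then v s (x - 1) else 0) + g s (x - 1))"
      using nb[of "x - 1"] mu_zero[OF xI] mu_nonneg[OF xI]
      by (cases "x - 1 \<in> I") (auto intro!: mult_left_mono)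
    ultimately have "?q x * (m + 1) \<le> B.jump (v s) x + (lam x * g s (x + 1) + mu x * g s (x - 1))"
      by (auto simp: bd_jump_def algebra_simps)
    also have "lam x * g s (x + 1) + mu x * g s (x - 1) \<le> g s x + ?q x * g s x"
    proof -
      have "lam x * f (x + 1) + mu x * f (x - 1) \<le> f x + ?q x * f x"
        using lyap[OF xI] by (simp add: algebra_simps)
      hence "exp s / C * (lam x * f (x + 1) + mu x * f (x - 1)) \<le> exp s / C * (f x + ?q x * f x)"
        using \<open>0 < C\<close> by (intro mult_left_mono) auto
      thus ?thesis by (simp add: g_def algebra_simps add_divide_distrib)
    qed
    finally show "?q x * m - ?q x * (v s x - 1 + g s x) \<le> B.jump (v s) x - ?q x * v s x + g s x"
      by (simp add: algebra_simps)
  qed (use assms in auto)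
  thus ?thesis by (simp add: v_def g_def)
qed

lemma p_has_sum_1:
  assumes x: "x \<in> I" and t: "0 \<le> t"
  shows "(p t x has_sum 1) I"
proof -
  have le: "infsum (p t x) I \<le> 1" unfolding p_eq using x t by (rule chain.infsum_trans_le_1)
  have "1 - exp t * f x / C \<le> infsum (p t x) I" if "0 < C" for C
  proof -
    obtain N where N: "\<And>z. z \<in> I \<Longrightarrow> N \<le> \<bar>z\<bar> \<Longrightarrow> C \<le> f z" using lyap_coercive by blast
    \<comment> \<open>The window contains every site where \<open>f\<close> may be below
      \<open>C\<close>, and also \<open>x\<close>; afterwards \<open>C\<close> tends to
      infinity.\<close>
    define M where "M = nat (max \<bar>N\<bar> \<bar>x\<bar>)"
    have xM: "x \<in> trunc M" using x unfolding trunc_def M_def by auto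
    have "1 - exp t * f x / C \<le> (\<Sum>z\<in>trunc M. bd_trans (trunc M) lam mu t x z)"
      by (rule trunc_mass[OF xM t that]) (auto intro!: N simp: trunc_def M_def max_def split: if_splits)
    also have "\<dots> \<le> (\<Sum>z\<in>trunc M. p t x z)"
      unfolding p_eq using xM t trunc_subset chain.bd_rates_axioms by (intro sum_mono bd_trans_mono_set) auto
    also have "\<dots> \<le> infsum (p t x) I"
      unfolding p_eq using x t trunc_subset
      by (intro finite_sum_le_infsum chain.trans_summable chain.trans_nonneg) auto
    finally show ?thesis .
  qed
  hence ev: "\<forall>\<^sub>F C in at_top. 1 - exp t * f x / C \<le> infsum (p t x) I"
    using eventually_gt_at_top[of "0::real"] by (rule eventually_mono[rotated]) auto
  have "((\<lambda>C. 1 - exp t * f x / C) \<longlongrightarrow> 1 - 0) at_top"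
    by (intro tendsto_intros tendsto_divide_0[OF tendsto_const] filterlim_at_top_imp_at_infinity filterlim_ident)
  hence "1 \<le> infsum (p t x) I"
    using tendsto_upperbound[OF _ ev] by simp
  hence "infsum (p t x) I = 1" using le by simp
  thus ?thesis using chain.trans_summable[OF x t, of I] unfolding p_eq by (metis has_sum_infsum)
qed

lemma p_summable: "x \<in> I \<Longrightarrow> 0 \<le> t \<Longrightarrow> p t x summable_on A"
  unfolding p_eq by (rule chain.trans_summable)

section \<open>The reflected chain in a window and its convergence\<close>

definition lamR :: "nat \<Rightarrow> int \<Rightarrow> real" where "lamR M x = (if x + 1 \<in> trunc M then lam x else 0)"
definition muR :: "nat \<Rightarrow> int \<Rightarrow> real" where "muR M x = (if x - 1 \<in> trunc M then mu x else 0)"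

sublocale refl: bd_rates "trunc M" "lamR M" "muR M" for M
  using chain.rates_nonneg trunc_subset by unfold_locales (auto simp: lamR_def muR_def)

text \<open>A jump out of the set would kill in \<open>bd_trans\<close>. Setting the rate of that
  jump to zero removes it from the holding rate as well, and this is reflection.\<close>

definition pR :: "nat \<Rightarrow> real \<Rightarrow> int \<Rightarrow> int \<Rightarrow> real" where
  "pR M = bd_trans (trunc M) (lamR M) (muR M)"

lemma pR_has_derivative:
  assumes "x \<in> trunc M" "t \<in> {0..T}"
  shows "((\<lambda>t. pR M t x y) has_real_derivative
     lamR M x * (pR M t (x + 1) y - pR M t x y) + muR M x * (pR M t (x - 1) y - pR M t x y)) (at t within {0..T})"
  using refl.trans_has_derivative[OF assms, of y] unfolding pR_def
  by (rule DERIV_cong) (auto simp: bd_jump_def lamR_def muR_def algebra_simps)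

lemma pR_0: "pR M 0 x y = (if x = y then 1 else 0)"
  unfolding pR_def by (rule refl.trans_0)

lemma sum_pR:
  assumes "x \<in> trunc M" "0 \<le> t"
  shows "(\<Sum>y\<in>trunc M. pR M t x y) = 1"
proof -
  define v where "v x t = (\<Sum>y\<in>trunc M. pR M t x y)" for x t
  have "v x t \<le> 1" unfolding v_def pR_def by (rule refl.sum_trans_le_1) (use assms in auto)
  moreover have "0 \<le> v x t - 1"
  proof (rule finite_system_nonneg[where J = "trunc M" and T = t and j = x and u = "\<lambda>x t. v x t - 1"
        and u' = "\<lambda>x t. lamR M x * (v (x + 1) t - v x t) + muR M x * (v (x - 1) t - v x t)"
        and r = "\<lambda>x. lamR M x + muR M x" and d = "\<lambda>x. lamR M x + muR M x"])
    fix x s assume x: "x \<in> trunc M" and s: "s \<in> {0..t}"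
    have "((\<lambda>t. v x t) has_real_derivative (\<Sum>y\<in>trunc M. lamR M x * (pR M s (x + 1) y - pR M s x y)
       + muR M x * (pR M s (x - 1) y - pR M s x y))) (at s within {0..t})"
      unfolding v_def by (intro DERIV_sum pR_has_derivative x s)
    from DERIV_diff[OF this DERIV_const[of 1]]
    show "((\<lambda>t. v x t - 1) has_real_derivative lamR M x * (v (x + 1) s - v x s)
      + muR M x * (v (x - 1) s - v x s)) (at s within {0..t})"
      by (rule DERIV_cong) (simp add: v_def sum.distrib sum_distrib_left sum_subtractf right_diff_distrib)
  next
    fix x assume "x \<in> trunc M"
    thus "0 \<le> v x 0 - 1" unfolding v_def pR_0 by simp
  next
    fix x assume "x \<in> trunc M"
    thus "0 \<le> lamR M x + muR M x" using refl.rates_nonneg by auto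
  next
    fix x s m assume x: "x \<in> trunc M" and s: "s \<in> {0..t}" and m: "m \<le> 0"
      and lb: "\<And>i. i \<in> trunc M \<Longrightarrow> m \<le> v i s - 1"
    have "lamR M x * m \<le> lamR M x * (v (x + 1) s - 1)"
      using lb[of "x + 1"] refl.rates_nonneg(1)[OF x] by (auto simp: lamR_def intro!: mult_left_mono)
    moreover have "muR M x * m \<le> muR M x * (v (x - 1) s - 1)"
      using lb[of "x - 1"] refl.rates_nonneg(2)[OF x] by (auto simp: muR_def intro!: mult_left_mono)
    ultimately show "(lamR M x + muR M x) * m - (lamR M x + muR M x) * (v x s - 1)
      \<le> lamR M x * (v (x + 1) s - v x s) + muR M x * (v (x - 1) s - v x s)"
      by (simp add: algebra_simps)
  qed (use assms in auto)
  ultimately show ?thesis by (simp add: v_def)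
qed

lemma trunc_local:
  assumes "x \<in> I" "nat \<bar>x\<bar> + K + 1 \<le> M" "\<bar>z - x\<bar> \<le> int K"
  shows "z \<in> trunc M \<longleftrightarrow> z \<in> I" "z + 1 \<in> trunc M \<longleftrightarrow> z + 1 \<in> I" "z - 1 \<in> trunc M \<longleftrightarrow> z - 1 \<in> I"
  using assms by (auto simp: trunc_def)

text \<open>Paths with fewer than \<open>K\<close> jumps do not reach the edge of such a window, so
  they have the same weight for the reflected chain.\<close>

lemma psum_le_pR:
  assumes "x \<in> I" "0 \<le> t" "nat \<bar>x\<bar> + K + 1 \<le> M"
  shows "chain.psum K t x y \<le> pR M t x y"
proof -
  have "chain.psum K t x y = refl.psum M K t x y"
    unfolding refl.psum_def chain.psum_def
  proof (intro sum.cong HOL.refl bd_iter_local)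
    fix k z assume "k \<in> {..<K}" "\<bar>z - x\<bar> \<le> int k"
    hence z: "\<bar>z - x\<bar> \<le> int K" by simp
    note loc = trunc_local[OF assms(1,3) z]
    show "z \<in> I \<longleftrightarrow> z \<in> trunc M" using loc by simp
    show "lam z = lamR M z \<and> mu z = muR M z" if "z \<in> I"
      using loc that up_closed[of z "z + 1"] mu_zero[of z] by (auto simp: lamR_def muR_def)
  qed (use assms in auto)
  also have "\<dots> \<le> pR M t x y"
    unfolding pR_def using assms trunc_local[OF assms(1,3), of x] by (intro refl.psum_le_trans) auto
  finally show ?thesis .
qed

lemma sum_pR_ge:
  assumes x: "x \<in> I" and t: "0 \<le> t" and A: "finite A" "A \<subseteq> B" "B \<subseteq> I" and e: "0 < e"
  shows "\<forall>\<^sub>F M in sequentially. (\<Sum>y\<in>A. p t x y) - e < (\<Sum>y\<in>B \<inter> trunc M. pR M t x y)"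
proof -
  have "(\<lambda>K. \<Sum>y\<in>A. chain.psum K t x y) \<longlonglongrightarrow> (\<Sum>y\<in>A. p t x y)"
    unfolding p_eq by (intro tendsto_sum chain.psum_tendsto x t)
  from order_tendstoD(1)[OF this, of "(\<Sum>y\<in>A. p t x y) - e"] e
  obtain K where K: "(\<Sum>y\<in>A. p t x y) - e < (\<Sum>y\<in>A. chain.psum K t x y)"
    by (auto simp: eventually_sequentially)
  have "\<forall>\<^sub>F M in sequentially. \<forall>y\<in>A. y \<in> trunc M"
    using A by (auto intro!: eventually_ball_finite eventually_in_trunc)
  moreover note eventually_ge_at_top[of "nat \<bar>x\<bar> + K + 1"] eventually_in_trunc[OF x]
  ultimately show ?thesis
  proof eventually_elim
    case (elim M)
    have "(\<Sum>y\<in>A. chain.psum K t x y) \<le> (\<Sum>y\<in>A. pR M t x y)"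
      by (intro sum_mono psum_le_pR x t elim)
    also have "\<dots> \<le> (\<Sum>y\<in>B \<inter> trunc M. pR M t x y)"
      using elim A t unfolding pR_def by (intro sum_mono2 refl.trans_nonneg) auto
    finally show ?case using K by linarith
  qed
qed

text \<open>Locality yields only lower bounds. The upper bound on \<open>B\<close> is the lower
  bound on \<open>I - B\<close>, because the reflected chain has mass one in every window and the
  full chain has mass one by \<open>p_has_sum_1\<close>.\<close>

lemma sum_pR_tendsto:
  assumes x: "x \<in> I" and t: "0 \<le> t" and B: "B \<subseteq> I"
  shows "(\<lambda>M. \<Sum>y\<in>B \<inter> trunc M. pR M t x y) \<longlonglongrightarrow> infsum (p t x) B"
proof -
  have lower: "\<forall>\<^sub>F M in sequentially. infsum (p t x) B - e < (\<Sum>y\<in>B \<inter> trunc M. pR M t x y)"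
    if e: "0 < e" and B: "B \<subseteq> I" for e B
  proof -
    obtain A where A: "finite A" "A \<subseteq> B" and d: "dist (sum (p t x) A) (infsum (p t x) B) \<le> e / 2"
      using infsum_finite_approximation[of "p t x" B "e / 2"] p_summable[OF x t, of B] e by auto
    from sum_pR_ge[OF x t A B, of "e / 2"] e
    have "\<forall>\<^sub>F M in sequentially. (\<Sum>y\<in>A. p t x y) - e / 2 < (\<Sum>y\<in>B \<inter> trunc M. pR M t x y)" by simp
    moreover have "infsum (p t x) B - e / 2 \<le> sum (p t x) A" using d unfolding dist_real_def by arith
    ultimately show ?thesis by (elim eventually_mono) linarith
  qed
  have split: "infsum (p t x) B + infsum (p t x) (I - B) = 1"
  proof -
    have "infsum (p t x) (B \<union> (I - B)) = infsum (p t x) B + infsum (p t x) (I - B)"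
      by (intro infsum_Un_disjoint p_summable x t) auto
    moreover have "B \<union> (I - B) = I" using B by auto
    ultimately show ?thesis using infsumI[OF p_has_sum_1[OF x t]] by simp
  qed
  show ?thesis
  proof (rule order_tendstoI)
    fix c assume "c < infsum (p t x) B"
    thus "\<forall>\<^sub>F M in sequentially. c < (\<Sum>y\<in>B \<inter> trunc M. pR M t x y)"
      using lower[of "infsum (p t x) B - c" B] B by simp
  next
    fix c assume c: "infsum (p t x) B < c"
    have "\<forall>\<^sub>F M in sequentially. infsum (p t x) (I - B) - (c - infsum (p t x) B) < (\<Sum>y\<in>(I - B) \<inter> trunc M. pR M t x y)"
      using c by (intro lower) auto
    thus "\<forall>\<^sub>F M in sequentially. (\<Sum>y\<in>B \<inter> trunc M. pR M t x y) < c"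
      using eventually_in_trunc[OF x]
    proof eventually_elim
      case (elim M)
      have "(\<Sum>y\<in>(B \<inter> trunc M) \<union> ((I - B) \<inter> trunc M). pR M t x y)
        = (\<Sum>y\<in>B \<inter> trunc M. pR M t x y) + (\<Sum>y\<in>(I - B) \<inter> trunc M. pR M t x y)"
        by (intro sum.union_disjoint) auto
      also have "(B \<inter> trunc M) \<union> ((I - B) \<inter> trunc M) = trunc M" using B trunc_subset by auto
      finally show ?case using elim sum_pR[OF elim(2) t] split by simp
    qed
  qed
qed

lemma pR_tendsto:
  assumes "x \<in> I" "0 \<le> t" "y \<in> I"
  shows "(\<lambda>M. pR M t x y) \<longlonglongrightarrow> p t x y"
proof -
  have "(\<lambda>M. \<Sum>z\<in>{y} \<inter> trunc M. pR M t x z) \<longlonglongrightarrow> infsum (p t x) {y}"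
    using assms by (intro sum_pR_tendsto) auto
  moreover have "\<forall>\<^sub>F M in sequentially. (\<Sum>z\<in>{y} \<inter> trunc M. pR M t x z) = pR M t x y"
    using eventually_in_trunc[OF assms(3)] by eventually_elim simp
  ultimately show ?thesis by (simp add: tendsto_cong)
qed

definition FR :: "nat \<Rightarrow> real \<Rightarrow> int \<Rightarrow> int \<Rightarrow> real" where
  "FR M t x y = (\<Sum>z\<in>{z\<in>trunc M. z \<le> y}. pR M t x z)"

abbreviation "F \<equiv> Pcum I lam mu"

lemma FR_tendsto:
  assumes "x \<in> I" "0 \<le> t"
  shows "(\<lambda>M. FR M t x y) \<longlonglongrightarrow> F t x y"
proof -
  have "{z\<in>trunc M. z \<le> y} = {z\<in>I. z \<le> y} \<inter> trunc M" for M using trunc_subset by auto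
  thus ?thesis unfolding FR_def Pcum_def using sum_pR_tendsto[OF assms, of "{z\<in>I. z \<le> y}"] by simp
qed

lemma FR_has_derivative:
  assumes "x \<in> trunc M" "t \<in> {0..T}"
  shows "((\<lambda>t. FR M t x y) has_real_derivative
     lamR M x * (FR M t (x + 1) y - FR M t x y) + muR M x * (FR M t (x - 1) y - FR M t x y)) (at t within {0..T})"
proof -
  have "((\<lambda>t. FR M t x y) has_real_derivative (\<Sum>z\<in>{z\<in>trunc M. z \<le> y}. lamR M x * (pR M t (x + 1) z - pR M t x z)
       + muR M x * (pR M t (x - 1) z - pR M t x z))) (at t within {0..T})"
    unfolding FR_def by (intro DERIV_sum pR_has_derivative assms)
  thus ?thesis
    by (rule DERIV_cong) (simp add: FR_def sum.distrib sum_distrib_left sum_subtractf right_diff_distrib)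
qed

lemma FR_0: "x \<in> trunc M \<Longrightarrow> FR M 0 x y = (if x \<le> y then 1 else 0)"
  unfolding FR_def pR_0 by simp

section \<open>The killed dual chain and Siegmund duality\<close>

definition htrunc :: "nat \<Rightarrow> int set" where "htrunc M = {y \<in> trunc M. y + 1 \<in> trunc M}"

lemma htrunc_subset: "htrunc M \<subseteq> I" using trunc_subset by (auto simp: htrunc_def)

lemma finite_htrunc [simp]: "finite (htrunc M)" by (simp add: htrunc_def)

text \<open>The dual sites are the bonds \<open>{y, y + 1}\<close> of the window. The rates are kept
  at the ends, so leaving the set of bonds kills.\<close>

sublocale hbd: bd_rates "htrunc M" "\<lambda>x. mu (x + 1)" lam for M
  using dual.rates_nonneg htrunc_subset by unfold_locales auto

text \<open>Killing at the edge only loses mass, so the full dual chain is an upper bound; locality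
  gives the lower bound.\<close>

lemma hbd_tendsto:
  assumes x: "x \<in> I" and t: "0 \<le> t"
  shows "(\<lambda>M. hbd.tr M t x y) \<longlonglongrightarrow> hp t x y"
proof (rule order_tendstoI)
  fix c assume "c < hp t x y"
  with order_tendstoD(1)[OF dual.psum_tendsto[OF x t, of y], of c]
  obtain K where K: "c < dual.psum K t x y" by (auto simp: hp_eq eventually_sequentially)
  show "\<forall>\<^sub>F M in sequentially. c < hbd.tr M t x y"
    using eventually_ge_at_top[of "nat \<bar>x\<bar> + K + 1"]
  proof eventually_elim
    case (elim M)
    have loc: "z \<in> htrunc M \<longleftrightarrow> z \<in> I" if "\<bar>z - x\<bar> \<le> int K" for z
      using trunc_local[OF x elim that] up_closed[of z "z + 1"] by (auto simp: htrunc_def)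
    hence "dual.psum K t x y = hbd.psum M K t x y"
      unfolding hbd.psum_def dual.psum_def by (intro sum.cong bd_iter_local) (use x in auto)
    also have "\<dots> \<le> hbd.tr M t x y"
      using loc[of x] x t by (intro hbd.psum_le_trans) auto
    finally show ?case using K by linarith
  qed
next
  fix c assume c: "hp t x y < c"
  have "\<forall>\<^sub>F M in sequentially. x \<in> trunc M \<and> x + 1 \<in> trunc M"
    using x up_closed[of x "x + 1"] by (intro eventually_conj eventually_in_trunc) auto
  thus "\<forall>\<^sub>F M in sequentially. hbd.tr M t x y < c"
  proof eventually_elim
    case (elim M)
    have "hbd.tr M t x y \<le> hp t x y"
      unfolding hp_eq using elim t htrunc_subset dual.bd_rates_axioms by (intro bd_trans_mono_set) (auto simp: htrunc_def)
    thus ?case using c by linarith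
  qed
qed

text \<open>Differencing a solution of the backward equation of the reflected chain gives a solution of the
  forward equation of the dual, which the reversing weight turns into its backward equation.\<close>

definition slope :: "nat \<Rightarrow> (int \<Rightarrow> real) \<Rightarrow> int \<Rightarrow> real" where
  "slope M g y = (if y \<in> htrunc M then (g y - g (y + 1)) / w y else 0)"

lemma slope_has_derivative:
  assumes g: "\<And>x. x \<in> trunc M \<Longrightarrow> ((\<lambda>t. g t x) has_real_derivative
      lamR M x * (g t (x + 1) - g t x) + muR M x * (g t (x - 1) - g t x)) (at t within A)"
    and y: "y \<in> htrunc M"
  shows "((\<lambda>t. slope M (g t) y) has_real_derivative
      mu (y + 1) * (slope M (g t) (y + 1) - slope M (g t) y) + lam y * (slope M (g t) (y - 1) - slope M (g t) y)) (at t within A)"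
proof -
  have yb: "y \<in> trunc M" "y + 1 \<in> trunc M" "y \<in> I" using y htrunc_subset by (auto simp: htrunc_def)
  have w: "0 < w y" using hpi_pos yb by auto
  let ?D = "\<lambda>x. lamR M x * (g t (x + 1) - g t x) + muR M x * (g t (x - 1) - g t x)"
  have "((\<lambda>t. (g t y - g t (y + 1)) / w y) has_real_derivative (?D y - ?D (y + 1)) / w y) (at t within A)"
    using w by (intro DERIV_cdivide DERIV_diff g yb)
  also have "(?D y - ?D (y + 1)) / w y =
     mu (y + 1) * (slope M (g t) (y + 1) - slope M (g t) y) + lam y * (slope M (g t) (y - 1) - slope M (g t) y)"
  proof -
    have l: "lamR M y = lam y" "muR M (y + 1) = mu (y + 1)" using yb by (auto simp: lamR_def muR_def)
    have s: "slope M (g t) y = (g t y - g t (y + 1)) / w y" using y by (simp add: slope_def)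
    \<comment> \<open>Detailed balance moves the weight from bond \<open>y\<close> to bond
      \<open>y + 1\<close>. At the edge of the window both sides vanish, through \<open>lamR\<close>
      on the left and \<open>slope\<close> on the right.\<close>
    have up: "lamR M (y + 1) * (g t (y + 1) - g t (y + 2)) / w y = mu (y + 1) * slope M (g t) (y + 1)"
    proof (cases "y + 2 \<in> trunc M")
      case True
      have I1: "y + 1 \<in> I" using yb trunc_subset by auto
      have y2: "y + 1 + 1 = y + 2" by simp
      have "y + 1 \<in> htrunc M" using yb True unfolding htrunc_def by (simp add: add.commute)
      hence "slope M (g t) (y + 1) = (g t (y + 1) - g t (y + 2)) / w (y + 1)" unfolding slope_def y2 by simp
      moreover have "lamR M (y + 1) = lam (y + 1)" using True unfolding lamR_def y2 by simp
      moreover have "lam (y + 1) / w y = mu (y + 1) / w (y + 1)"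
        using hpi_step[OF yb(3)] w hpi_pos[OF I1] by (simp add: field_simps)
      ultimately show ?thesis by (metis times_divide_eq_left mult.commute times_divide_eq_right)
    next
      case False
      thus ?thesis by (simp add: lamR_def slope_def htrunc_def add.commute)
    qed
    have down: "muR M y * (g t (y - 1) - g t y) / w y = lam y * slope M (g t) (y - 1)"
    proof (cases "y - 1 \<in> trunc M")
      case True
      hence I1: "y - 1 \<in> I" using trunc_subset by auto
      have "y - 1 \<in> htrunc M" using yb True by (simp add: htrunc_def)
      hence "slope M (g t) (y - 1) = (g t (y - 1) - g t y) / w (y - 1)" by (simp add: slope_def)
      moreover have "muR M y = mu y" using True by (simp add: muR_def)
      moreover have "mu y / w y = lam y / w (y - 1)"
        using hpi_step[OF I1] w hpi_pos[OF I1] by (simp add: field_simps)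
      ultimately show ?thesis by (metis times_divide_eq_left mult.commute times_divide_eq_right)
    next
      case False
      thus ?thesis by (simp add: muR_def slope_def htrunc_def)
    qed
    have "(?D y - ?D (y + 1)) / w y = lamR M (y + 1) * (g t (y + 1) - g t (y + 2)) / w y
       + muR M y * (g t (y - 1) - g t y) / w y - (lam y + mu (y + 1)) * ((g t y - g t (y + 1)) / w y)"
      unfolding l using w by (simp add: field_simps)
    thus ?thesis unfolding up down s[symmetric] by (simp add: algebra_simps)
  qed
  finally show ?thesis using y by (simp add: slope_def)
qed

text \<open>Uniqueness for a finite linear system: both sides solve the killed backward equation,
  and at time zero the differenced indicators give the identity. The comparison lemma is applied to
  the difference with both signs of \<open>c\<close>.\<close>

lemma dual_trunc:
  assumes y: "y \<in> htrunc M" and y': "y' \<in> htrunc M" and t: "0 \<le> t"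
  shows "hbd.tr M t y y' = w y' * slope M (\<lambda>x. FR M t x y') y"
proof -
  define V where "V t y = w y' * slope M (\<lambda>x. FR M t x y') y" for t y
  define D where "D c y t = c * (hbd.tr M t y y' - V t y)" for c y t
  have dV: "((\<lambda>t. V t y) has_real_derivative mu (y + 1) * (V s (y + 1) - V s y) + lam y * (V s (y - 1) - V s y)) (at s within {0..t})"
    if "y \<in> htrunc M" "s \<in> {0..t}" for y s
    unfolding V_def
    by (rule DERIV_cong[OF DERIV_cmult[OF slope_has_derivative[OF FR_has_derivative[OF _ that(2)] that(1)]]])
      (simp_all add: algebra_simps)
  have V0: "V s y = 0" if "y \<notin> htrunc M" for s y using that by (simp add: V_def slope_def)
  have "0 \<le> D c y t" for c
  proof (rule finite_system_nonneg[where J = "htrunc M" and T = t and j = y and u = "D c"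
        and u' = "\<lambda>y s. bd_jump (htrunc M) (\<lambda>x. mu (x + 1)) lam (\<lambda>z. D c z s) y - (mu (y + 1) + lam y) * D c y s"
        and r = "\<lambda>y. mu (y + 1) + lam y" and d = "\<lambda>y. mu (y + 1) + lam y"])
    fix y s assume y: "y \<in> htrunc M" and s: "s \<in> {0..t}"
    show "(D c y has_real_derivative bd_jump (htrunc M) (\<lambda>x. mu (x + 1)) lam (\<lambda>z. D c z s) y - (mu (y + 1) + lam y) * D c y s) (at s within {0..t})"
      unfolding D_def
      by (rule DERIV_cong[OF DERIV_cmult[OF DERIV_diff[OF hbd.trans_has_derivative[OF y s] dV[OF y s]]]])
         (auto simp: bd_jump_def V0 algebra_simps)
  next
    fix y assume y: "y \<in> htrunc M"
    hence "y \<in> trunc M" "y + 1 \<in> trunc M" "0 < w y" using hpi_pos htrunc_subset by (auto simp: htrunc_def)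
    hence "V 0 y = (if y = y' then 1 else 0)"
      using y by (auto simp: V_def slope_def FR_0)
    thus "0 \<le> D c y 0" by (simp add: D_def hbd.trans_0)
  next
    fix y assume "y \<in> htrunc M"
    thus "0 \<le> mu (y + 1) + lam y" using hbd.rates_nonneg by force
  next
    fix y s m assume y: "y \<in> htrunc M" and m: "m \<le> 0" and lb: "\<And>i. i \<in> htrunc M \<Longrightarrow> m \<le> D c i s"
    have rn: "0 \<le> mu (y + 1)" "0 \<le> lam y" using hbd.rates_nonneg[OF y] by auto
    have "mu (y + 1) * m \<le> (if y + 1 \<in> htrunc M then mu (y + 1) * D c (y + 1) s else 0)"
      using lb[of "y + 1"] m rn by (auto intro: mult_left_mono mult_nonneg_nonpos)
    moreover have "lam y * m \<le> (if y - 1 \<in> htrunc M then lam y * D c (y - 1) s else 0)"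
      using lb[of "y - 1"] m rn by (auto intro: mult_left_mono mult_nonneg_nonpos)
    ultimately show "(mu (y + 1) + lam y) * m - (mu (y + 1) + lam y) * D c y s
       \<le> bd_jump (htrunc M) (\<lambda>x. mu (x + 1)) lam (\<lambda>z. D c z s) y - (mu (y + 1) + lam y) * D c y s"
      unfolding bd_jump_def distrib_right by linarith
  qed (use y t in auto)
  from this[of 1] this[of "-1"] show ?thesis by (simp add: D_def V_def)
qed

lemma siegmund_duality:
  assumes y: "y \<in> I" and y': "y' \<in> I" and t: "0 \<le> t"
  shows "hp t y y' = w y' * ((F t y y' - F t (y + 1) y') / w y)"
proof -
  have I: "y + 1 \<in> I" "y' + 1 \<in> I" using up_closed[of y "y + 1"] up_closed[of y' "y' + 1"] assms by auto
  have "(\<lambda>M. w y' * ((FR M t y y' - FR M t (y + 1) y') / w y)) \<longlonglongrightarrow> w y' * ((F t y y' - F t (y + 1) y') / w y)"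
    using hpi_pos[OF y] by (intro tendsto_intros FR_tendsto assms I) auto
  moreover have "\<forall>\<^sub>F M in sequentially. w y' * ((FR M t y y' - FR M t (y + 1) y') / w y) = hbd.tr M t y y'"
    using eventually_in_trunc[OF y] eventually_in_trunc[OF y'] eventually_in_trunc[OF I(1)] eventually_in_trunc[OF I(2)]
  proof eventually_elim
    case (elim M)
    hence "y \<in> htrunc M" "y' \<in> htrunc M" by (auto simp: htrunc_def)
    thus ?case by (simp add: dual_trunc t slope_def)
  qed
  ultimately have "(\<lambda>M. hbd.tr M t y y') \<longlonglongrightarrow> w y' * ((F t y y' - F t (y + 1) y') / w y)"
    by (simp add: tendsto_cong)
  thus ?thesis using hbd_tendsto[OF y t] LIMSEQ_unique by blast
qed

end

subsection \<open>The Lyapunov function\<close>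

lemma prod_shift_neg:
  fixes g :: "int \<Rightarrow> real"
  shows "(\<Prod>i\<in>{1..-x}. g (x + i)) = (\<Prod>j\<in>{x+1..0}. g j)"
  by (rule prod.reindex_bij_witness[of _ "\<lambda>j. j - x" "\<lambda>i. x + i"]) auto

lemma hpi_nonneg_eq: "0 \<le> x \<Longrightarrow> hpi lam mu x = (\<Prod>i\<in>{1..x}. mu i / lam i)"
  and hpi_nonpos_eq: "x \<le> 0 \<Longrightarrow> hpi lam mu x = (\<Prod>j\<in>{x+1..0}. lam j / mu j)"
  using prod_shift_neg[where g = "\<lambda>j. lam j / mu j" and x = x] by (auto simp: hpi_def)

lemma pi_D_nonneg_eq: "0 \<le> x \<Longrightarrow> pi_D lam mu x = (\<Prod>i\<in>{1..x}. lam (i - 1) / mu i)"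
  and pi_D_nonpos_eq: "x \<le> 0 \<Longrightarrow> pi_D lam mu x = (\<Prod>j\<in>{x+1..0}. mu j / lam (j - 1))"
  using prod_shift_neg[where g = "\<lambda>j. mu j / lam (j - 1)" and x = x] by (auto simp: pi_D_def)

lemma atLeastAtMost_plus1: "l \<le> x + 1 \<Longrightarrow> {l..x + 1} = insert (x + 1) {l..x}" for x :: int
  by auto

lemma atLeastAtMost_minus1: "x \<le> u \<Longrightarrow> {x..u} = insert x {x + 1..u}" for x :: int
  by auto

lemma unbounded_partial_sums:
  fixes s :: "nat \<Rightarrow> real"
  assumes "\<And>k. 0 \<le> s k" "(\<Sum>k. ennreal (s k)) = \<infinity>"
  shows "\<exists>K. C \<le> (\<Sum>k<K. s k)"
proof (rule ccontr)
  assume "\<not> ?thesis"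
  hence "(\<Sum>k<K. s k) \<le> C" for K by (meson linear)
  hence "summable s" using assms(1) by (intro summableI_nonneg_bounded)
  hence "(\<Sum>k. ennreal (s k)) = ennreal (suminf s)" by (rule suminf_ennreal2[OF assms(1)])
  thus False using assms(2) by simp
qed

context
  fixes I :: "int set" and lam mu :: "int \<Rightarrow> real"
  assumes setting: "bd_setting I lam mu" and natural: "natural_boundaries I lam mu"
begin

lemma setting_cases: "(I = {0..} \<and> mu 0 = 0) \<or> I = UNIV"
  using setting by (auto simp: bd_setting_def)

lemma setting_up_closed: "x \<in> I \<Longrightarrow> x \<le> y \<Longrightarrow> y \<in> I"
  using setting_cases by auto

lemma setting_lam_pos: "x \<in> I \<Longrightarrow> 0 < lam x"
  using setting by (auto simp: bd_setting_def)

lemma setting_mu_pos: "x \<in> I \<Longrightarrow> x - 1 \<in> I \<Longrightarrow> 0 < mu x"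
  using setting by (auto simp: bd_setting_def)

lemma setting_nonneg: "0 \<le> x \<Longrightarrow> x \<in> I"
  using setting_cases by auto

lemma setting_hpi_pos:
  assumes "x \<in> I"
  shows "0 < hpi lam mu x"
proof (cases "0 \<le> x")
  case True
  thus ?thesis by (auto simp: hpi_nonneg_eq intro!: prod_pos divide_pos_pos setting_lam_pos setting_mu_pos setting_nonneg)
next
  case False
  hence "I = UNIV" using assms setting_cases by auto
  thus ?thesis using False by (auto simp: hpi_nonpos_eq intro!: prod_pos divide_pos_pos setting_lam_pos setting_mu_pos)
qed

lemma setting_hpi_step:
  assumes "x \<in> I"
  shows "hpi lam mu (x + 1) * lam (x + 1) = hpi lam mu x * mu (x + 1)"
proof -
  have I: "x + 1 \<in> I" using assms setting_up_closed by auto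
  have pos: "0 < lam (x + 1)" "0 < mu (x + 1)"
    using I assms setting_lam_pos setting_mu_pos[of "x + 1"] by auto
  show ?thesis
  proof (cases "0 \<le> x")
    case True
    thus ?thesis using pos by (simp add: hpi_nonneg_eq atLeastAtMost_plus1)
  next
    case False
    thus ?thesis using pos by (simp add: hpi_nonpos_eq atLeastAtMost_minus1[of "x + 1"])
  qed
qed

abbreviation "\<pi> \<equiv> pi_D lam mu"

lemma setting_pi_pos:
  assumes "x \<in> I"
  shows "0 < \<pi> x"
proof (cases "0 \<le> x")
  case True
  thus ?thesis by (auto simp: pi_D_nonneg_eq intro!: prod_pos divide_pos_pos setting_lam_pos setting_mu_pos setting_nonneg)
next
  case False
  hence "I = UNIV" using assms setting_cases by auto
  thus ?thesis using False by (auto simp: pi_D_nonpos_eq intro!: prod_pos divide_pos_pos setting_lam_pos setting_mu_pos)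
qed

lemma setting_pi_step:
  assumes "x \<in> I"
  shows "mu (x + 1) * \<pi> (x + 1) = lam x * \<pi> x"
proof -
  have I: "x + 1 \<in> I" using assms setting_up_closed by auto
  have pos: "0 < lam x" "0 < mu (x + 1)"
    using I assms setting_lam_pos setting_mu_pos[of "x + 1"] by auto
  show ?thesis
  proof (cases "0 \<le> x")
    case True
    thus ?thesis using pos by (simp add: pi_D_nonneg_eq atLeastAtMost_plus1)
  next
    case False
    thus ?thesis using pos by (simp add: pi_D_nonpos_eq atLeastAtMost_minus1[of "x + 1"])
  qed
qed

text \<open>The solutions of \<open>\<D> g = 1\<close> on the two half lines, started from zero; the natural-boundary
  conditions say that they are unbounded.\<close>

definition gplus :: "int \<Rightarrow> int \<Rightarrow> real" where
  "gplus l x = (\<Sum>j\<in>{l..x - 1}. 1 / (lam j * \<pi> j) * (\<Sum>i\<in>{l..j}. \<pi> i))"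

definition gminus :: "int \<Rightarrow> real" where
  "gminus x = (\<Sum>j\<in>{x..-1}. 1 / (lam j * \<pi> j) * (\<Sum>i\<in>{j + 1..-1}. \<pi> i))"

abbreviation gen :: "(int \<Rightarrow> real) \<Rightarrow> int \<Rightarrow> real" where
  "gen g x \<equiv> lam x * (g (x + 1) - g x) + mu x * (g (x - 1) - g x)"

lemma gplus_term_nonneg:
  assumes "l \<in> I" "l \<le> j"
  shows "0 \<le> 1 / (lam j * \<pi> j) * (\<Sum>i\<in>{l..j}. \<pi> i)"
  using assms setting_up_closed[of l]
  by (intro mult_nonneg_nonneg sum_nonneg divide_nonneg_nonneg less_imp_le[OF setting_lam_pos] less_imp_le[OF setting_pi_pos]) auto

lemma gminus_term_nonneg:
  assumes "j \<in> I"
  shows "0 \<le> 1 / (lam j * \<pi> j) * (\<Sum>i\<in>{j + 1..-1}. \<pi> i)"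
  using assms setting_up_closed[of j]
  by (intro mult_nonneg_nonneg sum_nonneg divide_nonneg_nonneg less_imp_le[OF setting_lam_pos] less_imp_le[OF setting_pi_pos]) auto

lemma gplus_mono: "l \<in> I \<Longrightarrow> x \<le> y \<Longrightarrow> gplus l x \<le> gplus l y"
  unfolding gplus_def by (intro sum_mono2 gplus_term_nonneg) auto

lemma gminus_mono: "x \<in> I \<Longrightarrow> x \<le> y \<Longrightarrow> gminus y \<le> gminus x"
  unfolding gminus_def using setting_up_closed[of x] by (intro sum_mono2 gminus_term_nonneg) auto

lemma gplus_nonneg: "l \<in> I \<Longrightarrow> 0 \<le> gplus l x"
  unfolding gplus_def by (intro sum_nonneg gplus_term_nonneg) auto

lemma gminus_nonneg: "x \<in> I \<Longrightarrow> 0 \<le> gminus x"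
  unfolding gminus_def using setting_up_closed[of x] by (intro sum_nonneg gminus_term_nonneg) auto

lemma gplus_Suc: "l \<le> x \<Longrightarrow> gplus l (x + 1) = gplus l x + 1 / (lam x * \<pi> x) * (\<Sum>i\<in>{l..x}. \<pi> i)"
  unfolding gplus_def using atLeastAtMost_plus1[of l "x - 1"] by simp

text \<open>With the flux \<open>lam x * \<pi> x * (g (x + 1) - g x)\<close>, the generator is the
  increment of the flux divided by \<open>\<pi> x\<close>. The flux of \<open>gplus l\<close> is the
  partial sum of \<open>\<pi>\<close> from \<open>l\<close>, whose increment is
  \<open>\<pi> x\<close>.\<close>

lemma gen_gplus:
  assumes "l \<in> I" "x \<in> I"
  shows "gen (gplus l) x = (if l \<le> x then 1 else 0)"
proof -
  consider "x < l" | "x = l" | "l < x" by linarith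
  thus ?thesis
  proof cases
    case 1
    hence "gplus l (x + 1) = 0" "gplus l x = 0" "gplus l (x - 1) = 0" by (auto simp: gplus_def)
    thus ?thesis using 1 by simp
  next
    case 2
    hence "gplus l x = 0" "gplus l (x - 1) = 0" by (auto simp: gplus_def)
    thus ?thesis using 2 gplus_Suc[of l x] setting_lam_pos[OF assms(2)] setting_pi_pos[OF assms(2)] by simp
  next
    case 3
    have I: "x - 1 \<in> I" using 3 assms setting_up_closed[of l "x - 1"] by simp
    have pos: "0 < lam x" "0 < \<pi> x" "0 < lam (x - 1)" "0 < \<pi> (x - 1)" "0 < mu x"
      using I assms setting_lam_pos setting_pi_pos setting_mu_pos by auto
    have "lam (x - 1) * \<pi> (x - 1) = mu x * \<pi> x" using setting_pi_step[OF I] by simp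
    hence "gplus l x = gplus l (x - 1) + 1 / (mu x * \<pi> x) * (\<Sum>i\<in>{l..x - 1}. \<pi> i)"
      using gplus_Suc[of l "x - 1"] 3 by simp
    moreover have "gplus l (x + 1) = gplus l x + 1 / (lam x * \<pi> x) * ((\<Sum>i\<in>{l..x - 1}. \<pi> i) + \<pi> x)"
      using gplus_Suc[of l x] 3 atLeastAtMost_plus1[of l "x - 1"] by simp
    ultimately have "gen (gplus l) x = lam x * (1 / (lam x * \<pi> x) * ((\<Sum>i\<in>{l..x - 1}. \<pi> i) + \<pi> x))
      - mu x * (1 / (mu x * \<pi> x) * (\<Sum>i\<in>{l..x - 1}. \<pi> i))" by simp
    also have "\<dots> = 1" using pos by (simp add: field_simps)
    finally show ?thesis using 3 by simp
  qed
qed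

lemma gen_gminus:
  assumes Z: "I = UNIV"
  shows "gen gminus x = (if x \<le> -1 then 1 else 0)"
proof (cases "x \<le> -1")
  case False
  \<comment> \<open>The term \<open>j = -1\<close> has an empty inner sum, so \<open>gminus\<close>
    vanishes already at \<open>-1\<close>; this settles \<open>x = 0\<close>.\<close>
  have z: "gminus z = 0" if "- 1 \<le> z" for z
    using that by (cases "z = - 1") (auto simp: gminus_def)
  have "gminus (x + 1) = 0" "gminus x = 0" "gminus (x - 1) = 0" using False by (auto intro!: z)
  thus ?thesis using False by simp
next
  case True
  have pos: "0 < lam x" "0 < \<pi> x" "0 < mu x"
    using Z setting_lam_pos setting_pi_pos setting_mu_pos by auto
  have "lam (x - 1) * \<pi> (x - 1) = mu x * \<pi> x" using setting_pi_step[of "x - 1"] Z by simp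
  hence "gminus (x - 1) = gminus x + 1 / (mu x * \<pi> x) * (\<Sum>i\<in>{x..-1}. \<pi> i)"
    unfolding gminus_def using atLeastAtMost_minus1[of "x - 1" "-1"] True by simp
  moreover have "gminus x = gminus (x + 1) + 1 / (lam x * \<pi> x) * (\<Sum>i\<in>{x + 1..-1}. \<pi> i)"
    unfolding gminus_def using atLeastAtMost_minus1[of x "-1"] True by simp
  moreover have "(\<Sum>i\<in>{x..-1}. \<pi> i) = \<pi> x + (\<Sum>i\<in>{x + 1..-1}. \<pi> i)"
    using atLeastAtMost_minus1[of x "-1"] True by simp
  ultimately have "gen gminus x = mu x * (1 / (mu x * \<pi> x) * (\<pi> x + (\<Sum>i\<in>{x + 1..-1}. \<pi> i)))
     - lam x * (1 / (lam x * \<pi> x) * (\<Sum>i\<in>{x + 1..-1}. \<pi> i))" by simp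
  also have "\<dots> = 1" using pos by (simp add: field_simps)
  finally show ?thesis using True by simp
qed

lemma gplus_unbounded:
  assumes "l \<in> I"
    and "(\<Sum>k. ennreal (1 / (lam (l + int k) * \<pi> (l + int k))) * ennreal (\<Sum>i\<in>{l..l + int k}. \<pi> i)) = \<infinity>"
  shows "\<exists>N. \<forall>x\<ge>N. C \<le> gplus l x"
proof -
  define s where "s k = 1 / (lam (l + int k) * \<pi> (l + int k)) * (\<Sum>i\<in>{l..l + int k}. \<pi> i)" for k
  have s0: "0 \<le> s k" for k unfolding s_def using gplus_term_nonneg[OF assms(1), of "l + int k"] by simp
  have "0 \<le> 1 / (lam (l + int k) * \<pi> (l + int k))" for k
    using setting_up_closed[OF assms(1), of "l + int k"]
    by (intro divide_nonneg_nonneg mult_nonneg_nonneg less_imp_le[OF setting_lam_pos] less_imp_le[OF setting_pi_pos]) auto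
  hence "(\<Sum>k. ennreal (s k)) = \<infinity>" using assms(2) by (simp only: s_def ennreal_mult')
  then obtain K where K: "C \<le> (\<Sum>k<K. s k)" using unbounded_partial_sums[of s C] s0 by blast
  have "(\<Sum>k<K. s k) = gplus l (l + int K)"
  proof (induction K)
    case (Suc K)
    have eq: "l + int (Suc K) = l + int K + 1" by simp
    show ?case unfolding eq using Suc gplus_Suc[of l "l + int K"] by (simp add: s_def)
  qed (simp add: gplus_def)
  hence "C \<le> gplus l x" if "x \<ge> l + int K" for x
    using K gplus_mono[OF assms(1) that] by linarith
  thus ?thesis by blast
qed

lemma gminus_unbounded:
  assumes Z: "I = UNIV"
  shows "\<exists>N. \<forall>x\<le>N. C \<le> gminus x"
proof -
  define s where "s k = 1 / (lam (- int k - 1) * \<pi> (- int k - 1)) * (\<Sum>i\<in>{- int k - 1 + 1..-1}. \<pi> i)" for k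
  have s0: "0 \<le> s k" for k unfolding s_def using gminus_term_nonneg[of "- int k - 1"] Z by simp
  have "0 \<le> 1 / (lam (- int k - 1) * \<pi> (- int k - 1))" for k
    using Z by (intro divide_nonneg_nonneg mult_nonneg_nonneg less_imp_le[OF setting_lam_pos] less_imp_le[OF setting_pi_pos]) auto
  moreover have "(\<Sum>k. ennreal (1 / (lam (- int k - 1) * \<pi> (- int k - 1))) * ennreal (\<Sum>i\<in>{- int k - 1 + 1..-1}. \<pi> i)) = \<infinity>"
    using natural Z unfolding natural_boundaries_def Let_def by blast
  ultimately have "(\<Sum>k. ennreal (s k)) = \<infinity>" by (simp only: s_def ennreal_mult')
  then obtain K where K: "C \<le> (\<Sum>k<K. s k)" using unbounded_partial_sums[of s C] s0 by blast
  have "(\<Sum>k<K. s k) = gminus (- int K)"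
  proof (induction K)
    case (Suc K)
    have "gminus (- int K - 1) = s K + gminus (- int K)"
      unfolding gminus_def s_def using atLeastAtMost_minus1[of "- int K - 1" "-1"] by simp
    moreover have eq: "- int (Suc K) = - int K - 1" by simp
    ultimately show ?case unfolding eq using Suc by simp
  qed (simp add: gminus_def)
  hence "C \<le> gminus x" if "x \<le> - int K" for x
    using K gminus_mono[of x "- int K"] that Z by force
  thus ?thesis by blast
qed

text \<open>The generator of the sum of the half-line solutions is at most 1, and adding the
  constant 1 to that sum makes 1 a lower bound of \<open>f\<close>; hence the generator of
  \<open>f\<close> is at most \<open>f\<close>.\<close>

lemma lyapunov_exists: "\<exists>f. bd_lyapunov I lam mu f"
proof -
  have mu_zero: "mu x = 0" if "x \<in> I" "x - 1 \<notin> I" for x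
  proof -
    from that setting_cases have "x = 0" "mu 0 = 0" by auto
    thus ?thesis by simp
  qed
  consider (N) "I = {0..}" | (Z) "I = UNIV" using setting_cases by auto
  thus ?thesis
  proof cases
    case N
    have 0: "0 \<in> I" using N by simp
    have "(\<Sum>k. ennreal (1 / (lam (0 + int k) * \<pi> (0 + int k))) * ennreal (\<Sum>i\<in>{0..0 + int k}. \<pi> i)) = \<infinity>"
      using natural N unfolding natural_boundaries_def Let_def by simp
    note unb = gplus_unbounded[OF 0 this]
    have "bd_lyapunov I lam mu (\<lambda>x. 1 + gplus 0 x)"
    proof
      fix x assume "x \<in> I"
      thus "lam x * (1 + gplus 0 (x + 1) - (1 + gplus 0 x)) + mu x * (1 + gplus 0 (x - 1) - (1 + gplus 0 x)) \<le> 1 + gplus 0 x"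
        using gen_gplus[OF 0, of x] gplus_nonneg[OF 0, of x] by simp
      show "0 \<le> 1 + gplus 0 x" using gplus_nonneg[OF 0, of x] by simp
    next
      fix C
      from unb[of C] obtain K where K: "\<And>x. x \<ge> K \<Longrightarrow> C \<le> gplus 0 x" by blast
      have "C \<le> 1 + gplus 0 x" if "x \<in> I" "K \<le> \<bar>x\<bar>" for x using K[of x] that N by simp
      thus "\<exists>K. \<forall>x\<in>I. K \<le> \<bar>x\<bar> \<longrightarrow> C \<le> 1 + gplus 0 x" by blast
    qed (use setting_up_closed setting_lam_pos setting_mu_pos mu_zero setting_hpi_pos setting_hpi_step in auto)
    thus ?thesis by blast
  next
    case Z
    have 1: "1 \<in> I" using Z by simp
    have "(\<Sum>k. ennreal (1 / (lam (1 + int k) * \<pi> (1 + int k))) * ennreal (\<Sum>i\<in>{1..1 + int k}. \<pi> i)) = \<infinity>"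
      using natural Z unfolding natural_boundaries_def Let_def by (simp add: add.commute)
    note unb = gplus_unbounded[OF 1 this]
    \<comment> \<open>The two solutions start at \<open>1\<close> and \<open>-1\<close>, so their
      generators are supported on disjoint half lines and never add up to more than 1.\<close>
    have "bd_lyapunov I lam mu (\<lambda>x. 1 + gplus 1 x + gminus x)"
    proof
      fix x assume x: "x \<in> I"
      have "lam x * (1 + gplus 1 (x + 1) + gminus (x + 1) - (1 + gplus 1 x + gminus x))
        + mu x * (1 + gplus 1 (x - 1) + gminus (x - 1) - (1 + gplus 1 x + gminus x)) = gen (gplus 1) x + gen gminus x"
        by (simp add: algebra_simps)
      also have "\<dots> \<le> 1" unfolding gen_gplus[OF 1 x] gen_gminus[OF Z] by simp
      finally show "lam x * (1 + gplus 1 (x + 1) + gminus (x + 1) - (1 + gplus 1 x + gminus x))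
        + mu x * (1 + gplus 1 (x - 1) + gminus (x - 1) - (1 + gplus 1 x + gminus x)) \<le> 1 + gplus 1 x + gminus x"
        using gplus_nonneg[OF 1, of x] gminus_nonneg[OF x] by linarith
      show "0 \<le> 1 + gplus 1 x + gminus x" using gplus_nonneg[OF 1, of x] gminus_nonneg[OF x] by simp
    next
      fix C
      from unb[of C] obtain K where K: "\<And>x. x \<ge> K \<Longrightarrow> C \<le> gplus 1 x" by blast
      from gminus_unbounded[OF Z, of C] obtain L where L: "\<And>x. x \<le> L \<Longrightarrow> C \<le> gminus x" by blast
      have "C \<le> 1 + gplus 1 x + gminus x" if "x \<in> I" "max \<bar>K\<bar> \<bar>L\<bar> \<le> \<bar>x\<bar>" for x
      proof (cases "0 \<le> x")
        case True
        hence "K \<le> x" using that(2) by auto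
        from K[OF this] show ?thesis using gminus_nonneg[OF that(1)] by linarith
      next
        case False
        hence "x \<le> L" using that(2) by auto
        from L[OF this] show ?thesis using gplus_nonneg[OF 1, of x] by linarith
      qed
      thus "\<exists>K. \<forall>x\<in>I. K \<le> \<bar>x\<bar> \<longrightarrow> C \<le> 1 + gplus 1 x + gminus x" by blast
    qed (use setting_up_closed setting_lam_pos setting_mu_pos mu_zero setting_hpi_pos setting_hpi_step in auto)
    thus ?thesis by blast
  qed
qed

end

subsection \<open>Nonnegativity of the two-level kernel\<close>

text \<open>Interlacing alone forces both levels to be strictly increasing, and convexity of
  \<open>S\<close> places \<open>y\<close> in \<open>S\<close>. Only these conditions have to be
  rechecked after a jump.\<close>

lemma WI_iff:
  assumes convex: "\<And>x y z. x \<in> S \<Longrightarrow> y \<in> S \<Longrightarrow> x \<le> z \<Longrightarrow> z \<le> y \<Longrightarrow> z \<in> S"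
  shows "(x, y) \<in> WI S n \<longleftrightarrow> length x = n + 1 \<and> length y = n \<and> (\<forall>i\<le>n. x ! i \<in> S) \<and>
     (\<forall>i<n. x ! i \<le> y ! i \<and> y ! i < x ! (i + 1))"
proof (intro iffI conjI; (elim conjE)?)
  assume "(x, y) \<in> WI S n"
  thus "length x = n + 1" "length y = n" "\<forall>i\<le>n. x ! i \<in> S" "\<forall>i<n. x ! i \<le> y ! i \<and> y ! i < x ! (i + 1)"
    by (auto simp: WI_def Wch_def Wint_def)
next
  assume len: "length x = n + 1" "length y = n" and xS: "\<forall>i\<le>n. x ! i \<in> S"
    and il: "\<forall>i<n. x ! i \<le> y ! i \<and> y ! i < x ! (i + 1)"
  have "sorted_wrt (<) x"
    unfolding sorted_wrt_iff_nth_Suc_transp[OF transp_on_less]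
  proof (intro allI impI)
    fix i assume "Suc i < length x"
    with il len show "x ! i < x ! Suc i" by fastforce
  qed
  moreover have "sorted_wrt (<) y"
    unfolding sorted_wrt_iff_nth_Suc_transp[OF transp_on_less]
  proof (intro allI impI)
    fix i assume "Suc i < length y"
    hence "y ! i < x ! (i + 1)" "x ! (i + 1) \<le> y ! (i + 1)" using il len by simp_all
    thus "y ! i < y ! Suc i" by simp
  qed
  moreover have "set x \<subseteq> S" using xS len by (auto simp: in_set_conv_nth)
  moreover have "set y \<subseteq> S"
  proof
    fix z assume "z \<in> set y"
    then obtain i where i: "i < n" "z = y ! i" using len by (auto simp: in_set_conv_nth)
    thus "z \<in> S" using convex[of "x ! i" "x ! (i + 1)" z] xS il by auto
  qed
  ultimately show "(x, y) \<in> WI S n" using len il by (auto simp: WI_def Wch_def Wint_def)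
qed

lemma WI_order:
  assumes "(x, y) \<in> WI S n"
  shows "i < j \<Longrightarrow> j \<le> n \<Longrightarrow> x ! i < x ! j" "i < j \<Longrightarrow> j < n \<Longrightarrow> y ! i < y ! j"
    "i \<le> j \<Longrightarrow> j < n \<Longrightarrow> x ! i \<le> y ! j" "j < i \<Longrightarrow> i \<le> n \<Longrightarrow> y ! j < x ! i"
proof -
  from assms have len: "length x = n + 1" "length y = n"
    and s: "sorted_wrt (<) x" "sorted_wrt (<) y" and il: "\<And>i. i < n \<Longrightarrow> x ! i \<le> y ! i \<and> y ! i < x ! (i + 1)"
    by (auto simp: WI_def Wch_def Wint_def)
  show x: "i < j \<Longrightarrow> j \<le> n \<Longrightarrow> x ! i < x ! j" for i j
    using s(1) len by (auto simp: sorted_wrt_iff_nth_less)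
  show "i < j \<Longrightarrow> j < n \<Longrightarrow> y ! i < y ! j"
    using s(2) len by (auto simp: sorted_wrt_iff_nth_less)
  show "i \<le> j \<Longrightarrow> j < n \<Longrightarrow> x ! i \<le> y ! j"
    using x[of i j] il[of j] by (cases "i = j") auto
  show "j < i \<Longrightarrow> i \<le> n \<Longrightarrow> y ! j < x ! i"
    using x[of "j + 1" i] il[of j] by (cases "i = j + 1") auto
qed

lemma finite_WI:
  assumes "finite S"
  shows "finite (WI S n)"
proof (rule finite_subset)
  show "WI S n \<subseteq> {xs. set xs \<subseteq> S \<and> length xs = n + 1} \<times> {ys. set ys \<subseteq> S \<and> length ys = n}"
    by (auto simp: WI_def Wch_def Wint_def)
  show "finite ({xs. set xs \<subseteq> S \<and> length xs = n + 1} \<times> {ys. set ys \<subseteq> S \<and> length ys = n})"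
    using assms by (intro finite_cartesian_product finite_lists_length_eq)
qed

section \<open>The determinant in a window, its backward equation, and jumps that break the
  interlacing\<close>

context bd_lyapunov
begin

lemma WI_trunc_iff: "(x, y) \<in> WI (trunc M) n \<longleftrightarrow> length x = n + 1 \<and> length y = n \<and> (\<forall>i\<le>n. x ! i \<in> trunc M) \<and>
     (\<forall>i<n. x ! i \<le> y ! i \<and> y ! i < x ! (i + 1))"
  by (rule WI_iff) (rule trunc_convex)

lemma WI_I_iff: "(x, y) \<in> WI I n \<longleftrightarrow> length x = n + 1 \<and> length y = n \<and> (\<forall>i\<le>n. x ! i \<in> I) \<and>
     (\<forall>i<n. x ! i \<le> y ! i \<and> y ! i < x ! (i + 1))"
  by (rule WI_iff) (rule up_closed)

text \<open>The row attached to a site \<open>z\<close>. Upper rows are its values up to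
  \<open>qcorr\<close>, and lower rows are its slopes, also in the lower right block because of
  duality.\<close>

definition Rrow :: "nat \<Rightarrow> nat \<Rightarrow> int list \<Rightarrow> int list \<Rightarrow> real \<Rightarrow> int \<Rightarrow> nat \<Rightarrow> real" where
  "Rrow M n x' y' t z j = (if j \<le> n then pR M t z (x' ! j)
     else w (y' ! (j - (n + 1))) * FR M t z (y' ! (j - (n + 1))))"

definition qcorr :: "nat \<Rightarrow> int list \<Rightarrow> nat \<Rightarrow> nat \<Rightarrow> real" where
  "qcorr n y' i j = (if \<not> j \<le> n \<and> i \<le> j - (n + 1) then w (y' ! (j - (n + 1))) else 0)"

definition qrow :: "nat \<Rightarrow> nat \<Rightarrow> int list \<Rightarrow> int list \<Rightarrow> real \<Rightarrow> int list \<Rightarrow> int list \<Rightarrow> nat \<Rightarrow> nat \<Rightarrow> real" where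
  "qrow M n x' y' t x y i = (if i \<le> n then (\<lambda>j. Rrow M n x' y' t (x ! i) j - qcorr n y' i j)
     else (\<lambda>j. slope M (\<lambda>z. Rrow M n x' y' t z j) (y ! (i - (n + 1)))))"

definition qR :: "nat \<Rightarrow> nat \<Rightarrow> int list \<Rightarrow> int list \<Rightarrow> real \<Rightarrow> int list \<Rightarrow> int list \<Rightarrow> real" where
  "qR M n x' y' t x y = ldet (2 * n + 1) (qrow M n x' y' t x y)"

lemma Rrow_has_derivative:
  assumes "z \<in> trunc M" "t \<in> {0..T}"
  shows "((\<lambda>t. Rrow M n x' y' t z j) has_real_derivative
     lamR M z * (Rrow M n x' y' t (z + 1) j - Rrow M n x' y' t z j)
     + muR M z * (Rrow M n x' y' t (z - 1) j - Rrow M n x' y' t z j)) (at t within {0..T})"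
proof (cases "j \<le> n")
  case True
  thus ?thesis using pR_has_derivative[OF assms] by (simp add: Rrow_def)
next
  case False
  thus ?thesis
    unfolding Rrow_def
    by (simp, intro DERIV_cong[OF DERIV_cmult[OF FR_has_derivative[OF assms]]]) (simp add: algebra_simps)
qed

lemma qrow_update_x:
  assumes "i \<le> n" "length x = n + 1"
  shows "qrow M n x' y' t (x[i := z]) y = (qrow M n x' y' t x y)(i := \<lambda>j. Rrow M n x' y' t z j - qcorr n y' i j)"
  using assms by (auto simp: qrow_def fun_eq_iff)

lemma qrow_update_y:
  assumes "i < n" "length y = n"
  shows "qrow M n x' y' t x (y[i := z]) = (qrow M n x' y' t x y)(n + 1 + i := \<lambda>j. slope M (\<lambda>z. Rrow M n x' y' t z j) z)"
  using assms by (auto simp: qrow_def fun_eq_iff nth_list_update)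

lemma trunc_between_htrunc: "x \<in> trunc M \<Longrightarrow> z \<in> trunc M \<Longrightarrow> x \<le> y \<Longrightarrow> y < z \<Longrightarrow> y \<in> htrunc M"
  using trunc_convex[of x M z y] trunc_convex[of x M z "y + 1"] by (auto simp: htrunc_def)

text \<open>The generator of independent particles. The interaction is hidden in the values of the
  determinant at pairs that have just stopped interlacing.\<close>

definition qR_gen :: "nat \<Rightarrow> nat \<Rightarrow> int list \<Rightarrow> int list \<Rightarrow> real \<Rightarrow> int list \<Rightarrow> int list \<Rightarrow> real" where
  "qR_gen M n x' y' t x y = (let Q = qR M n x' y' t in
     (\<Sum>i<n + 1. lamR M (x ! i) * (Q (x[i := x ! i + 1]) y - Q x y) + muR M (x ! i) * (Q (x[i := x ! i - 1]) y - Q x y))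
   + (\<Sum>i<n. mu (y ! i + 1) * (Q x (y[i := y ! i + 1]) - Q x y) + lam (y ! i) * (Q x (y[i := y ! i - 1]) - Q x y)))"

text \<open>Each row depends on a single particle and satisfies that particle's backward equation;
  \<open>qcorr\<close> depends on the row index but not on the site, so it cancels in
  differences.\<close>

lemma qR_has_derivative:
  assumes xy: "(x, y) \<in> WI (trunc M) n" and t: "t \<in> {0..T}"
  shows "((\<lambda>t. qR M n x' y' t x y) has_real_derivative qR_gen M n x' y' t x y) (at t within {0..T})"
proof -
  from xy have len: "length x = n + 1" "length y = n" and xS: "\<And>i. i \<le> n \<Longrightarrow> x ! i \<in> trunc M"
    and il: "\<And>i. i < n \<Longrightarrow> x ! i \<le> y ! i \<and> y ! i < x ! (i + 1)"
    by (auto simp: WI_trunc_iff)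
  have yS: "y ! i \<in> htrunc M" if "i < n" for i
    using il[OF that] xS[of i] xS[of "i + 1"] that by (intro trunc_between_htrunc[of "x ! i" _ "x ! (i + 1)"]) auto
  let ?R = "Rrow M n x' y'"
  let ?m = "2 * n + 1"
  define row' where "row' i j = (if i \<le> n then
      lamR M (x ! i) * (?R t (x ! i + 1) j - ?R t (x ! i) j) + muR M (x ! i) * (?R t (x ! i - 1) j - ?R t (x ! i) j)
    else let z = y ! (i - (n + 1)) in
      mu (z + 1) * (slope M (\<lambda>z. ?R t z j) (z + 1) - slope M (\<lambda>z. ?R t z j) z)
      + lam z * (slope M (\<lambda>z. ?R t z j) (z - 1) - slope M (\<lambda>z. ?R t z j) z))" for i j
  have "((\<lambda>t. qR M n x' y' t x y) has_real_derivative
      (\<Sum>k<?m. ldet ?m ((qrow M n x' y' t x y)(k := row' k)))) (at t within {0..T})"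
    unfolding qR_def
  proof (rule has_real_derivative_ldet)
    fix i j assume "i < ?m" "j < ?m"
    show "((\<lambda>t. qrow M n x' y' t x y i j) has_real_derivative row' i j) (at t within {0..T})"
    proof (cases "i \<le> n")
      case True
      have "((\<lambda>t. ?R t (x ! i) j - qcorr n y' i j) has_real_derivative row' i j) (at t within {0..T})"
        using DERIV_diff[OF Rrow_has_derivative[OF xS[OF True] t] DERIV_const] True by (simp add: row'_def)
      thus ?thesis using True by (simp add: qrow_def)
    next
      case False
      have "y ! (i - (n + 1)) \<in> htrunc M" using False \<open>i < ?m\<close> by (intro yS) auto
      from slope_has_derivative[where g = "\<lambda>t z. ?R t z j", OF Rrow_has_derivative[OF _ t] this]
      show ?thesis using False by (simp add: qrow_def row'_def Let_def)
    qed
  qed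
  also have "(\<Sum>k<?m. ldet ?m ((qrow M n x' y' t x y)(k := row' k))) = 
    (\<Sum>k<n + 1. ldet ?m ((qrow M n x' y' t x y)(k := row' k))) + (\<Sum>i<n. ldet ?m ((qrow M n x' y' t x y)(n + 1 + i := row' (n + 1 + i))))"
  proof -
    have "(\<Sum>k<a + b. h k) = (\<Sum>k<a. h k) + (\<Sum>i<b. h (a + i))" for a b and h :: "nat \<Rightarrow> real"
      by (induction b) (auto simp: add.assoc)
    from this[of "\<lambda>k. ldet ?m ((qrow M n x' y' t x y)(k := row' k))" "n + 1" n]
    have "(\<Sum>k<(n + 1) + n. ldet ?m ((qrow M n x' y' t x y)(k := row' k))) =
      (\<Sum>k<n + 1. ldet ?m ((qrow M n x' y' t x y)(k := row' k))) + (\<Sum>i<n. ldet ?m ((qrow M n x' y' t x y)(n + 1 + i := row' (n + 1 + i))))" .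
    moreover have "(n + 1) + n = ?m" by simp
    ultimately show ?thesis by (simp only:)
  qed
  also have "(\<Sum>k<n + 1. ldet ?m ((qrow M n x' y' t x y)(k := row' k))) =
    (\<Sum>i<n + 1. lamR M (x ! i) * (qR M n x' y' t (x[i := x ! i + 1]) y - qR M n x' y' t x y)
     + muR M (x ! i) * (qR M n x' y' t (x[i := x ! i - 1]) y - qR M n x' y' t x y))"
  proof (intro sum.cong refl)
    fix i assume "i \<in> {..<n + 1}"
    hence i: "i \<le> n" by simp
    show "ldet ?m ((qrow M n x' y' t x y)(i := row' i)) =
      lamR M (x ! i) * (qR M n x' y' t (x[i := x ! i + 1]) y - qR M n x' y' t x y)
     + muR M (x ! i) * (qR M n x' y' t (x[i := x ! i - 1]) y - qR M n x' y' t x y)"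
      unfolding qR_def qrow_update_x[OF i len(1)]
      by (rule ldet_row_move) (use i in \<open>auto simp: row'_def qrow_def\<close>)
  qed
  also have "(\<Sum>i<n. ldet ?m ((qrow M n x' y' t x y)(n + 1 + i := row' (n + 1 + i)))) =
    (\<Sum>i<n. mu (y ! i + 1) * (qR M n x' y' t x (y[i := y ! i + 1]) - qR M n x' y' t x y)
     + lam (y ! i) * (qR M n x' y' t x (y[i := y ! i - 1]) - qR M n x' y' t x y))"
  proof (intro sum.cong refl)
    fix i assume "i \<in> {..<n}"
    hence i: "i < n" by simp
    show "ldet ?m ((qrow M n x' y' t x y)(n + 1 + i := row' (n + 1 + i))) =
      mu (y ! i + 1) * (qR M n x' y' t x (y[i := y ! i + 1]) - qR M n x' y' t x y)
     + lam (y ! i) * (qR M n x' y' t x (y[i := y ! i - 1]) - qR M n x' y' t x y)"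
      unfolding qR_def qrow_update_y[OF i len(2)]
      by (rule ldet_row_move) (use i in \<open>auto simp: row'_def qrow_def Let_def\<close>)
  qed
  finally show ?thesis unfolding qR_gen_def Let_def .
qed

text \<open>At a contact between the two patterns the two determinants differ by a multiple of the row
  indexed by the contact site.\<close>

lemma qR_contact:
  assumes len: "length x = n + 1" "length y = n" and "k \<le> n" "i < n" "y ! i = v" "v \<in> htrunc M"
  shows "qR M n x' y' t (x[k := v + 1]) y = qR M n x' y' t (x[k := v]) y"
proof -
  have w: "w v \<noteq> 0" using hpi_pos[of v] assms(6) htrunc_subset by force
  have "qrow M n x' y' t (x[k := v + 1]) y = (qrow M n x' y' t (x[k := v]) y)(k := \<lambda>j. Rrow M n x' y' t (v + 1) j - qcorr n y' k j)"
    using assms by (simp add: qrow_update_x)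
  moreover have "ldet (2 * n + 1) \<dots> = ldet (2 * n + 1) (qrow M n x' y' t (x[k := v]) y)"
    by (rule ldet_add_row_multiple[where l = "n + 1 + i" and c = "- w v"])
       (use assms w in \<open>auto simp: qrow_def slope_def\<close>)
  ultimately show ?thesis unfolding qR_def by simp
qed

text \<open>A lower particle leaving the window is killed: \<open>slope\<close> vanishes outside
  \<open>htrunc M\<close>.\<close>

lemma qR_zero_row:
  assumes "length y = n" "i < n" "z \<notin> htrunc M"
  shows "qR M n x' y' t x (y[i := z]) = 0"
  unfolding qR_def qrow_update_y[OF assms(2,1)]
  by (rule ldet_rows_proportional[of "n + 1 + i" _ 0 _ 0]) (use assms in \<open>auto simp: slope_def\<close>)

text \<open>Two lower particles that meet have equal rows, so their collision is killing as
  well.\<close>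

lemma qR_equal_rows:
  assumes "length y = n" "i < n" "k < n" "i \<noteq> k" "y ! k = z"
  shows "qR M n x' y' t x (y[i := z]) = 0"
  unfolding qR_def qrow_update_y[OF assms(2,1)]
  by (rule ldet_rows_proportional[of "n + 1 + i" _ "n + 1 + k" _ 1]) (use assms in \<open>auto simp: qrow_def\<close>)

text \<open>An upper jump can violate only one inequality, and then the moving particle was in
  contact with a lower one. The contact identity returns the value before the jump: the jump is
  blocked.\<close>

lemma qR_move_x:
  assumes xy: "(x, y) \<in> WI (trunc M) n" and i: "i \<le> n"
    and z: "z = x ! i + 1 \<or> z = x ! i - 1" "z \<in> trunc M"
  shows "\<exists>(x2, y2)\<in>WI (trunc M) n. qR M n x' y' t (x[i := z]) y = qR M n x' y' t x2 y2"
proof -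
  from xy have len: "length x = n + 1" "length y = n" and xS: "\<And>i. i \<le> n \<Longrightarrow> x ! i \<in> trunc M"
    and il: "\<And>i. i < n \<Longrightarrow> x ! i \<le> y ! i \<and> y ! i < x ! (i + 1)"
    by (auto simp: WI_trunc_iff)
  have nx: "x[i := z] ! k = (if k = i then z else x ! k)" for k
    using i len by (auto simp: nth_list_update)
  show ?thesis
  proof (cases "(x[i := z], y) \<in> WI (trunc M) n")
    case False
    then obtain k where k: "k < n" "\<not> (x[i := z] ! k \<le> y ! k \<and> y ! k < x[i := z] ! (k + 1))"
    proof -
      have "(if k = i then z else x ! k) \<in> trunc M" if "k \<le> n" for k using xS[OF that] z(2) by simp
      thus ?thesis using False len that unfolding WI_trunc_iff nx by auto
    qed
    have "(k = i \<and> y ! i = x ! i \<and> z = x ! i + 1) \<or> (k + 1 = i \<and> y ! k = z \<and> z = x ! i - 1)"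
    proof (cases "k = i")
      case True
      thus ?thesis using k(2) il[OF k(1)] z(1) by (auto simp: nx)
    next
      case False
      hence *: "\<not> (x ! k \<le> y ! k \<and> y ! k < (if k + 1 = i then z else x ! (k + 1)))" using k(2) unfolding nx by simp
      hence "k + 1 = i" using il[OF k(1)] by (auto split: if_splits)
      thus ?thesis using * il[OF k(1)] z(1) by auto
    qed
    hence "qR M n x' y' t (x[i := z]) y = qR M n x' y' t x y"
    proof (elim disjE conjE, goal_cases)
      case 1
      have "y ! i \<in> trunc M" using xS[OF i] 1(2) by metis
      moreover have "y ! i + 1 \<in> trunc M" using z(2) 1(2,3) by metis
      ultimately have h: "y ! i \<in> htrunc M" unfolding htrunc_def by blast
      have "i < n" using k(1) 1(1) by simp
      hence "qR M n x' y' t (x[i := y ! i + 1]) y = qR M n x' y' t (x[i := y ! i]) y"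
        by (rule qR_contact[OF len i _ HOL.refl h])
      moreover have "x[i := y ! i] = x" using 1(2) by (metis list_update_id)
      moreover have "z = y ! i + 1" using 1(2,3) by linarith
      ultimately show ?case by (simp only:)
    next
      case 2
      have yk: "y ! k + 1 = x ! i" using 2 by linarith
      have "y ! k \<in> trunc M" using z(2) 2(2) by metis
      moreover have "y ! k + 1 \<in> trunc M" unfolding yk by (rule xS[OF i])
      ultimately have "y ! k \<in> htrunc M" unfolding htrunc_def by blast
      from qR_contact[OF len i k(1) refl this]
      have "qR M n x' y' t (x[i := y ! k + 1]) y = qR M n x' y' t (x[i := y ! k]) y" .
      moreover have "z + 1 = x ! i" using 2 by linarith
      ultimately show ?case unfolding 2(2) by (simp only: list_update_id)
    qed
    thus ?thesis by (intro bexI[OF _ xy]) simp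
  next
    case True
    thus ?thesis by (rule bexI[rotated]) simp
  qed
qed

text \<open>A lower jump is killed at the window's edge or by a collision. Otherwise it keeps the
  interlacing or runs into an upper particle, which the contact identity pushes one site in the same
  direction.\<close>

lemma qR_move_y:
  assumes xy: "(x, y) \<in> WI (trunc M) n" and i: "i < n"
    and z: "z = y ! i + 1 \<or> z = y ! i - 1"
  shows "qR M n x' y' t x (y[i := z]) = 0 \<or>
    (\<exists>(x2, y2)\<in>WI (trunc M) n. qR M n x' y' t x (y[i := z]) = qR M n x' y' t x2 y2)"
proof -
  from xy have len: "length x = n + 1" "length y = n" and xS: "\<And>i. i \<le> n \<Longrightarrow> x ! i \<in> trunc M"
    and il: "\<And>i. i < n \<Longrightarrow> x ! i \<le> y ! i \<and> y ! i < x ! (i + 1)"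
    by (auto simp: WI_trunc_iff)
  have ny: "y[i := z] ! k = (if k = i then z else y ! k)" for k
    using i len by (auto simp: nth_list_update)
  have nx: "x[k := v] ! l = (if l = k then v else x ! l)" if "k \<le> n" for k l v
    using that len by (auto simp: nth_list_update)
  show ?thesis
  \<comment> \<open>Killing is separated first, so that in the pushing case there is room:
    \<open>z + 1\<close> lies in the window, and no other lower particle occupies
    \<open>z\<close>.\<close>
  proof (cases "z \<notin> htrunc M \<or> (\<exists>k<n. k \<noteq> i \<and> y ! k = z) \<or> (x, y[i := z]) \<in> WI (trunc M) n")
    case True
    thus ?thesis
    proof (elim disjE)
      assume "z \<notin> htrunc M"
      from qR_zero_row[OF len(2) i this] show ?thesis by (rule disjI1)
    next
      assume "\<exists>k<n. k \<noteq> i \<and> y ! k = z"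
      then obtain k where "k < n" "i \<noteq> k" "y ! k = z" by metis
      from qR_equal_rows[OF len(2) i this] show ?thesis by (rule disjI1)
    next
      assume W: "(x, y[i := z]) \<in> WI (trunc M) n"
      show ?thesis by (intro disjI2 bexI[OF _ W]) simp
    qed
  next
    case False
    hence zh: "z \<in> htrunc M" and ne: "\<And>k. k < n \<Longrightarrow> k \<noteq> i \<Longrightarrow> y ! k \<noteq> z" 
      and nW: "(x, y[i := z]) \<notin> WI (trunc M) n" by auto
    have zS: "z \<in> trunc M" "z + 1 \<in> trunc M" using zh by (auto simp: htrunc_def)
    have "\<not> (x ! i \<le> z \<and> z < x ! (i + 1))"
    proof
      assume a: "x ! i \<le> z \<and> z < x ! (i + 1)"
      have "(if k = i then z else y ! k) < x ! (k + 1)" "x ! k \<le> (if k = i then z else y ! k)" if "k < n" for k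
        using a il[OF that] by (cases "k = i"; simp)+
      hence "(x, y[i := z]) \<in> WI (trunc M) n" unfolding WI_trunc_iff ny using len xS by simp
      thus False using nW by simp
    qed
    hence "(z = y ! i + 1 \<and> x ! (i + 1) = z) \<or> (z = y ! i - 1 \<and> x ! i = z + 1)"
      using il[OF i] z by (elim disjE) linarith+
    thus ?thesis
    proof (elim disjE conjE, goal_cases)
      case 1
      \<comment> \<open>Contact of the moved lower particle with \<open>x ! (i + 1) = z\<close>;
        replacing that entry by \<open>z + 1\<close> is the push.\<close>
      have "qR M n x' y' t (x[i + 1 := z + 1]) (y[i := z]) = qR M n x' y' t (x[i + 1 := z]) (y[i := z])"
        using len i zh by (intro qR_contact[where i = i]) auto
      also have "x[i + 1 := z] = x" using 1 by (metis list_update_id)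
      finally have "qR M n x' y' t x (y[i := z]) = qR M n x' y' t (x[i + 1 := z + 1]) (y[i := z])" by simp
      moreover have W: "(x[i + 1 := z + 1], y[i := z]) \<in> WI (trunc M) n"
        unfolding WI_trunc_iff
      proof (intro conjI allI impI)
        fix k assume k: "k < n"
        show "x[i + 1 := z + 1] ! k \<le> y[i := z] ! k"
          using il[OF k] ne[OF k] 1 i unfolding ny nx[OF Suc_leI[OF i, unfolded Suc_eq_plus1]] by (cases "k = i + 1"; cases "k = i") auto
        show "y[i := z] ! k < x[i + 1 := z + 1] ! (k + 1)"
          using il[OF k] 1 i unfolding ny nx[OF Suc_leI[OF i, unfolded Suc_eq_plus1]] by (cases "k = i") auto
      qed (use len i xS zS nx in auto)
      ultimately show ?case by (intro disjI2 bexI[OF _ W]) simp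
    next
      case 2
      have "qR M n x' y' t (x[i := z + 1]) (y[i := z]) = qR M n x' y' t (x[i := z]) (y[i := z])"
        using len i zh by (intro qR_contact[where i = i]) auto
      also have "x[i := z + 1] = x" using 2 by (metis list_update_id)
      finally have "qR M n x' y' t x (y[i := z]) = qR M n x' y' t (x[i := z]) (y[i := z])" by simp
      moreover have W: "(x[i := z], y[i := z]) \<in> WI (trunc M) n"
        unfolding WI_trunc_iff
      proof (intro conjI allI impI)
        fix k assume k: "k < n"
        show "x[i := z] ! k \<le> y[i := z] ! k"
          using il[OF k] 2 i unfolding ny nx[OF less_imp_le[OF i]] by (cases "k = i") auto
        show "y[i := z] ! k < x[i := z] ! (k + 1)"
          using il[OF k] ne[OF k] 2 i unfolding ny nx[OF less_imp_le[OF i]] by (cases "k = i"; cases "k + 1 = i") auto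
      qed (use len i xS zS nx in auto)
      ultimately show ?case by (intro disjI2 bexI[OF _ W]) simp
    qed
  qed
qed

end

context bd_lyapunov
begin

lemma WI_trunc_y_htrunc:
  assumes "(x, y) \<in> WI (trunc M) n" "i < n"
  shows "y ! i \<in> htrunc M"
proof -
  have "x ! i \<in> trunc M" "x ! (i + 1) \<in> trunc M" "x ! i \<le> y ! i" "y ! i < x ! (i + 1)"
    using assms by (auto simp: WI_trunc_iff)
  thus ?thesis using trunc_between_htrunc by blast
qed

section \<open>Values of the determinant at time zero\<close>

context
  fixes M n :: nat and x y x' y' :: "int list"
  assumes n: "1 \<le> n" and xy: "(x, y) \<in> WI (trunc M) n" and xy': "(x', y') \<in> WI (trunc M) n"
begin

lemma qrow_0_x:
  assumes "i \<le> n"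
  shows "j \<le> n \<Longrightarrow> qrow M n x' y' 0 x y i j = (if x ! i = x' ! j then 1 else 0)"
    and "j < n \<Longrightarrow> qrow M n x' y' 0 x y i (n + 1 + j) =
      w (y' ! j) * ((if x ! i \<le> y' ! j then 1 else 0) - (if i \<le> j then 1 else 0))"
proof -
  have "x ! i \<in> trunc M" using xy assms by (auto simp: WI_trunc_iff)
  thus "j \<le> n \<Longrightarrow> qrow M n x' y' 0 x y i j = (if x ! i = x' ! j then 1 else 0)"
    "j < n \<Longrightarrow> qrow M n x' y' 0 x y i (n + 1 + j) =
      w (y' ! j) * ((if x ! i \<le> y' ! j then 1 else 0) - (if i \<le> j then 1 else 0))"
    using assms by (simp_all add: qrow_def Rrow_def qcorr_def pR_0 FR_0)
qed

lemma qrow_0_y: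
  assumes i: "i < n"
  shows "j \<le> n \<Longrightarrow> qrow M n x' y' 0 x y (n + 1 + i) j =
      ((if y ! i = x' ! j then 1 else 0) - (if y ! i + 1 = x' ! j then 1 else 0)) / w (y ! i)"
    and "j < n \<Longrightarrow> qrow M n x' y' 0 x y (n + 1 + i) (n + 1 + j) = (if y ! i = y' ! j then 1 else 0)"
proof -
  have yh: "y ! i \<in> htrunc M" by (rule WI_trunc_y_htrunc[OF xy i])
  hence yt: "y ! i \<in> trunc M" "y ! i + 1 \<in> trunc M" by (auto simp: htrunc_def)
  have w: "0 < w (y ! i)" using hpi_pos yt trunc_subset by auto
  show "j \<le> n \<Longrightarrow> qrow M n x' y' 0 x y (n + 1 + i) j =
      ((if y ! i = x' ! j then 1 else 0) - (if y ! i + 1 = x' ! j then 1 else 0)) / w (y ! i)"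
    using yh by (simp add: qrow_def Rrow_def slope_def pR_0)
  show "j < n \<Longrightarrow> qrow M n x' y' 0 x y (n + 1 + i) (n + 1 + j) = (if y ! i = y' ! j then 1 else 0)"
    using yh yt w by (auto simp: qrow_def Rrow_def slope_def FR_0)
qed

lemma row_cases:
  assumes "i < 2 * n + 1"
  obtains "i \<le> n" | i' where "i = n + 1 + i'" "i' < n"
proof (cases "i \<le> n")
  case False
  hence "i = n + 1 + (i - (n + 1))" "i - (n + 1) < n" using assms by auto
  thus ?thesis by (rule that(2))
qed (rule that(1))

lemma zero_col:
  assumes "j < 2 * n + 1" "\<And>i. i \<le> n \<Longrightarrow> qrow M n x' y' 0 x y i j = 0"
    and "\<And>i. i < n \<Longrightarrow> qrow M n x' y' 0 x y (n + 1 + i) j = 0"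
  shows "qR M n x' y' 0 x y = 0"
proof -
  define l where "l = (if j = 0 then 1 else 0 :: nat)"
  show ?thesis unfolding qR_def
  proof (rule ldet_cols_proportional[of j _ l _ 0])
    fix i assume "i < 2 * n + 1"
    thus "qrow M n x' y' 0 x y i j = 0 * qrow M n x' y' 0 x y i l"
      by (cases rule: row_cases) (use assms in auto)
  qed (use assms n in \<open>auto simp: l_def\<close>)
qed

text \<open>When \<open>y' ! k = y ! k\<close>, the column of \<open>y' ! k\<close> is the unit
  vector of the row of \<open>y ! k\<close>, and by assumption the column of \<open>x' ! j\<close>
  can be nonzero only in that row.\<close>

lemma prop_col:
  assumes "j \<le> n" "k < n" "y' ! k = y ! k" "\<And>i. i \<le> n \<Longrightarrow> x ! i \<noteq> x' ! j"
    and "\<And>i. i < n \<Longrightarrow> i \<noteq> k \<Longrightarrow> y ! i \<noteq> x' ! j \<and> y ! i + 1 \<noteq> x' ! j"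
  shows "qR M n x' y' 0 x y = 0"
  unfolding qR_def
proof (rule ldet_cols_proportional[of j _ "n + 1 + k" _ "qrow M n x' y' 0 x y (n + 1 + k) j"])
  fix i assume "i < 2 * n + 1"
  thus "qrow M n x' y' 0 x y i j = qrow M n x' y' 0 x y (n + 1 + k) j * qrow M n x' y' 0 x y i (n + 1 + k)"
  proof (cases rule: row_cases)
    case 1
    have "x ! i \<le> y ! k \<longleftrightarrow> i \<le> k"
      using WI_order(3)[OF xy, of i k] WI_order(4)[OF xy, of k i] 1 assms(2) by (cases "i \<le> k") auto
    thus ?thesis using 1 assms qrow_0_x(1)[OF 1 assms(1)] qrow_0_x(2)[OF 1 assms(2)] by simp
  next
    case (2 i')
    show ?thesis
    proof (cases "i' = k")
      case True
      thus ?thesis using 2 assms(2,3) qrow_0_y(2)[of k k] by simp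
    next
      case False
      have "y ! i' \<noteq> y ! k" using WI_order(2)[OF xy, of i' k] WI_order(2)[OF xy, of k i'] False 2 assms(2)
        by (cases "i' < k") auto
      thus ?thesis using 2 assms False qrow_0_y(1)[of i' j] qrow_0_y(2)[of i' k] by simp
    qed
  qed
qed (use assms in auto)

lemmas ord = WI_order[OF xy] and ord' = WI_order[OF xy']

text \<open>At the last index \<open>k\<close> with \<open>y'\<^sub>k > y\<^sub>k\<close>, either column \<open>y'\<^sub>k\<close> vanishes, or column \<open>x'\<^sub>k\<^sub>+\<^sub>1\<close>
  is a multiple of column \<open>y'\<^sub>k\<^sub>+\<^sub>1\<close>.\<close>

lemma qR_0_above:
  assumes "k < n" "y ! k < y' ! k" and max: "\<And>l. k < l \<Longrightarrow> l < n \<Longrightarrow> y' ! l \<le> y ! l"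
  shows "qR M n x' y' 0 x y = 0"
proof (cases "y' ! k < x ! (k + 1)")
  case True
  show ?thesis
  proof (rule zero_col[of "n + 1 + k"])
    fix i assume i: "i \<le> n"
    have "x ! i \<le> y' ! k \<longleftrightarrow> i \<le> k"
    proof (cases "i \<le> k")
      case True
      thus ?thesis using ord(3)[of i k] assms by simp
    next
      case False
      hence "x ! (k + 1) \<le> x ! i" using ord(1)[of "k + 1" i] i by (cases "i = k + 1") auto
      thus ?thesis using False \<open>y' ! k < x ! (k + 1)\<close> by simp
    qed
    thus "qrow M n x' y' 0 x y i (n + 1 + k) = 0" using qrow_0_x(2)[OF i assms(1)] by simp
  next
    fix i assume i: "i < n"
    have "y ! i \<noteq> y' ! k"
    proof (cases "i \<le> k")
      case True
      thus ?thesis using ord(2)[of i k] assms by (cases "i = k") auto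
    next
      case False
      thus ?thesis using ord'(2)[of k i] max[of i] i by auto
    qed
    thus "qrow M n x' y' 0 x y (n + 1 + i) (n + 1 + k) = 0" using qrow_0_y(2)[OF i assms(1)] by simp
  qed (use assms in auto)
next
  case False
  have x'k: "x ! (k + 1) < x' ! (k + 1)" using False ord'(4)[of k "k + 1"] assms(1) by simp
  have xne: "x ! i \<noteq> x' ! (k + 1)" if "i \<le> n" for i
  proof (cases "i \<le> k + 1")
    case True
    hence "x ! i \<le> x ! (k + 1)" using ord(1)[of i "k + 1"] assms(1) by (cases "i = k + 1") auto
    thus ?thesis using x'k by simp
  next
    case False
    hence "x' ! (k + 1) \<le> y' ! (k + 1)" "y' ! (k + 1) \<le> y ! (k + 1)" "y ! (k + 1) < x ! i"
      using ord'(3)[of "k + 1" "k + 1"] max[of "k + 1"] ord(4)[of "k + 1" i] that by auto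
    thus ?thesis by simp
  qed
  have ylow: "y ! i \<noteq> x' ! (k + 1) \<and> y ! i + 1 \<noteq> x' ! (k + 1)" if "i \<le> k" for i
    using ord(4)[of i "k + 1"] that assms(1) x'k by auto
  have yhigh: "x' ! (k + 1) \<le> y' ! (k + 1)" "y' ! (k + 1) \<le> y ! (k + 1)" "y ! (k + 1) \<le> y ! i"
    if "k < i" "i < n" for i
    using that ord'(3)[of "k + 1" "k + 1"] max[of "k + 1"] ord(2)[of "k + 1" i] by (cases "i = k + 1"; auto)+
  show ?thesis
  proof (cases "k + 1 < n \<and> y' ! (k + 1) = y ! (k + 1)")
    case True
    show ?thesis
    proof (rule prop_col[of "k + 1" "k + 1"])
      fix i assume i: "i < n" "i \<noteq> k + 1"
      show "y ! i \<noteq> x' ! (k + 1) \<and> y ! i + 1 \<noteq> x' ! (k + 1)"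
      proof (cases "i \<le> k")
        case False
        hence "y ! (k + 1) < y ! i" using i by (intro ord(2)) auto
        thus ?thesis using yhigh[of i] False i by auto
      qed (rule ylow)
    qed (use True xne in auto)
  next
    case False
    show ?thesis
    proof (rule zero_col[of "k + 1"])
      fix i assume i: "i < n"
      have "y ! i \<noteq> x' ! (k + 1) \<and> y ! i + 1 \<noteq> x' ! (k + 1)"
      proof (cases "i \<le> k")
        case False
        with i have "k + 1 < n" "k < i" by auto
        thus ?thesis using yhigh[of i] i \<open>\<not> (k + 1 < n \<and> y' ! (k + 1) = y ! (k + 1))\<close> by auto
      qed (rule ylow)
      thus "qrow M n x' y' 0 x y (n + 1 + i) (k + 1) = 0" using qrow_0_y(1)[OF i, of "k + 1"] assms(1) by simp
    qed (use assms(1) xne in \<open>auto simp: qrow_0_x\<close>)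
  qed
qed

text \<open>Mirror image of the previous case, at the first index with
  \<open>y' ! k < y ! k\<close>: either column \<open>y' ! k\<close> vanishes, or column
  \<open>x' ! k\<close> vanishes or is a multiple of column \<open>y' ! (k - 1)\<close>.\<close>

lemma qR_0_below:
  assumes "k < n" "y' ! k < y ! k" and min: "\<And>l. l < k \<Longrightarrow> y ! l \<le> y' ! l"
  shows "qR M n x' y' 0 x y = 0"
proof (cases "x ! k \<le> y' ! k")
  case True
  show ?thesis
  proof (rule zero_col[of "n + 1 + k"])
    fix i assume i: "i \<le> n"
    have "x ! i \<le> y' ! k \<longleftrightarrow> i \<le> k"
    proof (cases "i \<le> k")
      case le: True
      thus ?thesis using ord(1)[of i k] assms(1) True by (cases "i = k") auto
    next
      case False
      thus ?thesis using ord(4)[of k i] i assms(2) by simp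
    qed
    thus "qrow M n x' y' 0 x y i (n + 1 + k) = 0" using qrow_0_x(2)[OF i assms(1)] by simp
  next
    fix i assume i: "i < n"
    have "y ! i \<noteq> y' ! k"
    proof (cases "i < k")
      case True
      thus ?thesis using min[of i] ord'(2)[of i k] assms(1) by auto
    next
      case False
      thus ?thesis using ord(2)[of k i] i assms(2) by (cases "i = k") auto
    qed
    thus "qrow M n x' y' 0 x y (n + 1 + i) (n + 1 + k) = 0" using qrow_0_y(2)[OF i assms(1)] by simp
  qed (use assms in auto)
next
  case False
  have x'k: "x' ! k < x ! k" using False ord'(3)[of k k] assms(1) by simp
  have ylow: "y ! i \<le> y' ! i" "y' ! i \<le> y' ! (k - 1)" "y' ! (k - 1) < x' ! k" if "i < k" for i
  proof -
    show "y ! i \<le> y' ! i" by (rule min[OF that])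
    have "i < k - 1 \<or> i = k - 1" using that by linarith
    moreover have "k - 1 < n" using assms(1) by simp
    ultimately show "y' ! i \<le> y' ! (k - 1)" using ord'(2)[of i "k - 1"] by (metis less_imp_le order_refl)
    show "y' ! (k - 1) < x' ! k" using ord'(4)[of "k - 1" k] that assms(1) by simp
  qed
  have xne: "x ! i \<noteq> x' ! k" if "i \<le> n" for i
  proof (cases "i < k")
    case True
    thus ?thesis using ylow[of i] ord(3)[of i i] assms(1) by auto
  next
    case False
    hence "x ! k \<le> x ! i" using ord(1)[of k i] that by (cases "i = k") auto
    thus ?thesis using x'k by simp
  qed
  have yhigh: "y ! i \<noteq> x' ! k \<and> y ! i + 1 \<noteq> x' ! k" if "k \<le> i" "i < n" for i
    using ord(3)[of k i] that x'k by auto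
  show ?thesis
  proof (cases "0 < k \<and> y' ! (k - 1) = y ! (k - 1)")
    case True
    show ?thesis
    proof (rule prop_col[of k "k - 1"])
      fix i assume i: "i < n" "i \<noteq> k - 1"
      show "y ! i \<noteq> x' ! k \<and> y ! i + 1 \<noteq> x' ! k"
      proof (cases "k \<le> i")
        case False
        hence "y' ! i < y' ! (k - 1)" using i assms(1) by (intro ord'(2)) auto
        thus ?thesis using ylow[of i] False by auto
      qed (use yhigh i in auto)
    qed (use True xne assms(1) in auto)
  next
    case nk: False
    show ?thesis
    proof (rule zero_col[of k])
      fix i assume i: "i < n"
      have "y ! i \<noteq> x' ! k \<and> y ! i + 1 \<noteq> x' ! k"
      proof (cases "k \<le> i")
        case False
        hence k: "0 < k" "i < k" by auto
        have "i < k - 1 \<or> i = k - 1" using k by linarith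
        moreover have "k - 1 < n" using assms(1) by simp
        ultimately have "y ! i \<le> y ! (k - 1)" using ord(2)[of i "k - 1"] by (metis less_imp_le order_refl)
        moreover have "y ! (k - 1) < y' ! (k - 1)" using nk k min[of "k - 1"] by auto
        ultimately show ?thesis using ylow[of i] k by auto
      qed (use yhigh i in auto)
      thus "qrow M n x' y' 0 x y (n + 1 + i) k = 0" using qrow_0_y(1)[OF i, of k] assms(1) by simp
    qed (use assms(1) xne in \<open>auto simp: qrow_0_x\<close>)
  qed
qed

text \<open>Interlacing says that \<open>x ! i \<le> y ! j\<close> holds exactly for
  \<open>i \<le> j\<close>, so the indicator correction empties the upper right block, and the lower
  right block is the identity.\<close>

lemma qR_0_same:
  assumes "y' = y"
  shows "0 \<le> qR M n x' y' 0 x y"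
proof -
  have len: "length x = n + 1" "length x' = n + 1" "sorted_wrt (<) x" "sorted_wrt (<) x'"
    using xy xy' by (auto simp: WI_def Wch_def)
  have m: "2 * n + 1 = (n + 1) + n" by simp
  have iff: "x ! i \<le> y ! j \<longleftrightarrow> i \<le> j" if "i \<le> n" "j < n" for i j
    using ord(3)[of i j] ord(4)[of j i] that by (cases "i \<le> j") auto
  have inj: "y ! i = y ! j \<longleftrightarrow> i = j" if "i < n" "j < n" for i j
    using ord(2)[of i j] ord(2)[of j i] that by (cases "i < j"; cases "i = j") auto
  have "qR M n x' y' 0 x y = ldet (n + 1) (qrow M n x' y' 0 x y)
     * ldet n (\<lambda>i j. qrow M n x' y' 0 x y (n + 1 + i) (n + 1 + j))"
    unfolding qR_def m by (rule ldet_block_upper_right_zero) (subst qrow_0_x(2), simp_all add: assms iff)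
  also have "ldet n (\<lambda>i j. qrow M n x' y' 0 x y (n + 1 + i) (n + 1 + j)) = ldet n (\<lambda>i j. if i = j then 1 else 0)"
    by (rule ldet_cong) (subst qrow_0_y(2), simp_all add: assms inj)
  also have "\<dots> = 1" by (subst ldet_diag) simp
  also have "ldet (n + 1) (qrow M n x' y' 0 x y) = ldet (n + 1) (\<lambda>i j. if x ! i = x' ! j then 1 else 0)"
    by (rule ldet_cong) (simp add: qrow_0_x)
  finally show ?thesis using ldet_indicator_nonneg[OF n len] by simp
qed

lemma qR_0_nonneg: "0 \<le> qR M n x' y' 0 x y"
proof -
  consider (above) "\<exists>k<n. y ! k < y' ! k" | (below) "\<exists>k<n. y' ! k < y ! k" | (same) "\<And>k. k < n \<Longrightarrow> y' ! k = y ! k"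
    by (meson linorder_neqE)
  thus ?thesis
  proof cases
    case above
    \<comment> \<open>The extremal index is needed for the inequality at all later indices, which
      keeps the later particles away from the column under study.\<close>
    define k where "k = (GREATEST k. k < n \<and> y ! k < y' ! k)"
    have ex: "\<exists>k. k < n \<and> y ! k < y' ! k" using above by blast
    have k: "k < n \<and> y ! k < y' ! k"
      unfolding k_def using GreatestI_ex_nat[OF ex, of n] by (auto intro: less_imp_le)
    have max: "y' ! l \<le> y ! l" if "k < l" "l < n" for l
      using Greatest_le_nat[of "\<lambda>k. k < n \<and> y ! k < y' ! k" l n] that unfolding k_def[symmetric]
      by (meson leI le_less_trans less_imp_le less_irrefl)
    have "qR M n x' y' 0 x y = 0" by (rule qR_0_above[of k]) (use k max in auto)
    thus ?thesis by simp
  next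
    case below
    define k where "k = (LEAST k. k < n \<and> y' ! k < y ! k)"
    have k: "k < n \<and> y' ! k < y ! k"
      unfolding k_def using below by (intro LeastI_ex[of "\<lambda>k. k < n \<and> y' ! k < y ! k"]) blast
    have min: "y ! l \<le> y' ! l" if "l < k" for l
      using not_less_Least[of l "\<lambda>k. k < n \<and> y' ! k < y ! k"] that k unfolding k_def[symmetric]
      by (meson leI less_trans)
    have "qR M n x' y' 0 x y = 0" by (rule qR_0_below[of k]) (use k min in auto)
    thus ?thesis by simp
  next
    case same
    have "y' = y" using same xy xy' by (intro nth_equalityI) (auto simp: WI_trunc_iff)
    thus ?thesis by (rule qR_0_same)
  qed
qed

end

text \<open>The comparison lemma runs over the interlacing pairs. A jump leads, with nonnegative
  rate, to the value at some interlacing pair or to 0, and both are at least any common lower bound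
  \<open>m \<le> 0\<close>.\<close>

lemma qR_nonneg:
  assumes n: "1 \<le> n" and xy: "(x, y) \<in> WI (trunc M) n" and xy': "(x', y') \<in> WI (trunc M) n" and t: "0 \<le> t"
  shows "0 \<le> qR M n x' y' t x y"
proof -
  define rate where "rate xy = (\<Sum>i<n + 1. lamR M (fst xy ! i) + muR M (fst xy ! i))
      + (\<Sum>i<n. mu (snd xy ! i + 1) + lam (snd xy ! i))" for xy
  let ?Q = "qR M n x' y'"
  have rates: "0 \<le> lamR M (x ! i)" "0 \<le> muR M (x ! i)" if "(x, y) \<in> WI (trunc M) n" "i < n + 1" for x y i
    using that refl.rates_nonneg[of "x ! i"] by (auto simp: WI_trunc_iff)
  have rates': "0 \<le> mu (y ! i + 1)" "0 \<le> lam (y ! i)" if "(x, y) \<in> WI (trunc M) n" "i < n" for x y i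
    using hbd.rates_nonneg[OF WI_trunc_y_htrunc[OF that]] by auto
  have "0 \<le> ?Q t (fst (x, y)) (snd (x, y))"
  proof (rule finite_system_nonneg[where J = "WI (trunc M) n" and T = t and j = "(x, y)"
        and u = "\<lambda>xy t. ?Q t (fst xy) (snd xy)" and u' = "\<lambda>xy t. qR_gen M n x' y' t (fst xy) (snd xy)"
        and r = rate and d = rate])
    show "finite (WI (trunc M) n)" by (rule finite_WI) simp
  next
    fix j s assume "j \<in> WI (trunc M) n" "s \<in> {0..t}"
    thus "((\<lambda>t. ?Q t (fst j) (snd j)) has_real_derivative qR_gen M n x' y' s (fst j) (snd j)) (at s within {0..t})"
      by (intro qR_has_derivative) auto
  next
    fix j assume j: "j \<in> WI (trunc M) n"
    thus "0 \<le> ?Q 0 (fst j) (snd j)" by (intro qR_0_nonneg n xy') auto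
    from j show "0 \<le> rate j" unfolding rate_def
      using rates[of "fst j" "snd j"] rates'[of "fst j" "snd j"]
      by (intro add_nonneg_nonneg sum_nonneg) auto
  next
    fix j s m assume j: "j \<in> WI (trunc M) n" and m: "m \<le> 0"
      and lb: "\<And>i. i \<in> WI (trunc M) n \<Longrightarrow> m \<le> ?Q s (fst i) (snd i)"
    obtain x y where xy: "j = (x, y)" by (cases j)
    have W: "(x, y) \<in> WI (trunc M) n" using j xy by simp
    \<comment> \<open>Upper jumps out of the window need no bound, since their reflected rate is
      zero.\<close>
    have mx: "m \<le> ?Q s (x[i := z]) y" if "i \<le> n" "z = x ! i + 1 \<or> z = x ! i - 1" "z \<in> trunc M" for i z
    proof -
      from qR_move_x[OF W that, of x' y' s] obtain v where "v \<in> WI (trunc M) n"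
        "?Q s (x[i := z]) y = ?Q s (fst v) (snd v)" by (auto simp: case_prod_unfold)
      thus ?thesis using lb by simp
    qed
    have my: "m \<le> ?Q s x (y[i := z])" if "i < n" "z = y ! i + 1 \<or> z = y ! i - 1" for i z
    proof -
      from qR_move_y[OF W that, of x' y' s] consider "?Q s x (y[i := z]) = 0"
        | v where "v \<in> WI (trunc M) n" "?Q s x (y[i := z]) = ?Q s (fst v) (snd v)"
        by (auto simp: case_prod_unfold)
      thus ?thesis using lb m by cases auto
    qed
    let ?q = "?Q s x y"
    have "rate j * m - rate j * ?q = (\<Sum>i<n + 1. lamR M (x ! i) * (m - ?q) + muR M (x ! i) * (m - ?q))
       + (\<Sum>i<n. mu (y ! i + 1) * (m - ?q) + lam (y ! i) * (m - ?q))"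
      unfolding rate_def xy fst_conv snd_conv
      by (simp only: right_diff_distrib[symmetric] distrib_right[symmetric] sum_distrib_right[symmetric])
    also have "\<dots> \<le> qR_gen M n x' y' s x y"
      unfolding qR_gen_def Let_def
    proof (intro add_mono sum_mono)
      fix i assume i: "i \<in> {..<n + 1}"
      show "lamR M (x ! i) * (m - ?q) \<le> lamR M (x ! i) * (?Q s (x[i := x ! i + 1]) y - ?q)"
        using mx[of i "x ! i + 1"] rates[OF W, of i] i
        by (cases "x ! i + 1 \<in> trunc M") (auto simp: lamR_def intro!: mult_left_mono)
      show "muR M (x ! i) * (m - ?q) \<le> muR M (x ! i) * (?Q s (x[i := x ! i - 1]) y - ?q)"
        using mx[of i "x ! i - 1"] rates[OF W, of i] i
        by (cases "x ! i - 1 \<in> trunc M") (auto simp: muR_def intro!: mult_left_mono)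
    next
      fix i assume "i \<in> {..<n}"
      hence i: "i < n" by simp
      show "mu (y ! i + 1) * (m - ?q) \<le> mu (y ! i + 1) * (?Q s x (y[i := y ! i + 1]) - ?q)"
        by (intro mult_left_mono diff_right_mono my i rates'(1)[OF W i]) simp
      show "lam (y ! i) * (m - ?q) \<le> lam (y ! i) * (?Q s x (y[i := y ! i - 1]) - ?q)"
        by (intro mult_left_mono diff_right_mono my i rates'(2)[OF W i]) simp
    qed
    finally show "rate j * m - rate j * ?Q s (fst j) (snd j) \<le> qR_gen M n x' y' s (fst j) (snd j)"
      by (simp add: xy)
  qed (use t xy in auto)
  thus ?thesis by simp
qed

section \<open>Passage from the windows to the full chain\<close>

definition Qrow :: "nat \<Rightarrow> int list \<Rightarrow> int list \<Rightarrow> real \<Rightarrow> int \<Rightarrow> nat \<Rightarrow> real" where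
  "Qrow n x' y' t z j = (if j \<le> n then p t z (x' ! j)
     else w (y' ! (j - (n + 1))) * F t z (y' ! (j - (n + 1))))"

text \<open>Siegmund duality rewrites the lower right block as slopes of the row function, which
  gives the kernel the shape of the determinants in the windows.\<close>

lemma qker_eq:
  assumes xy: "(x, y) \<in> WI I n" and xy': "(x', y') \<in> WI I n" and t: "0 \<le> t"
  shows "qker I lam mu n t (x, y) (x', y') = ldet (2 * n + 1) (\<lambda>i j.
     if i \<le> n then Qrow n x' y' t (x ! i) j - qcorr n y' i j
     else (Qrow n x' y' t (y ! (i - (n + 1))) j - Qrow n x' y' t (y ! (i - (n + 1)) + 1) j) / w (y ! (i - (n + 1))))"
proof -
  have yI: "y ! i \<in> I" "y' ! i \<in> I" if "i < n" for i
    using that xy xy' by (auto simp: WI_def Wint_def Wch_def)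
  show ?thesis unfolding qker_def Let_def fst_conv snd_conv
  proof (rule ldet_cong)
    fix i j assume ij: "i < 2 * n + 1" "j < 2 * n + 1"
    show "(if i \<le> n \<and> j \<le> n then p t (x ! i) (x' ! j)
        else if i \<le> n then w (y' ! (j - (n + 1))) * (F t (x ! i) (y' ! (j - (n + 1))) - (if i \<le> j - (n + 1) then 1 else 0))
        else if j \<le> n then (p t (y ! (i - (n + 1))) (x' ! j) - p t (y ! (i - (n + 1)) + 1) (x' ! j)) / w (y ! (i - (n + 1)))
        else hp t (y ! (i - (n + 1))) (y' ! (j - (n + 1)))) =
      (if i \<le> n then Qrow n x' y' t (x ! i) j - qcorr n y' i j
       else (Qrow n x' y' t (y ! (i - (n + 1))) j - Qrow n x' y' t (y ! (i - (n + 1)) + 1) j) / w (y ! (i - (n + 1))))"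
    proof (cases "i \<le> n \<or> j \<le> n")
      case True
      thus ?thesis by (auto simp: Qrow_def qcorr_def right_diff_distrib)
    next
      case False
      have "hp t (y ! (i - (n + 1))) (y' ! (j - (n + 1))) = w (y' ! (j - (n + 1))) *
        ((F t (y ! (i - (n + 1))) (y' ! (j - (n + 1))) - F t (y ! (i - (n + 1)) + 1) (y' ! (j - (n + 1)))) / w (y ! (i - (n + 1))))"
        using False ij by (intro siegmund_duality yI t) auto
      thus ?thesis using False by (simp add: Qrow_def right_diff_distrib)
    qed
  qed
qed

lemma eventually_WI_trunc:
  assumes "(x, y) \<in> WI I n"
  shows "\<forall>\<^sub>F M in sequentially. (x, y) \<in> WI (trunc M) n"
proof -
  have "\<forall>\<^sub>F M in sequentially. \<forall>i\<in>{..n}. x ! i \<in> trunc M"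
    using assms by (auto simp: WI_I_iff intro!: eventually_ball_finite eventually_in_trunc)
  thus ?thesis by eventually_elim (use assms in \<open>auto simp: WI_I_iff WI_trunc_iff\<close>)
qed

lemma qR_tendsto:
  assumes xy: "(x, y) \<in> WI I n" and xy': "(x', y') \<in> WI I n" and t: "0 \<le> t"
  shows "(\<lambda>M. qR M n x' y' t x y) \<longlonglongrightarrow> qker I lam mu n t (x, y) (x', y')"
  unfolding qR_def qker_eq[OF assms]
proof (rule tendsto_ldet)
  fix i j assume i: "i < 2 * n + 1" and j: "j < 2 * n + 1"
  have R: "(\<lambda>M. Rrow M n x' y' t z j) \<longlonglongrightarrow> Qrow n x' y' t z j" if "z \<in> I" for z
    using xy' j that t unfolding Rrow_def Qrow_def WI_I_iff
    by (cases "j \<le> n") (auto intro!: tendsto_intros pR_tendsto FR_tendsto)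
  show "(\<lambda>M. qrow M n x' y' t x y i j) \<longlonglongrightarrow> (if i \<le> n then Qrow n x' y' t (x ! i) j - qcorr n y' i j
     else (Qrow n x' y' t (y ! (i - (n + 1))) j - Qrow n x' y' t (y ! (i - (n + 1)) + 1) j) / w (y ! (i - (n + 1))))"
  proof (cases "i \<le> n")
    case True
    have "x ! i \<in> I" using xy True by (auto simp: WI_I_iff)
    thus ?thesis using True unfolding qrow_def by (auto intro!: tendsto_intros R)
  next
    case False
    define z where "z = y ! (i - (n + 1))"
    have k: "i - (n + 1) < n" using False i by auto
    have zI: "z \<in> I" using xy k unfolding z_def by (auto simp: WI_def Wint_def Wch_def)
    hence zI1: "z + 1 \<in> I" using up_closed[of z "z + 1"] by simp
    have "(\<lambda>M. (Rrow M n x' y' t z j - Rrow M n x' y' t (z + 1) j) / w z) \<longlonglongrightarrow> (Qrow n x' y' t z j - Qrow n x' y' t (z + 1) j) / w z"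
      using hpi_pos[OF zI] by (intro tendsto_intros R zI zI1) auto
    moreover have "\<forall>\<^sub>F M in sequentially. (Rrow M n x' y' t z j - Rrow M n x' y' t (z + 1) j) / w z = qrow M n x' y' t x y i j"
      using eventually_in_trunc[OF zI] eventually_in_trunc[OF zI1]
      by eventually_elim (use False in \<open>auto simp: qrow_def slope_def htrunc_def z_def\<close>)
    ultimately show ?thesis using False by (simp add: tendsto_cong z_def)
  qed
qed

lemma qker_nonneg:
  assumes n: "1 \<le> n" and xy: "(x, y) \<in> WI I n" and xy': "(x', y') \<in> WI I n" and t: "0 \<le> t"
  shows "0 \<le> qker I lam mu n t (x, y) (x', y')"
proof (rule tendsto_lowerbound[OF qR_tendsto[OF xy xy' t]])
  show "\<forall>\<^sub>F M in sequentially. 0 \<le> qR M n x' y' t x y"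
    using eventually_WI_trunc[OF xy] eventually_WI_trunc[OF xy']
    by eventually_elim (rule qR_nonneg[OF n _ _ t])
qed simp

end

subsection \<open>Intertwining\<close>

lemma sum_telescope_int:
  fixes g :: "int \<Rightarrow> real"
  assumes "a \<le> b"
  shows "(\<Sum>v\<in>{a..<b}. g v - g (v + 1)) = g a - g b"
  using assms
proof (induction b rule: int_ge_induct)
  case (step b)
  have "{a..<b + 1} = insert b {a..<b}" using step.hyps by auto
  thus ?case using step by simp
qed simp

section \<open>The two partial sums of the kernel\<close>

context bd_lyapunov
begin

lemma Wint_eq_list_prod:
  assumes "x \<in> Wch I (n + 1)"
  shows "Wint I x = list_prod n (\<lambda>i. {x ! i..<x ! (i + 1)})"
proof -
  have len: "length x = n + 1" "\<forall>i\<le>n. x ! i \<in> I" using assms by (auto simp: Wch_def)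
  have "y \<in> Wint I x \<longleftrightarrow> (x, y) \<in> WI I n" for y using assms by (auto simp: WI_def)
  thus ?thesis using len by (auto simp: WI_I_iff list_prod_def)
qed

lemma finite_Wint: "x \<in> Wch I (n + 1) \<Longrightarrow> finite (Wint I x)"
  unfolding Wint_eq_list_prod by (rule finite_list_prod) simp

text \<open>The weights clear the denominators of the lower rows. Each coordinate of
  \<open>y\<close> then occurs in one row, and over the product set \<open>Wint I x\<close> that row
  telescopes to a difference of row functions at consecutive entries of \<open>x\<close>.\<close>

lemma sum_qker_start:
  assumes x: "x \<in> Wch I (n + 1)" and xy': "(x', y') \<in> WI I n" and t: "0 \<le> t"
  shows "(\<Sum>y\<in>Wint I x. (\<Prod>i<n. w (y ! i)) * qker I lam mu n t (x, y) (x', y'))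
    = KM p (n + 1) t x x' * (\<Prod>i<n. w (y' ! i))"
proof -
  let ?R = "Qrow n x' y' t"
  let ?m = "n + 1 + n"
  have m: "2 * n + 1 = ?m" by simp
  define top where "top i j = ?R (x ! i) j - qcorr n y' i j" for i j
  have xinc: "x ! i \<le> x ! (i + 1)" if "i < n" for i
  proof -
    have "sorted_wrt (<) x" "length x = n + 1" using x by (auto simp: Wch_def)
    thus ?thesis using that by (auto simp: sorted_wrt_iff_nth_less intro: less_imp_le)
  qed
  have scaled: "(\<Prod>i<n. w (y ! i)) * qker I lam mu n t (x, y) (x', y') =
     ldet ?m (\<lambda>i j. if i < n + 1 then top i j else ?R (y ! (i - (n + 1))) j - ?R (y ! (i - (n + 1)) + 1) j)"
    if y: "y \<in> Wint I x" for y
  proof -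
    have xy: "(x, y) \<in> WI I n" using x y by (auto simp: WI_def)
    have w: "w (y ! i) \<noteq> 0" if "i < n" for i
    proof -
      have "y ! i \<in> I" using xy that by (auto simp: WI_def Wint_def Wch_def)
      thus ?thesis using hpi_pos by force
    qed
    have "(\<Prod>i<n. w (y ! i)) * qker I lam mu n t (x, y) (x', y') = (\<Prod>i<n. w (y ! i)) *
       ldet ?m (\<lambda>i j. if i < n + 1 then top i j else (?R (y ! (i - (n + 1))) j - ?R (y ! (i - (n + 1)) + 1) j) / w (y ! (i - (n + 1))))"
      unfolding qker_eq[OF xy xy' t] m by (intro arg_cong2[where f = "(*)"] ldet_cong refl) (simp add: top_def)
    also have "\<dots> = ldet ?m (\<lambda>i j. if i < n + 1 then top i j
        else w (y ! (i - (n + 1))) * ((?R (y ! (i - (n + 1))) j - ?R (y ! (i - (n + 1)) + 1) j) / w (y ! (i - (n + 1)))))"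
      by (rule ldet_scale_rows[symmetric, where c = "\<lambda>i. w (y ! i)" and f = "\<lambda>i j. (?R (y ! i) j - ?R (y ! i + 1) j) / w (y ! i)"])
    also have "\<dots> = ldet ?m (\<lambda>i j. if i < n + 1 then top i j else ?R (y ! (i - (n + 1))) j - ?R (y ! (i - (n + 1)) + 1) j)"
      using w by (intro ldet_cong) simp
    finally show ?thesis .
  qed
  define summed where "summed i j = (if i < n + 1 then top i j else ?R (x ! (i - (n + 1))) j - ?R (x ! (i - (n + 1) + 1)) j)" for i j
  have "((\<lambda>y. ldet ?m (\<lambda>i j. if i < n + 1 then top i j else ?R (y ! (i - (n + 1))) j - ?R (y ! (i - (n + 1)) + 1) j))
     has_sum ldet ?m summed) (list_prod n (\<lambda>i. {x ! i..<x ! (i + 1)}))"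
    unfolding summed_def
  proof (rule has_sum_ldet_rows[where f = "\<lambda>i j v. ?R v j - ?R (v + 1) j"])
    fix i j assume "i < n"
    thus "((\<lambda>v. ?R v j - ?R (v + 1) j) has_sum (?R (x ! i) j - ?R (x ! (i + 1)) j)) {x ! i..<x ! (i + 1)}"
      using sum_telescope_int[OF xinc, of i "\<lambda>v. ?R v j"] by (intro has_sum_finiteI) auto
  qed
  hence "(\<Sum>y\<in>Wint I x. ldet ?m (\<lambda>i j. if i < n + 1 then top i j else ?R (y ! (i - (n + 1))) j - ?R (y ! (i - (n + 1)) + 1) j))
      = ldet ?m summed"
    unfolding Wint_eq_list_prod[OF x, symmetric] by (rule has_sum_unique[OF has_sum_finite[OF finite_Wint[OF x]]])
  hence "(\<Sum>y\<in>Wint I x. (\<Prod>i<n. w (y ! i)) * qker I lam mu n t (x, y) (x', y')) = ldet ?m summed"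
    using scaled by (simp only: sum.cong[OF HOL.refl scaled])
  also have "\<dots> = ldet ?m (\<lambda>i j. if i < n + 1 then top i j else if j = i then w (y' ! (i - (n + 1))) else 0)"
  \<comment> \<open>To lower row \<open>k\<close>, \<open>T\<close> adds upper row
    \<open>k + 1\<close> minus upper row \<open>k\<close>. The row functions cancel, and consecutive
    \<open>qcorr\<close> rows differ only in column \<open>n + 1 + k\<close>, so a diagonal block of
    weights remains.\<close>
  proof (rule ldet_add_rows[where k = "n + 1" and T = "\<lambda>i l. (if l = i - (n + 1) then -1 else 0) + (if l = i - (n + 1) + 1 then 1 else 0)", symmetric])
    fix i j assume ij: "i < ?m" "j < ?m"
    show "(if i < n + 1 then top i j else if j = i then w (y' ! (i - (n + 1))) else 0) = summed i j +
      (if n + 1 \<le> i then \<Sum>l<n + 1. ((if l = i - (n + 1) then -1 else 0) + (if l = i - (n + 1) + 1 then 1 else 0)) * summed l j else 0)"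
    proof (cases "i < n + 1")
      case False
      define k where "k = i - (n + 1)"
      have k: "k < n" "i = n + 1 + k" using False ij by (auto simp: k_def)
      have "(\<Sum>l<n + 1. ((if l = k then -1 else 0) + (if l = k + 1 then 1 else 0)) * summed l j)
        = (\<Sum>l<n + 1. (if l = k then - summed l j else 0)) + (\<Sum>l<n + 1. (if l = k + 1 then summed l j else 0))"
        unfolding sum.distrib[symmetric] by (intro sum.cong) auto
      also have "\<dots> = - top k j + top (k + 1) j" using k by (simp add: summed_def)
      also have "summed i j + \<dots> = qcorr n y' k j - qcorr n y' (k + 1) j"
        unfolding summed_def k_def[symmetric] using k by (simp add: top_def)
      also have "\<dots> = (if j = i then w (y' ! k) else 0)"
        using k ij by (auto simp: qcorr_def)
      finally show ?thesis using False by (simp add: k_def)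
    qed (simp add: summed_def)
  qed simp
  also have "\<dots> = ldet (n + 1) top * ldet n (\<lambda>i j. if i = j then w (y' ! i) else 0)"
    by (subst ldet_block_lower_left_zero) (auto intro!: arg_cong2[where f = "(*)"] ldet_cong)
  also have "ldet (n + 1) top = KM p (n + 1) t x x'"
    unfolding KM_def by (rule ldet_cong) (simp add: top_def Qrow_def qcorr_def)
  finally show ?thesis by (simp add: ldet_diag)
qed

lemma p_has_sum_F:
  assumes "z \<in> I" "0 \<le> t"
  shows "(p t z has_sum F t z v) {u \<in> I. u \<le> v}"
  unfolding Pcum_def using p_summable[OF assms] by simp

text \<open>For fixed \<open>y'\<close> the admissible \<open>x'\<close> form a product of disjoint
  consecutive intervals, one per left column, so the sum acts column by column.\<close>

lemma has_sum_qker_target: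
  assumes xy: "(x, y) \<in> WI I n" and y': "y' \<in> Wch I n" and t: "0 \<le> t"
  shows "((\<lambda>x'. qker I lam mu n t (x, y) (x', y')) has_sum KM hp n t y y') {x'. (x', y') \<in> WI I n}"
proof -
  let ?m = "n + 1 + n"
  have m: "2 * n + 1 = ?m" by simp
  have xI: "x ! i \<in> I" if "i \<le> n" for i using xy that by (auto simp: WI_I_iff)
  have yI: "y ! i \<in> I" if "i < n" for i using xy that by (auto simp: WI_def Wint_def Wch_def)
  have y1I: "y ! i + 1 \<in> I" if "i < n" for i using up_closed[OF yI[OF that], of "y ! i + 1"] by simp
  have y'len: "length y' = n" and y'I: "\<And>i. i < n \<Longrightarrow> y' ! i \<in> I"
    and y'inc: "\<And>i j. i < j \<Longrightarrow> j < n \<Longrightarrow> y' ! i < y' ! j"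
    using y' by (auto simp: Wch_def sorted_wrt_iff_nth_less)
  \<comment> \<open>The last interval has no upper end. Conservativity gives \<open>L n\<close> mass
    one from every site, hence the value 1 in \<open>H\<close>.\<close>
  define L where "L j = (if j < n then {u \<in> I. u \<le> y' ! j} else I)" for j
  define H where "H z j = (if j < n then F t z (y' ! j) else 1)" for z j
  define S where "S j = (if j = 0 then L j else L j - L (j - 1))" for j
  define s where "s z j = H z j - (if j = 0 then 0 else H z (j - 1))" for z j
  have L: "(p t z has_sum H z j) (L j)" if "z \<in> I" for z j
    using p_has_sum_F[OF that t] p_has_sum_1[OF that t] by (simp add: L_def H_def)
  have S: "(p t z has_sum s z j) (S j)" if "z \<in> I" "j \<le> n" for z j
  proof (cases "j = 0")
    case True
    thus ?thesis using L[OF that(1), of j] by (simp add: s_def S_def)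
  next
    case False
    have "L (j - 1) \<subseteq> L j" using False that(2) y'inc[of "j - 1" j] by (auto simp: L_def)
    from has_sum_Diff[OF L[OF that(1)] L[OF that(1)] this] show ?thesis using False by (simp add: s_def S_def)
  qed
  have set_eq: "{x'. (x', y') \<in> WI I n} = list_prod (n + 1) S"
  proof (intro Set.set_eqI iffI)
    fix x' assume "x' \<in> {x'. (x', y') \<in> WI I n}"
    hence W: "(x', y') \<in> WI I n" by simp
    show "x' \<in> list_prod (n + 1) S"
      unfolding list_prod_def
    proof (intro CollectI conjI allI impI)
      fix j assume j: "j < n + 1"
      have "x' ! j \<in> L j" using W j by (auto simp: WI_I_iff L_def)
      moreover have "x' ! j \<notin> L (j - 1)" if "j \<noteq> 0"
        using WI_order(4)[OF W, of "j - 1" j] j that by (auto simp: L_def)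
      ultimately show "x' ! j \<in> S j" by (auto simp: S_def)
    qed (use W in \<open>auto simp: WI_I_iff\<close>)
  next
    fix x' assume "x' \<in> list_prod (n + 1) S"
    hence len: "length x' = n + 1" and S: "\<And>j. j \<le> n \<Longrightarrow> x' ! j \<in> S j" by (auto simp: list_prod_def)
    have "x' ! j \<in> I" if "j \<le> n" for j using S[OF that] by (auto simp: S_def L_def split: if_splits)
    moreover have "x' ! j \<le> y' ! j" if "j < n" for j
      using S[of j] that by (auto simp: S_def L_def split: if_splits)
    moreover have "y' ! j < x' ! (j + 1)" if "j < n" for j
      using S[of "j + 1"] calculation(1)[of "j + 1"] that by (auto simp: S_def L_def not_le)
    ultimately show "x' \<in> {x'. (x', y') \<in> WI I n}" using len y'len by (auto simp: WI_I_iff)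
  qed
  define f where "f i v = (if i \<le> n then p t (x ! i) v else (p t (y ! (i - (n + 1))) v - p t (y ! (i - (n + 1)) + 1) v) / w (y ! (i - (n + 1))))" for i v
  define g where "g i j = (if i \<le> n then w (y' ! (j - (n + 1))) * (F t (x ! i) (y' ! (j - (n + 1))) - (if i \<le> j - (n + 1) then 1 else 0))
     else hp t (y ! (i - (n + 1))) (y' ! (j - (n + 1))))" for i j
  define sf where "sf i j = (if i \<le> n then s (x ! i) j else (s (y ! (i - (n + 1))) j - s (y ! (i - (n + 1)) + 1) j) / w (y ! (i - (n + 1))))" for i j
  define summed where "summed i j = (if j < n + 1 then sf i j else g i j)" for i j
  have q: "qker I lam mu n t (x, y) (x', y') = ldet ?m (\<lambda>i j. if j < n + 1 then f i (x' ! j) else g i j)" for x'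
    unfolding qker_def Let_def fst_conv snd_conv m by (rule ldet_cong) (simp add: f_def g_def)
  have "((\<lambda>x'. qker I lam mu n t (x, y) (x', y')) has_sum ldet ?m summed) (list_prod (n + 1) S)"
    unfolding q summed_def
  proof (rule has_sum_ldet_cols)
    fix i j assume i: "i < ?m" and j: "j < n + 1"
    show "((\<lambda>v. f i v) has_sum sf i j) (S j)"
    proof (cases "i \<le> n")
      case True
      thus ?thesis using S[OF xI[OF True], of j] j by (simp add: f_def sf_def)
    next
      case False
      have k: "i - (n + 1) < n" using False i by auto
      have jn: "j \<le> n" using j by simp
      from has_sum_divide_const[OF has_sum_minus[OF S[OF yI[OF k] jn] S[OF y1I[OF k] jn]]]
      show ?thesis using False unfolding f_def sf_def by (simp only: if_False)
    qed
  qed simp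
  also have "ldet ?m summed = ldet ?m (\<lambda>i j. if j < n + 1 then (if i = j then 1 else 0) else g i j)"
  \<comment> \<open>Column \<open>n + 1 + l\<close> carries the cumulative function at
    \<open>y' ! l\<close> times its weight. Adding the one for \<open>j - 1\<close> and subtracting
    the one for \<open>j\<close> undoes the increment \<open>s\<close>. For \<open>j = 0\<close> and
    \<open>j = n\<close> one index leaves the range: the first interval has no lower end among the
    \<open>y'\<close>, the last no upper one.\<close>
  proof (rule ldet_add_cols[where k = "n + 1" and T = "\<lambda>l j. ((if l = n + 1 + j then -1 else 0) + (if l = n + j then 1 else 0)) / w (y' ! (l - (n + 1)))", symmetric])
    fix i j assume i: "i < ?m" and j: "j < ?m"
    define T where "T l = ((if l = n + 1 + j then -1 else 0) + (if l = n + j then 1 else 0)) / w (y' ! (l - (n + 1)))" for l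
    show "(if j < n + 1 then if i = j then 1 else 0 else g i j) = summed i j +
      (if j < n + 1 then \<Sum>l\<in>{n + 1..<?m}. summed i l * T l else 0)"
    proof (cases "j < n + 1")
      case True
      define G where "G k = summed i (n + 1 + k) / w (y' ! k)" for k
      have "(\<Sum>l\<in>{n + 1..<?m}. summed i l * T l) = (\<Sum>k<n. (if k = j then - G k else 0) + (if k + 1 = j then G k else 0))"
        by (rule sum.reindex_bij_witness[of _ "\<lambda>k. n + 1 + k" "\<lambda>l. l - (n + 1)"]) (auto simp: T_def G_def)
      also have "\<dots> = (if j < n then - G j else 0) + (if 0 < j then G (j - 1) else 0)"
      proof -
        have "(\<Sum>k<n. (if k + 1 = j then G k else 0)) = (if 0 < j then G (j - 1) else 0)"
        proof (cases "0 < j")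
          case True
          have "(\<Sum>k<n. (if k + 1 = j then G k else 0)) = (\<Sum>k<n. (if k = j - 1 then G k else 0))"
            using True by (intro sum.cong) auto
          thus ?thesis using True \<open>j < n + 1\<close> by simp
        qed simp
        thus ?thesis by (simp add: sum.distrib)
      qed
      finally have sumT: "(\<Sum>l\<in>{n + 1..<?m}. summed i l * T l) = (if j < n then - G j else 0) + (if 0 < j then G (j - 1) else 0)" .
      \<comment> \<open>In an upper row only the difference of two consecutive indicators survives,
        which is 1 exactly at \<open>i = j\<close>. In a lower row everything cancels by
        duality.\<close>
      have "sf i j + ((if j < n then - G j else 0) + (if 0 < j then G (j - 1) else 0)) = (if i = j then 1 else 0)"
      proof (cases "i \<le> n")
        case i: True
        have G: "G k = H (x ! i) k - (if i \<le> k then 1 else 0)" if "k < n" for k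
          using that i hpi_pos[OF y'I[OF that]] by (simp add: G_def summed_def g_def H_def)
        have Hn: "H (x ! i) j = 1" if "\<not> j < n" using that by (simp add: H_def)
        show ?thesis using i True G[of j] G[of "j - 1"] Hn by (cases "j < n"; cases "0 < j") (auto simp: sf_def s_def)
      next
        case False
        define k where "k = i - (n + 1)"
        have k: "k < n" using False i by (auto simp: k_def)
        have G: "G l = (H (y ! k) l - H (y ! k + 1) l) / w (y ! k)" if "l < n" for l
          using that False hpi_pos[OF y'I[OF that]] siegmund_duality[OF yI[OF k] y'I[OF that] t]
          by (simp add: G_def summed_def g_def H_def k_def)
        have Hn: "H z j = 1" if "\<not> j < n" for z using that by (simp add: H_def)
        have "sf i j = (s (y ! k) j - s (y ! k + 1) j) / w (y ! k)" using False by (simp add: sf_def k_def)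
        moreover have "i \<noteq> j" using False True by simp
        ultimately show ?thesis using True G[of j] G[of "j - 1"] Hn[of "y ! k"] Hn[of "y ! k + 1"]
          by (cases "j < n"; cases "0 < j") (auto simp: s_def diff_divide_distrib)
      qed
      thus ?thesis using True sumT by (simp add: summed_def)
    qed (simp add: summed_def)
  qed simp
  also have "\<dots> = ldet (n + 1) (\<lambda>i j. if i = j then 1 else 0) * ldet n (\<lambda>i j. hp t (y ! i) (y' ! j))"
    by (subst ldet_block_lower_left_zero) (auto intro!: arg_cong2[where f = "(*)"] ldet_cong simp: g_def)
  also have "\<dots> = KM hp n t y y'"
    by (subst ldet_diag) (simp add: KM_def)
  finally show ?thesis unfolding set_eq .
qed

lemma Wint_imp_Wch: "x \<in> Wch I (n + 1) \<Longrightarrow> y \<in> Wint I x \<Longrightarrow> y \<in> Wch I n"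
  by (auto simp: Wint_def Wch_def)

lemma WI_eq_Sigma: "WI I n = Sigma (Wch I (n + 1)) (Wint I)"
  by (auto simp: WI_def)

lemma weight_pos: "y \<in> Wch I n \<Longrightarrow> 0 < (\<Prod>i<n. w (y ! i))"
  by (intro prod_pos hpi_pos ballI) (auto simp: Wch_def)

lemma hup_eq:
  assumes x: "x \<in> Wch I (n + 1)"
  shows "hup I lam mu n hh x = (\<Sum>y\<in>Wint I x. (\<Prod>i<n. w (y ! i)) * hh y)"
proof -
  have "hup I lam mu n hh x = infsum (\<lambda>y. (\<Prod>i<n. w (y ! i)) * hh y) (Wint I x)"
    unfolding hup_def using Wint_imp_Wch[OF x]
    by (intro infsum_cong_neutral) (auto simp: Lam_def Wch_def)
  thus ?thesis using finite_Wint[OF x] by simp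
qed

text \<open>Interlacing is weak on the left, so \<open>y ! i = x ! i\<close> is admissible; this
  makes the sum defining \<open>h\<close> nonempty.\<close>

lemma Wint_nonempty:
  assumes x: "x \<in> Wch I (n + 1)"
  shows "take n x \<in> Wint I x"
proof -
  have "length x = n + 1" "sorted_wrt (<) x" using x by (auto simp: Wch_def)
  thus ?thesis unfolding Wint_eq_list_prod[OF x] by (auto simp: list_prod_def sorted_wrt_iff_nth_less)
qed

section \<open>Eigenfunctions and intertwining relations\<close>

context
  fixes n :: nat and hh :: "int list \<Rightarrow> real" and c :: real
  assumes n1: "1 \<le> n" and hh_all_pos: "\<forall>y\<in>Wch I n. 0 < hh y"
    and hh_all_eig: "\<forall>t\<ge>0. \<forall>y\<in>Wch I n.
        ((\<lambda>y'. KM hp n t y y' * hh y') has_sum (exp (c * t) * hh y)) (Wch I n)"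
begin

lemma hh_pos: "y \<in> Wch I n \<Longrightarrow> 0 < hh y"
  using hh_all_pos by blast

lemma hh_eig: "0 \<le> t \<Longrightarrow> y \<in> Wch I n \<Longrightarrow>
    ((\<lambda>y'. KM hp n t y y' * hh y') has_sum (exp (c * t) * hh y)) (Wch I n)"
  using hh_all_eig by blast

abbreviation "h \<equiv> hup I lam mu n hh"
abbreviation "q \<equiv> qker I lam mu n"

text \<open>Summing over \<open>x'\<close> for fixed \<open>y'\<close> leaves \<open>KM hp\<close>,
  to which the hypothesis applies. Nonnegativity of the kernel upgrades this iterated sum to a sum
  over pairs.\<close>

lemma qker_eigenfunction:
  assumes t: "0 \<le> t" and xy: "(x, y) \<in> WI I n"
  shows "((\<lambda>xy'. q t (x, y) xy' * hh (snd xy')) has_sum (exp (c * t) * hh y)) (WI I n)"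
proof -
  let ?X = "\<lambda>y'. {x'. (x', y') \<in> WI I n}"
  have y: "y \<in> Wch I n" using xy Wint_imp_Wch by (auto simp: WI_def)
  have inner: "((\<lambda>x'. q t (x, y) (x', y') * hh y') has_sum (KM hp n t y y' * hh y')) (?X y')" if "y' \<in> Wch I n" for y'
    by (intro has_sum_cmult_left has_sum_qker_target[OF xy that t])
  have "((\<lambda>(y', x'). q t (x, y) (x', y') * hh y') has_sum (exp (c * t) * hh y)) (Sigma (Wch I n) ?X)"
  proof (rule has_sum_SigmaI)
    show "((\<lambda>y'. KM hp n t y y' * hh y') has_sum (exp (c * t) * hh y)) (Wch I n)"
      by (rule hh_eig[OF t y])
    show "(\<lambda>(y', x'). q t (x, y) (x', y') * hh y') summable_on Sigma (Wch I n) ?X"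
    proof (rule summable_on_SigmaI)
      show "(\<lambda>y'. KM hp n t y y' * hh y') summable_on Wch I n"
        using hh_eig[OF t y] by (rule has_sum_imp_summable)
      fix y' x' assume "y' \<in> Wch I n" "x' \<in> ?X y'"
      thus "0 \<le> (case (y', x') of (y', x') \<Rightarrow> q t (x, y) (x', y') * hh y')"
        using qker_nonneg[OF n1 xy, of x' y' t] t hh_pos[of y'] by simp
    qed (use inner in simp)
  qed (use inner in simp)
  also have "?this \<longleftrightarrow> ?thesis"
    by (rule has_sum_reindex_bij_witness[of _ "\<lambda>(x', y'). (y', x')" "\<lambda>(y', x'). (x', y')"])
       (auto simp: WI_def dest: Wint_imp_Wch[simplified])
  finally show ?thesis .
qed

lemma hup_pos:
  assumes x: "x \<in> Wch I (n + 1)"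
  shows "0 < h x"
  unfolding hup_eq[OF x]
proof (rule sum_pos)
  show "Wint I x \<noteq> {}" using Wint_nonempty[OF x] by blast
  fix y assume "y \<in> Wint I x"
  from Wint_imp_Wch[OF x this] show "0 < (\<Prod>i<n. w (y ! i)) * hh y"
    using weight_pos hh_pos by simp
qed (rule finite_Wint[OF x])

text \<open>A finite weighted combination, over the starting \<open>y\<close>, of the eigenfunction
  relation for the two-level kernel.\<close>

lemma hup_eigenfunction:
  assumes t: "0 \<le> t" and x: "x \<in> Wch I (n + 1)"
  shows "((\<lambda>x'. KM p (n + 1) t x x' * h x') has_sum (exp (c * t) * h x)) (Wch I (n + 1))"
proof -
  let ?W = "\<lambda>y. \<Prod>i<n. w (y ! i)"
  have "((\<lambda>xy'. \<Sum>y\<in>Wint I x. ?W y * (q t (x, y) xy' * hh (snd xy')))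
     has_sum (\<Sum>y\<in>Wint I x. ?W y * (exp (c * t) * hh y))) (WI I n)"
    using x by (intro has_sum_finite_sum has_sum_cmult_right qker_eigenfunction t) (auto simp: WI_def)
  also have "(\<Sum>y\<in>Wint I x. ?W y * (exp (c * t) * hh y)) = exp (c * t) * h x"
    unfolding hup_eq[OF x] by (simp add: sum_distrib_left mult_ac)
  finally have sum: "((\<lambda>(x', y'). KM p (n + 1) t x x' * ?W y' * hh y') has_sum (exp (c * t) * h x)) (WI I n)"
  proof (rule has_sum_cong[THEN iffD1, rotated])
    fix xy' assume xy': "xy' \<in> WI I n"
    obtain x' y' where eq: "xy' = (x', y')" by (cases xy')
    have "(\<Sum>y\<in>Wint I x. ?W y * (q t (x, y) xy' * hh (snd xy'))) = (\<Sum>y\<in>Wint I x. ?W y * q t (x, y) (x', y')) * hh y'"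
      by (simp add: eq sum_distrib_left mult_ac)
    also have "(\<Sum>y\<in>Wint I x. ?W y * q t (x, y) (x', y')) = KM p (n + 1) t x x' * ?W y'"
      using xy' eq by (intro sum_qker_start x t) simp
    finally show "(\<Sum>y\<in>Wint I x. ?W y * (q t (x, y) xy' * hh (snd xy'))) = (case xy' of (x', y') \<Rightarrow> KM p (n + 1) t x x' * ?W y' * hh y')"
      by (simp add: eq)
  qed
  show ?thesis
  \<comment> \<open>The sum over pairs is known to converge, so it may be grouped by
    \<open>x'\<close>; each finite fibre rebuilds \<open>h x'\<close>.\<close>
  proof (rule has_sum_SigmaD[OF sum[unfolded WI_eq_Sigma]])
    fix x' assume x': "x' \<in> Wch I (n + 1)"
    show "((\<lambda>y'. case (x', y') of (x', y') \<Rightarrow> KM p (n + 1) t x x' * ?W y' * hh y') has_sum (KM p (n + 1) t x x' * h x')) (Wint I x')"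
      using finite_Wint[OF x'] by (intro has_sum_finiteI) (auto simp: hup_eq[OF x'] sum_distrib_left mult_ac)
  qed
qed

text \<open>Only \<open>x'\<close> survives as intermediate point on the left and only the finite
  fibre over \<open>x\<close> on the right. The Doob factors there cancel, which leaves
  \<open>sum_qker_start\<close>.\<close>

lemma intertwining_two_level:
  assumes t: "0 \<le> t" and x: "x \<in> Wch I (n + 1)" and xy': "(x', y') \<in> WI I n"
  shows "kcomp (Wch I (n + 1)) (doob c h t (KM p (n + 1) t)) (LamH I lam mu n hh) x (x', y')
     = kcomp (WI I n) (LamH I lam mu n hh) (doob c (\<lambda>xy. hh (snd xy)) t (q t)) x (x', y')"
proof -
  let ?W = "\<lambda>y. \<Prod>i<n. w (y ! i)"
  have x': "x' \<in> Wch I (n + 1)" "y' \<in> Wint I x'" using xy' by (auto simp: WI_def)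
  have "kcomp (Wch I (n + 1)) (doob c h t (KM p (n + 1) t)) (LamH I lam mu n hh) x (x', y')
     = infsum (\<lambda>x''. doob c h t (KM p (n + 1) t) x x'' * LamH I lam mu n hh x'' (x', y')) {x'}"
    unfolding kcomp_def using x' by (intro infsum_cong_neutral) (auto simp: LamH_def)
  also have "\<dots> = exp (- c * t) * KM p (n + 1) t x x' * ?W y' * hh y' / h x"
    using x' hup_pos[OF x'(1)] by (simp add: doob_def LamH_def)
  finally have L: "kcomp (Wch I (n + 1)) (doob c h t (KM p (n + 1) t)) (LamH I lam mu n hh) x (x', y') = \<dots>" .
  have "kcomp (WI I n) (LamH I lam mu n hh) (doob c (\<lambda>xy. hh (snd xy)) t (q t)) x (x', y')
     = infsum (\<lambda>xy. LamH I lam mu n hh x xy * doob c (\<lambda>xy. hh (snd xy)) t (q t) xy (x', y')) (Pair x ` Wint I x)"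
    unfolding kcomp_def using x by (intro infsum_cong_neutral) (auto simp: LamH_def WI_def)
  also have "\<dots> = (\<Sum>y\<in>Wint I x. LamH I lam mu n hh x (x, y) * doob c (\<lambda>xy. hh (snd xy)) t (q t) (x, y) (x', y'))"
    using finite_Wint[OF x] by (simp add: sum.reindex inj_on_def)
  also have "\<dots> = (\<Sum>y\<in>Wint I x. exp (- c * t) * hh y' / h x * (?W y * q t (x, y) (x', y')))"
  proof (intro sum.cong HOL.refl)
    fix y assume y: "y \<in> Wint I x"
    have "0 < hh y" using hh_pos Wint_imp_Wch[OF x y] by simp
    thus "LamH I lam mu n hh x (x, y) * doob c (\<lambda>xy. hh (snd xy)) t (q t) (x, y) (x', y')
      = exp (- c * t) * hh y' / h x * (?W y * q t (x, y) (x', y'))"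
      using y by (simp add: LamH_def doob_def)
  qed
  also have "\<dots> = exp (- c * t) * hh y' / h x * (KM p (n + 1) t x x' * ?W y')"
    unfolding sum_distrib_left[symmetric] sum_qker_start[OF x xy' t] ..
  finally show ?thesis unfolding L by simp
qed

text \<open>The weighted kernel is summed over the starting \<open>y\<close> and the target
  \<open>x'\<close> in both orders; since the sum over \<open>y\<close> is finite, the interchange
  is harmless.\<close>

lemma intertwining_one_level:
  assumes t: "0 \<le> t" and x: "x \<in> Wch I (n + 1)" and y': "y' \<in> Wch I n"
  shows "kcomp (Wch I (n + 1)) (doob c h t (KM p (n + 1) t)) (\<lambda>x'' y. LamH I lam mu n hh x'' (x'', y)) x y'
     = kcomp (Wch I n) (\<lambda>x'' y. LamH I lam mu n hh x'' (x'', y)) (doob c hh t (KM hp n t)) x y'"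
proof -
  let ?W = "\<lambda>y. \<Prod>i<n. w (y ! i)"
  let ?C = "exp (- c * t) * hh y' / h x"
  have "((\<lambda>x'. \<Sum>y\<in>Wint I x. ?W y * q t (x, y) (x', y')) has_sum (\<Sum>y\<in>Wint I x. ?W y * KM hp n t y y')) {x'. (x', y') \<in> WI I n}"
    using x by (intro has_sum_finite_sum has_sum_cmult_right has_sum_qker_target y' t) (auto simp: WI_def)
  hence "((\<lambda>x'. KM p (n + 1) t x x' * ?W y') has_sum (\<Sum>y\<in>Wint I x. ?W y * KM hp n t y y')) {x'. (x', y') \<in> WI I n}"
    by (rule has_sum_cong[THEN iffD1, rotated]) (use sum_qker_start[OF x _ t] in simp)
  from infsumI[OF has_sum_cmult_right[OF this, of ?C]]
  have key: "infsum (\<lambda>x'. ?C * (KM p (n + 1) t x x' * ?W y')) {x'. (x', y') \<in> WI I n} = ?C * (\<Sum>y\<in>Wint I x. ?W y * KM hp n t y y')" .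
  have "kcomp (Wch I (n + 1)) (doob c h t (KM p (n + 1) t)) (\<lambda>x'' y. LamH I lam mu n hh x'' (x'', y)) x y'
     = infsum (\<lambda>x'. ?C * (KM p (n + 1) t x x' * ?W y')) {x'. (x', y') \<in> WI I n}"
    unfolding kcomp_def
  proof (rule infsum_cong_neutral)
    fix x' assume "x' \<in> Wch I (n + 1) \<inter> {x'. (x', y') \<in> WI I n}"
    hence "x' \<in> Wch I (n + 1)" "y' \<in> Wint I x'" by (auto simp: WI_def)
    thus "doob c h t (KM p (n + 1) t) x x' * LamH I lam mu n hh x' (x', y') = ?C * (KM p (n + 1) t x x' * ?W y')"
      using hup_pos[of x'] by (simp add: doob_def LamH_def)
  qed (auto simp: WI_def LamH_def)
  also note key
  also have "?C * (\<Sum>y\<in>Wint I x. ?W y * KM hp n t y y') = (\<Sum>y\<in>Wint I x. LamH I lam mu n hh x (x, y) * doob c hh t (KM hp n t) y y')"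
    unfolding sum_distrib_left
  proof (intro sum.cong HOL.refl)
    fix y assume y: "y \<in> Wint I x"
    have "0 < hh y" using hh_pos Wint_imp_Wch[OF x y] by simp
    thus "?C * (?W y * KM hp n t y y') = LamH I lam mu n hh x (x, y) * doob c hh t (KM hp n t) y y'"
      using y by (simp add: LamH_def doob_def)
  qed
  also have "\<dots> = kcomp (Wch I n) (\<lambda>x'' y. LamH I lam mu n hh x'' (x'', y)) (doob c hh t (KM hp n t)) x y'"
  proof -
    have "infsum (\<lambda>y. LamH I lam mu n hh x (x, y) * doob c hh t (KM hp n t) y y') (Wch I n)
      = infsum (\<lambda>y. LamH I lam mu n hh x (x, y) * doob c hh t (KM hp n t) y y') (Wint I x)"
      using Wint_imp_Wch[OF x] by (intro infsum_cong_neutral) (auto simp: LamH_def)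
    thus ?thesis unfolding kcomp_def using finite_Wint[OF x] by simp
  qed
  finally show ?thesis .
qed

end

end

theorem theorem2p8:
  fixes I :: "int set" and lam mu :: "int \<Rightarrow> real" and n :: nat
    and hh :: "int list \<Rightarrow> real" and c :: real
  assumes setting: "bd_setting I lam mu"
    and natural: "natural_boundaries I lam mu"
    and n1: "n \<ge> 1"
    and hh_pos: "\<forall>y\<in>Wch I n. hh y > 0"
    and hh_eig: "\<forall>t\<ge>0. \<forall>y\<in>Wch I n.
        ((\<lambda>y'. KM (hptr I lam mu) n t y y' * hh y') has_sum (exp (c * t) * hh y)) (Wch I n)"
  shows
    "(\<forall>t\<ge>0. \<forall>xy\<in>WI I n.
        ((\<lambda>xy'. qker I lam mu n t xy xy' * hh (snd xy')) has_sum (exp (c * t) * hh (snd xy))) (WI I n))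
   \<and> (\<forall>x\<in>Wch I (n + 1). hup I lam mu n hh x > 0)
   \<and> (\<forall>t\<ge>0. \<forall>x\<in>Wch I (n + 1).
        ((\<lambda>x'. KM (ptr I lam mu) (n + 1) t x x' * hup I lam mu n hh x')
           has_sum (exp (c * t) * hup I lam mu n hh x)) (Wch I (n + 1)))
   \<and> (\<forall>t\<ge>0. \<forall>x\<in>Wch I (n + 1). \<forall>xy'\<in>WI I n.
        kcomp (Wch I (n + 1))
          (doob c (hup I lam mu n hh) t (KM (ptr I lam mu) (n + 1) t))
          (LamH I lam mu n hh) x xy'
      = kcomp (WI I n)
          (LamH I lam mu n hh)
          (doob c (\<lambda>xy. hh (snd xy)) t (qker I lam mu n t)) x xy')
   \<and> (\<forall>t\<ge>0. \<forall>x\<in>Wch I (n + 1). \<forall>y'\<in>Wch I n.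
        kcomp (Wch I (n + 1))
          (doob c (hup I lam mu n hh) t (KM (ptr I lam mu) (n + 1) t))
          (\<lambda>x'' y. LamH I lam mu n hh x'' (x'', y)) x y'
      = kcomp (Wch I n)
          (\<lambda>x'' y. LamH I lam mu n hh x'' (x'', y))
          (doob c hh t (KM (hptr I lam mu) n t)) x y')"
proof -
  note * = n1 hh_pos hh_eig
  obtain f where "bd_lyapunov I lam mu f" using lyapunov_exists[OF setting natural] by blast
  then interpret bd_lyapunov I lam mu f .
  show ?thesis
  proof (intro conjI ballI allI impI)
    fix t :: real and xy assume "0 \<le> t" "xy \<in> WI I n"
    thus "((\<lambda>xy'. qker I lam mu n t xy xy' * hh (snd xy')) has_sum (exp (c * t) * hh (snd xy))) (WI I n)"
      using qker_eigenfunction[OF *, of t "fst xy" "snd xy"] by simp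
  next
    fix x assume "x \<in> Wch I (n + 1)"
    thus "hup I lam mu n hh x > 0" by (rule hup_pos[OF *])
  next
    fix t :: real and x assume "0 \<le> t" "x \<in> Wch I (n + 1)"
    thus "((\<lambda>x'. KM (ptr I lam mu) (n + 1) t x x' * hup I lam mu n hh x')
           has_sum (exp (c * t) * hup I lam mu n hh x)) (Wch I (n + 1))"
      by (rule hup_eigenfunction[OF *])
  next
    fix t :: real and x xy' assume "0 \<le> t" "x \<in> Wch I (n + 1)" "xy' \<in> WI I n"
    thus "kcomp (Wch I (n + 1)) (doob c (hup I lam mu n hh) t (KM (ptr I lam mu) (n + 1) t)) (LamH I lam mu n hh) x xy'
      = kcomp (WI I n) (LamH I lam mu n hh) (doob c (\<lambda>xy. hh (snd xy)) t (qker I lam mu n t)) x xy'"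
      using intertwining_two_level[OF *, of t x "fst xy'" "snd xy'"] by simp
  next
    fix t :: real and x y' assume "0 \<le> t" "x \<in> Wch I (n + 1)" "y' \<in> Wch I n"
    thus "kcomp (Wch I (n + 1)) (doob c (hup I lam mu n hh) t (KM (ptr I lam mu) (n + 1) t))
          (\<lambda>x'' y. LamH I lam mu n hh x'' (x'', y)) x y'
      = kcomp (Wch I n) (\<lambda>x'' y. LamH I lam mu n hh x'' (x'', y)) (doob c hh t (KM (hptr I lam mu) n t)) x y'"
      by (rule intertwining_one_level[OF *])
  qed
qed

end
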